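(* Let $q$, $r$ be positive integers and $k \geq 3$ an integer, and let $R \subseteq [q]^r$ be a permutation-invariant relation of arity $r$ over $[q]$ from which an OR relation of arity $k$ is definable. Then, for any real $\varepsilon > 0$, the $R$-Constrained Coloring problem parameterized by the number of vertices $n$ does not admit a compression of size $O(n^{k-\varepsilon})$ unless $\mathsf{NP} \subseteq \mathsf{coNP}/\mathsf{poly}$.
   Context: $[q]=\{1,\dots,q\}$. A relation $R\subseteq[q]^r$ is permutation-invariant if for every permutation $\pi$ of $[q]$ and every $(x_1,\dots,x_r)\in[q]^r$, $(x_1,\dots,x_r)\in R$ iff $(\pi(x_1),\dots,\pi(x_r))\in R$. An OR relation of arity $k$ is definable from $R$ if there exist sets $D_1,\dots,D_r\subseteq[q]$, exactly $k$ of size $2$ and the others of size $1$, such that $|(D_1\times\cdots\times D_r)\cap R|=2^k-1$. The $R$-Constrained Coloring problem: the input is a graph $G=(V,E)$ and a collection $\mathcal{F}\subseteq V^r$; the question is whether there is a proper coloring $c:V\to[q]$ of $G$ (adjacent vertices get distinct colors) such that $(c(x_1),\dots,c(x_r))\in R$ for every $(x_1,\dots,x_r)\in\mathcal{F}$. The parameter is $n=|V|$. A parameterized problem is a set $Q\subseteq\Sigma^*\times\mathbb{N}$. A compression of $Q$ into a parameterized problem $Q'$ is a polynomial-time algorithm mapping $(x,k)$ to $(x',k')$ with $(x,k)\in Q\iff(x',k')\in Q'$ and $|x'|+k'\le h(k)$ for a computable function $h$ (the size). $Q$ admits a compression of size $h$ if such a compression exists into some parameterized problem $Q'$. *)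

theory Defs
  imports
    "HOL-Combinatorics.Permutations"
    "HOL-Computational_Algebra.Polynomial"
    "HOL-Library.Landau_Symbols"
begin

section \<open>Relations over \<open>[q]\<close>\<close>

text \<open>Tuples are lists, so a relation of arity \<open>r\<close> is a set of lists of length \<open>r\<close>.\<close>

definition tuples :: "'a set \<Rightarrow> nat \<Rightarrow> 'a list set" where
  "tuples A r = {xs. length xs = r \<and> set xs \<subseteq> A}"

definition permutation_invariant :: "nat \<Rightarrow> nat \<Rightarrow> nat list set \<Rightarrow> bool" where
  "permutation_invariant q r R \<longleftrightarrow>
     (\<forall>\<pi>. \<pi> permutes {1..q} \<longrightarrow> (\<forall>xs \<in> tuples {1..q} r. xs \<in> R \<longleftrightarrow> map \<pi> xs \<in> R))"

definition OR_definable :: "nat \<Rightarrow> nat \<Rightarrow> nat list set \<Rightarrow> nat \<Rightarrow> bool" where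
  "OR_definable q r R k \<longleftrightarrow>
     (\<exists>Ds :: nat set list.
        length Ds = r \<and> (\<forall>D \<in> set Ds. D \<subseteq> {1..q} \<and> card D \<in> {1, 2}) \<and>
        card {i. i < r \<and> card (Ds ! i) = 2} = k \<and>
        card (listset Ds \<inter> R) = 2 ^ k - 1)"


section \<open>Turing machines and polynomial time\<close>

text \<open>
  Deterministic machines with finitely many two-way infinite tapes. The states are
  \<open>0, \<dots>, states M\<close>, where \<open>0\<close> is the initial and \<open>states M\<close> the halting state; the tape
  alphabet is \<open>{0, \<dots>, symbols M - 1}\<close>, where \<open>0\<close> is the blank and \<open>1\<close>, \<open>2\<close> represent the bits.
  The transition function maps a state and the list of scanned symbols to the new state
  and, for each tape, the symbol written and the head move.
\<close>

datatype move = Go_Left | Stay | Go_Right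

fun move_offset :: "move \<Rightarrow> int" where
  "move_offset Go_Left = - 1"
| "move_offset Stay = 0"
| "move_offset Go_Right = 1"

record tm =
  tapes :: nat
  states :: nat
  symbols :: nat
  delta :: "nat \<Rightarrow> nat list \<Rightarrow> nat \<times> (nat \<times> move) list"

definition wf_tm :: "tm \<Rightarrow> bool" where
  "wf_tm M \<longleftrightarrow> tapes M \<ge> 2 \<and> symbols M \<ge> 3 \<and>
     (\<forall>s < states M. \<forall>as \<in> tuples {..<symbols M} (tapes M).
        case delta M s as of (s', ws) \<Rightarrow>
          s' \<le> states M \<and> length ws = tapes M \<and> fst ` set ws \<subseteq> {..<symbols M})"

text \<open>A tape consists of its contents and the position of the head.\<close>

type_synonym tape = "(int \<Rightarrow> nat) \<times> int"
type_synonym config = "nat \<times> tape list"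

definition scanned :: "tape \<Rightarrow> nat" where
  "scanned t = fst t (snd t)"

definition update_tape :: "tape \<Rightarrow> nat \<times> move \<Rightarrow> tape" where
  "update_tape t w = ((fst t)(snd t := fst w), snd t + move_offset (snd w))"

fun step :: "tm \<Rightarrow> config \<Rightarrow> config" where
  "step M (s, ts) =
     (if s < states M
      then case delta M s (map scanned ts) of (s', ws) \<Rightarrow> (s', map2 update_tape ts ws)
      else (s, ts))"

definition bit_symbol :: "bool \<Rightarrow> nat" where
  "bit_symbol b = (if b then 2 else 1)"

definition word_tape :: "bool list \<Rightarrow> tape" where
  "word_tape w = ((\<lambda>i. if 0 \<le> i \<and> i < int (length w) then bit_symbol (w ! nat i) else 0), 0)"

definition initial_config :: "tm \<Rightarrow> bool list \<Rightarrow> config" where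
  "initial_config M w = (0, word_tape w # replicate (tapes M - 1) (word_tape []))"

text \<open>The word on a tape extends from the head to the right up to the first blank.\<close>

definition tape_word :: "tape \<Rightarrow> bool list \<Rightarrow> bool" where
  "tape_word t w \<longleftrightarrow>
     (\<forall>i < length w. fst t (snd t + int i) = bit_symbol (w ! i)) \<and>
     fst t (snd t + int (length w)) = 0"

text \<open>
  The input is written on the first tape and the output is read from the second one.
  Since \<open>step\<close> does not change halting configurations, \<open>T\<close> is an upper bound on the running time.
\<close>

definition outputs_within :: "tm \<Rightarrow> nat \<Rightarrow> bool list \<Rightarrow> bool list \<Rightarrow> bool" where
  "outputs_within M T x y \<longleftrightarrow>
     (case (step M ^^ T) (initial_config M x) of (s, ts) \<Rightarrow>
        s = states M \<and> tape_word (ts ! 1) y)"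

definition computable :: "('a \<Rightarrow> bool list) \<Rightarrow> ('b \<Rightarrow> bool list) \<Rightarrow> ('a \<Rightarrow> 'b) \<Rightarrow> bool" where
  "computable enc enc' f \<longleftrightarrow>
     (\<exists>M. wf_tm M \<and> (\<forall>x. \<exists>T. outputs_within M T (enc x) (enc' (f x))))"

definition poly_time_computable ::
    "('a \<Rightarrow> bool list) \<Rightarrow> ('b \<Rightarrow> bool list) \<Rightarrow> ('a \<Rightarrow> 'b) \<Rightarrow> bool" where
  "poly_time_computable enc enc' f \<longleftrightarrow>
     (\<exists>M (p :: nat poly). wf_tm M \<and>
        (\<forall>x. outputs_within M (poly p (length (enc x))) (enc x) (enc' (f x))))"


section \<open>Encodings\<close>

definition unary :: "nat \<Rightarrow> bool list" where
  "unary n = replicate n True"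

definition encode_bool :: "bool \<Rightarrow> bool list" where
  "encode_bool b = [b]"

fun encode_pair :: "bool list \<times> bool list \<Rightarrow> bool list" where
  "encode_pair (x, y) = concat (map (\<lambda>b. [True, b]) x) @ [False] @ y"

text \<open>The parameter is encoded in unary, so polynomial time means polynomial in \<open>|x| + k\<close>.\<close>

fun encode_param :: "bool list \<times> nat \<Rightarrow> bool list" where
  "encode_param (x, k) = encode_pair (x, unary k)"

lemma encode_pair_inject: "encode_pair (x, y) = encode_pair (x', y') \<Longrightarrow> x = x' \<and> y = y'"
proof (induction x arbitrary: x')
  case Nil
  then show ?case by (cases x') auto
next
  case (Cons a x)
  then show ?case by (cases x') auto
qed

lemma inj_encode_pair: "inj encode_pair"
proof (rule injI)
  fix a b assume "encode_pair a = encode_pair b"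
  then show "a = b"
    using encode_pair_inject[of "fst a" "snd a" "fst b" "snd b"] by (simp add: prod_eq_iff)
qed

lemma inj_encode_param: "inj encode_param"
proof (rule injI)
  fix a b assume eq: "encode_param a = encode_param b"
  obtain x k y l where ab: "a = (x, k)" "b = (y, l)" by (cases a, cases b)
  with eq have "x = y \<and> unary k = unary l"
    using encode_pair_inject[of x "unary k" y "unary l"] by (simp del: encode_pair.simps)
  moreover have "k = l" if "unary k = unary l"
    using arg_cong[OF that, of length] by (simp add: unary_def)
  ultimately show "a = b" using ab by simp
qed


section \<open>Complexity classes\<close>

definition NP :: "bool list set set" where
  "NP = {L. \<exists>V (p :: nat poly). poly_time_computable encode_pair encode_bool V \<and>
           (\<forall>x. x \<in> L \<longleftrightarrow> (\<exists>u. length u \<le> poly p (length x) \<and> V (x, u)))}"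

definition coNP :: "bool list set set" where
  "coNP = {L. - L \<in> NP}"

definition with_poly_advice :: "bool list set set \<Rightarrow> bool list set set" where
  "with_poly_advice C = {L. \<exists>L' \<in> C. \<exists>(a :: nat \<Rightarrow> bool list) (p :: nat poly).
           (\<forall>n. length (a n) \<le> poly p n) \<and>
           (\<forall>x. x \<in> L \<longleftrightarrow> encode_pair (x, a (length x)) \<in> L')}"


section \<open>Parameterized problems and compressions\<close>

type_synonym param_problem = "(bool list \<times> nat) set"

definition is_compression ::
    "param_problem \<Rightarrow> param_problem \<Rightarrow> (nat \<Rightarrow> nat) \<Rightarrow> (bool list \<times> nat \<Rightarrow> bool list \<times> nat) \<Rightarrow> bool" where
  "is_compression Q Q' h f \<longleftrightarrow>
     poly_time_computable encode_param encode_param f \<and>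
     (\<forall>x k. (x, k) \<in> Q \<longleftrightarrow> f (x, k) \<in> Q') \<and>
     computable unary unary h \<and>
     (\<forall>x k. case f (x, k) of (x', k') \<Rightarrow> length x' + k' \<le> h k)"

definition admits_compression :: "param_problem \<Rightarrow> (nat \<Rightarrow> nat) \<Rightarrow> bool" where
  "admits_compression Q h \<longleftrightarrow> (\<exists>Q' f. is_compression Q Q' h f)"

definition admits_compression_bigo :: "param_problem \<Rightarrow> (nat \<Rightarrow> real) \<Rightarrow> bool" where
  "admits_compression_bigo Q g \<longleftrightarrow>
     (\<exists>h. (\<lambda>n. real (h n)) \<in> O(g) \<and> admits_compression Q h)"


section \<open>Constrained coloring\<close>

definition simple_graph :: "'a set \<Rightarrow> 'a set set \<Rightarrow> bool" where
  "simple_graph V E \<longleftrightarrow> finite V \<and> (\<forall>e \<in> E. e \<subseteq> V \<and> card e = 2)"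

definition proper_coloring :: "nat \<Rightarrow> 'a set \<Rightarrow> 'a set set \<Rightarrow> ('a \<Rightarrow> nat) \<Rightarrow> bool" where
  "proper_coloring q V E c \<longleftrightarrow>
     c ` V \<subseteq> {1..q} \<and> (\<forall>u v. {u, v} \<in> E \<longrightarrow> c u \<noteq> c v)"

definition constrained_colorable ::
    "nat \<Rightarrow> nat list set \<Rightarrow> 'a set \<Rightarrow> 'a set set \<Rightarrow> 'a list set \<Rightarrow> bool" where
  "constrained_colorable q R V E F \<longleftrightarrow>
     (\<exists>c. proper_coloring q V E c \<and> (\<forall>xs \<in> F. map c xs \<in> R))"

text \<open>
  An instance on the vertex set \<open>{0, \<dots>, n - 1}\<close> is written as \<open>n\<close>, a list of edges and a list of
  constraint tuples. Vertices are in unary, which is polynomially equivalent to binary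
  because the \<open>n\<close> vertices are part of the input.
\<close>

definition encode_nat :: "nat \<Rightarrow> bool list" where
  "encode_nat n = replicate n True @ [False]"

definition encode_list :: "('a \<Rightarrow> bool list) \<Rightarrow> 'a list \<Rightarrow> bool list" where
  "encode_list enc xs = concat (map (\<lambda>x. True # enc x) xs) @ [False]"

definition encode_instance :: "nat \<Rightarrow> (nat \<times> nat) list \<Rightarrow> nat list list \<Rightarrow> bool list" where
  "encode_instance n es fs =
     encode_nat n @ encode_list (\<lambda>(u, v). encode_nat u @ encode_nat v) es @
     encode_list (\<lambda>xs. concat (map encode_nat xs)) fs"

definition edge_set :: "(nat \<times> nat) list \<Rightarrow> nat set set" where
  "edge_set es = (\<lambda>(u, v). {u, v}) ` set es"

definition constrained_coloring :: "nat \<Rightarrow> nat \<Rightarrow> nat list set \<Rightarrow> param_problem" where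
  "constrained_coloring q r R =
     {(encode_instance n es fs, n) | n es fs.
        simple_graph {..<n} (edge_set es) \<and> set fs \<subseteq> tuples {..<n} r \<and>
        constrained_colorable q R {..<n} (edge_set es) (set fs)}"

text \<open>Words determine instances uniquely.\<close>

lemma encode_nat_append_inject:
  "encode_nat m @ x = encode_nat n @ y \<Longrightarrow> m = n \<and> x = y"
proof (induction m arbitrary: n)
  case 0
  then show ?case by (cases n) (auto simp: encode_nat_def)
next
  case (Suc m)
  then show ?case by (cases n) (auto simp: encode_nat_def)
qed

lemma encode_nats_append_inject:
  "length xs = length ys \<Longrightarrow>
   concat (map encode_nat xs) @ x = concat (map encode_nat ys) @ y \<Longrightarrow> xs = ys \<and> x = y"
proof (induction xs ys rule: list_induct2)
  case (Cons a xs b ys)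
  then show ?case
    using encode_nat_append_inject[of a "concat (map encode_nat xs) @ x" b "concat (map encode_nat ys) @ y"]
    by simp
qed simp

lemma encode_list_append_inject:
  assumes "\<And>a b x y. a \<in> set as \<Longrightarrow> b \<in> set bs \<Longrightarrow> enc a @ x = enc b @ y \<Longrightarrow> a = b \<and> x = y"
    and "encode_list enc as @ x = encode_list enc bs @ y"
  shows "as = bs \<and> x = y"
  using assms
proof (induction as arbitrary: bs)
  case Nil
  then show ?case by (cases bs) (auto simp: encode_list_def)
next
  case (Cons a as)
  show ?case
  proof (cases bs)
    case Nil
    with Cons.prems(2) show ?thesis by (simp add: encode_list_def)
  next
    case (Cons b bs')
    have "enc a @ (encode_list enc as @ x) = enc b @ (encode_list enc bs' @ y)"
      using Cons.prems(2) Cons by (simp add: encode_list_def)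
    then have ab: "a = b \<and> encode_list enc as @ x = encode_list enc bs' @ y"
      using Cons.prems(1)[of a b] Cons by auto
    moreover have "as = bs' \<and> x = y"
      using Cons.IH[of bs'] Cons.prems(1) Cons ab by auto
    ultimately show ?thesis using Cons by simp
  qed
qed

lemma encode_instance_inject:
  assumes "set fs \<subseteq> tuples A r" "set fs' \<subseteq> tuples A' r"
    and eq: "encode_instance n es fs = encode_instance n' es' fs'"
  shows "n = n' \<and> es = es' \<and> fs = fs'"
proof -
  let ?e = "\<lambda>(u, v). encode_nat u @ encode_nat v"
  let ?f = "\<lambda>xs. concat (map encode_nat xs)"
  have n: "n = n'" and
    1: "encode_list ?e es @ encode_list ?f fs = encode_list ?e es' @ encode_list ?f fs'"
    using encode_nat_append_inject[OF eq[unfolded encode_instance_def]] by simp_all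
  have es: "es = es' \<and> encode_list ?f fs = encode_list ?f fs'"
    by (rule encode_list_append_inject[OF _ 1]) (auto dest!: encode_nat_append_inject)
  have "fs = fs' \<and> ([] :: bool list) = []"
  proof (rule encode_list_append_inject[of fs fs' ?f])
    fix a b x y
    assume "a \<in> set fs" "b \<in> set fs'" and e: "?f a @ x = ?f b @ y"
    then have "length a = length b" using assms(1,2) by (auto simp: tuples_def)
    then show "a = b \<and> x = y" using e by (rule encode_nats_append_inject)
  qed (use es in simp)
  with n es show ?thesis by simp
qed

end

theory Submission
  imports Defs
begin

text \<open>
  Let \<open>L \<in> NP\<close>. A non-uniform Cook--Levin theorem gives a formula of size polynomial in \<open>s\<close> in which the
  bits of the word \<open>x\<close> of length \<open>s\<close> are variables. The disjunction of \<open>m\<^sup>k\<close> such questions, indexed by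
  \<open>[m]\<^sup>k\<close>, is expressed by \<open>k\<close>-clauses over only \<open>m\<close> times polynomially many variables: select a
  coordinate in each of the \<open>k\<close> directions, and let one \<open>k\<close>-clause per instance and bit transfer the
  bits of the selected instance. A definable OR relation of arity \<open>k\<close> turns each \<open>k\<close>-clause into one
  constraint tuple, where a clique of palette vertices fixes the names of the colors up to
  a permutation.

  A compression to size \<open>O(n\<^bsup>k-\<epsilon>\<^esup>)\<close> then maps \<open>m\<^sup>k\<close> words, for a suitable polynomial \<open>m\<close>, to fewer
  than \<open>m\<^sup>k\<close> bits. By counting, some output is the image of families of non-members of \<open>L\<close> that show at least half
  of all non-members at some fixed index. Iterating this, \<open>s + 1\<close> outputs suffice to witness all non-members
  of length \<open>s\<close>; together with the skeleton of the coloring instance they form the advice. The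
  verifier inserts the tested word and guessed words into the skeleton, runs the compression and compares the result
  with the chosen output.
\<close>

section \<open>Turing machines relative to their heads\<close>

text \<open>Non-uniformity shapes the whole argument: formula, graph and chosen outputs depend on
  the word length alone and may be stored, so it is enough that they exist and have polynomial size.
  The only algorithm a machine must execute is the compression, wrapped into a verifier that copies
  symbols, inserts bits and compares. To make this possible, an instance depends on the words in a
  very simple way: each bit decides whether one vertex number, written in unary, is increased by
  one.

  With m poly(s) vertices the compressed size is at most m^(k-\<epsilon>) poly(s), a small fraction
  of m^k once m^\<epsilon> exceeds the polynomial; this dictates a number of variables linear in m.
  A stored output certifies non-membership because it is the image of a family of non-members: it
  lies outside the target problem, so no family with the same output contains a member. The
  assumption k \<ge> 3 lets the 3-clauses of the skeleton use the same gadget as the transfer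
  clauses.\<close>

type_synonym rtape = "int \<Rightarrow> nat"

text \<open>A tape seen from its head: absolute positions disappear, so a configuration can be
  described by the words to the left and to the right of each head.\<close>

definition rel :: "tape \<Rightarrow> rtape" where
  "rel t = (\<lambda>i. fst t (snd t + i))"

definition rupd :: "rtape \<Rightarrow> nat \<times> move \<Rightarrow> rtape" where
  "rupd t w = (\<lambda>i. (t(0 := fst w)) (i + move_offset (snd w)))"

fun rstep :: "tm \<Rightarrow> nat \<times> rtape list \<Rightarrow> nat \<times> rtape list" where
  "rstep M (s, ts) =
     (if s < states M
      then case delta M s (map (\<lambda>t. t 0) ts) of (s', ws) \<Rightarrow> (s', map2 rupd ts ws)
      else (s, ts))"

definition rword :: "rtape \<Rightarrow> bool list \<Rightarrow> bool" where
  "rword t w \<longleftrightarrow> (\<forall>i < length w. t (int i) = bit_symbol (w ! i)) \<and> t (int (length w)) = 0"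

lemma rel_update_tape: "rel (update_tape t w) = rupd (rel t) w"
  by (auto simp: rel_def update_tape_def rupd_def fun_eq_iff ac_simps)

lemma rel_0: "rel t 0 = scanned t"
  by (simp add: rel_def scanned_def)

lemma map_rel_map2: "map rel (map2 update_tape ts ws) = map2 rupd (map rel ts) ws"
  by (induction ts ws rule: list_induct2') (auto simp: rel_update_tape)

lemma rstep_map_rel: "rstep M (s, map rel ts) = map_prod id (map rel) (step M (s, ts))"
  using map_rel_map2 by (auto simp: rel_0 comp_def split: prod.split)

lemma rstep_funpow_rel:
  "(rstep M ^^ n) (map_prod id (map rel) c) = map_prod id (map rel) ((step M ^^ n) c)"
proof (induction n)
  case (Suc n)
  then show ?case
    by (cases "(step M ^^ n) c") (simp add: rstep_map_rel id_def del: step.simps rstep.simps)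
qed simp

lemma tape_word_rel: "tape_word t w \<longleftrightarrow> rword (rel t) w"
  by (simp add: tape_word_def rword_def rel_def)

section \<open>Invariants of runs and stability after halting\<close>

definition valid_config :: "tm \<Rightarrow> config \<Rightarrow> bool" where
  "valid_config M c \<longleftrightarrow> fst c \<le> states M \<and> length (snd c) = tapes M \<and>
     (\<forall>t \<in> set (snd c). \<forall>i. fst t i < symbols M)"

lemma valid_config_scanned:
  "valid_config M (s, ts) \<Longrightarrow> map scanned ts \<in> tuples {..<symbols M} (tapes M)"
  by (auto simp: valid_config_def tuples_def scanned_def)

lemma wf_tm_delta:
  assumes "wf_tm M" "s < states M" "as \<in> tuples {..<symbols M} (tapes M)" "delta M s as = (s', ws)"
  shows "s' \<le> states M" "length ws = tapes M" "fst ` set ws \<subseteq> {..<symbols M}"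
  using assms unfolding wf_tm_def by fastforce+

lemma valid_config_step:
  assumes "wf_tm M" "valid_config M c"
  shows "valid_config M (step M c)"
proof (cases c)
  case (Pair s ts)
  show ?thesis
  proof (cases "s < states M")
    case True
    obtain s' ws where d: "delta M s (map scanned ts) = (s', ws)" by fastforce
    note w = wf_tm_delta[OF assms(1) True valid_config_scanned[OF assms(2)[unfolded Pair]] d]
    have v: "length ts = tapes M" "\<And>t i. t \<in> set ts \<Longrightarrow> fst t i < symbols M"
      using assms(2) Pair by (auto simp: valid_config_def)
    have "fst (update_tape t x) i < symbols M" if "(t, x) \<in> set (zip ts ws)" for t x i
    proof -
      have "t \<in> set ts" "x \<in> set ws" using that by (auto dest: set_zip_leftD set_zip_rightD)
      then have "fst x < symbols M" using w(3) by auto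
      then show ?thesis using v(2)[OF \<open>t \<in> set ts\<close>] by (simp add: update_tape_def)
    qed
    then show ?thesis using True Pair d w v(1) by (auto simp: valid_config_def)
  qed (use assms Pair in simp)
qed

lemma valid_config_initial: "wf_tm M \<Longrightarrow> valid_config M (initial_config M w)"
  by (auto simp: valid_config_def initial_config_def word_tape_def bit_symbol_def wf_tm_def)

lemma valid_config_funpow:
  "wf_tm M \<Longrightarrow> valid_config M ((step M ^^ n) (initial_config M w))"
  by (induction n) (auto simp: valid_config_initial valid_config_step)

lemma step_halted: "fst c = states M \<Longrightarrow> (step M ^^ n) c = c"
  by (induction n) (cases c; auto)+

lemma step_funpow_mono:
  assumes "fst ((step M ^^ n) c) = states M" "n \<le> n'"
  shows "(step M ^^ n') c = (step M ^^ n) c"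
proof -
  have "(step M ^^ n') c = (step M ^^ (n' - n)) ((step M ^^ n) c)"
    using assms(2) by (metis comp_apply funpow_add le_add_diff_inverse2)
  with assms(1) show ?thesis by (simp add: step_halted)
qed

text \<open>The tape with \<open>r\<close> written from the head to the right and \<open>l\<close> from the head to the left.\<close>

definition zt :: "nat list \<Rightarrow> nat list \<Rightarrow> rtape" where
  "zt l r = (\<lambda>i. if 0 \<le> i then (if nat i < length r then r ! nat i else 0)
                 else (if nat (- i - 1) < length l then l ! nat (- i - 1) else 0))"

lemma zt_0 [simp]: "zt l (a # r) 0 = a" "zt l [] 0 = 0"
  by (simp_all add: zt_def)

text \<open>A written blank cannot be told from an unvisited cell; this lets the rules for a
  nonempty word also treat a head at its end.\<close>

lemma zt_trailing_blank: "zt l [0] = zt l []" "zt [0] r = zt [] r"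
  by (auto simp: zt_def fun_eq_iff)

lemma rupd_zt_right: "rupd (zt l (a # r)) (b, Go_Right) = zt (b # l) r"
proof
  fix i
  have "nat (i + 1) = Suc (nat i)" if "0 \<le> i" using that by simp
  moreover have "nat (- i - 1) = Suc (nat (- i - 2))" if "i < -1" using that by simp
  ultimately show "rupd (zt l (a # r)) (b, Go_Right) i = zt (b # l) r i"
    by (cases "i \<ge> 0"; cases "i = -1") (auto simp: zt_def rupd_def algebra_simps)
qed

lemma rupd_zt_right_Nil: "rupd (zt l []) (b, Go_Right) = zt (b # l) []"
  using rupd_zt_right[of l 0 "[]" b] by (simp add: zt_trailing_blank)

lemma rupd_zt_left: "rupd (zt (c # l) (a # r)) (b, Go_Left) = zt l (c # b # r)"
proof
  fix i :: int
  consider "i \<ge> 2" | "i = 1" | "i = 0" | "i < 0" by linarith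
  then show "rupd (zt (c # l) (a # r)) (b, Go_Left) i = zt l (c # b # r) i"
  proof cases
    case 1
    then obtain n where "i = int n + 2" using zle_iff_zadd[of 2 i] by auto
    then show ?thesis by (auto simp: zt_def rupd_def nat_add_distrib numeral_2_eq_2 nth_Cons')
  next
    case 4
    then have "i = - int (nat (- i - 1)) - 1" by simp
    then obtain n where "i = - int n - 1" by blast
    then show ?thesis by (auto simp: zt_def rupd_def nat_add_distrib)
  qed (auto simp: zt_def rupd_def)
qed

lemma rupd_zt_left_Nil: "rupd (zt [] (a # r)) (b, Go_Left) = zt [] (0 # b # r)"
  using rupd_zt_left[of 0 "[]" a r b] by (simp add: zt_trailing_blank)

lemma rupd_zt_stay: "rupd (zt l (a # r)) (b, Stay) = zt l (b # r)"
  by (auto simp: zt_def rupd_def fun_eq_iff nth_Cons')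

lemma rupd_scanned_stay: "rupd t (t 0, Stay) = t"
  by (auto simp: rupd_def fun_eq_iff)

lemma rel_word_tape: "rel (word_tape w) = zt [] (map bit_symbol w)"
  by (auto simp: rel_def word_tape_def zt_def fun_eq_iff)

lemma rword_zt: "rword (zt l (map bit_symbol w)) w"
  by (auto simp: rword_def zt_def)

lemma outputs_within_rstepI:
  assumes "(rstep M ^^ n) (0, zt [] (map bit_symbol x) # replicate (tapes M - 1) (zt [] [])) = (states M, ts)"
    and "n \<le> T" "length ts \<ge> 2" "rword (ts ! 1) y"
  shows "outputs_within M T x y"
proof -
  obtain s' ts' where c: "(step M ^^ n) (initial_config M x) = (s', ts')" by fastforce
  have "map_prod id (map rel) (initial_config M x) =
      (0, zt [] (map bit_symbol x) # replicate (tapes M - 1) (zt [] []))"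
    by (simp add: initial_config_def rel_word_tape)
  then have 1: "s' = states M" "map rel ts' = ts"
    using rstep_funpow_rel[of n M "initial_config M x"] assms(1) c by auto
  then have "(step M ^^ T) (initial_config M x) = (s', ts')"
    using step_funpow_mono[OF _ assms(2)] c by simp
  then show ?thesis using 1 assms(3,4) by (auto simp: outputs_within_def tape_word_rel)
qed

text \<open>With an upper bound in place of the exact number of steps, the bounds of consecutive
  phases add up and cases of different length share one statement.\<close>

definition reaches :: "tm \<Rightarrow> nat \<Rightarrow> nat \<times> rtape list \<Rightarrow> nat \<times> rtape list \<Rightarrow> bool" where
  "reaches M b c c' \<longleftrightarrow> (\<exists>n \<le> b. (rstep M ^^ n) c = c')"

lemma reaches_trans:
  assumes "reaches M a c c'" "reaches M b c' c''"
  shows "reaches M (a + b) c c''"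
proof -
  from assms obtain n m where "n \<le> a" "m \<le> b" "(rstep M ^^ n) c = c'" "(rstep M ^^ m) c' = c''"
    by (auto simp: reaches_def)
  then show ?thesis
    unfolding reaches_def by (intro exI[of _ "m + n"]) (simp add: funpow_add)
qed

lemma reaches_step: "rstep M c = c' \<Longrightarrow> reaches M 1 c c'"
  unfolding reaches_def by (rule exI[of _ 1]) simp

lemma reaches_Suc: "rstep M c = c' \<Longrightarrow> reaches M b c' c'' \<Longrightarrow> reaches M (Suc b) c c''"
  using reaches_trans[OF reaches_step] by fastforce

lemma reaches_mono: "reaches M a c c' \<Longrightarrow> a \<le> b \<Longrightarrow> reaches M b c c'"
  unfolding reaches_def using order_trans by blast

section \<open>The verifier machine\<close>

text \<open>An action keeps (\<open>None\<close>) or overwrites the scanned symbol and then moves the head.\<close>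

type_synonym action = "nat option \<times> move"

definition write_of :: "nat \<Rightarrow> action \<Rightarrow> nat \<times> move" where
  "write_of a x = (case fst x of None \<Rightarrow> a | Some b \<Rightarrow> b, snd x)"

definition ract :: "rtape \<Rightarrow> action \<Rightarrow> rtape" where
  "ract t x = rupd t (write_of (t 0) x)"

abbreviation keep :: action where "keep \<equiv> (None, Stay)"
abbreviation mvL :: action where "mvL \<equiv> (None, Go_Left)"
abbreviation mvR :: action where "mvR \<equiv> (None, Go_Right)"

lemma ract_keep [simp]: "ract t keep = t"
  by (simp add: ract_def write_of_def rupd_scanned_stay)

lemma map2_ract_keep [simp]: "length ts = n \<Longrightarrow> map2 ract ts (replicate n keep) = ts"
  by (induction ts arbitrary: n) auto

text \<open>The tape from which \<open>l\<close> is read leftwards, starting at the head.\<close>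

definition rl :: "nat list \<Rightarrow> nat list \<Rightarrow> rtape" where
  "rl l r = (case l of [] \<Rightarrow> zt [] (0 # r) | a # l' \<Rightarrow> zt l' (a # r))"

lemma rl_0 [simp]: "rl [] r 0 = 0" "rl (a # l) r 0 = a"
  by (simp_all add: rl_def)

text \<open>What lies to the right of a reading head is never visited again, so only its existence
  is recorded. Past the end the word stays empty, matching \<open>tl [] = []\<close>.\<close>

lemma rl_mvL: "\<exists>r'. ract (rl l r) mvL = rl (tl l) r'"
  by (cases l; cases "tl l")
    (auto simp: rl_def ract_def write_of_def rupd_zt_left rupd_zt_left_Nil simp del: fun_upd_apply)

text \<open>The turn from writing to reading: the cell under the head, blank or an unfinished
  symbol, is left behind, and the last finished symbol becomes the first one read.\<close>

lemma zt_mvL: "\<exists>r'. ract (zt l [c]) mvL = rl l r'"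
  by (cases l) (auto simp: rl_def ract_def write_of_def rupd_zt_left rupd_zt_left_Nil)

lemma zt_mvL_Nil: "\<exists>r'. ract (zt l []) mvL = rl l r'"
  using zt_mvL[of l 0] by (simp add: zt_trailing_blank)

lemma ract_zt:
  "ract (zt l (a # r)) mvR = zt (a # l) r"
  "ract (zt l []) (Some b, Go_Right) = zt (b # l) []"
  "ract (zt l [c]) (Some b, Stay) = zt l [b]"
  "ract (zt [] (0 # r)) (Some b, Go_Left) = zt [] (0 # b # r)"
  "ract (zt [] (0 # r)) mvR = zt [] r"
  "ract (zt [] []) (Some b, Stay) = zt [] [b]"
  using rupd_zt_stay[of "[]" 0 "[]" b]
  by (simp_all add: ract_def write_of_def rupd_zt_right rupd_zt_right_Nil rupd_zt_stay
      rupd_zt_left_Nil zt_trailing_blank)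

text \<open>
  The tapes of the verifier are the input and output tapes, one tape each for the tested word,
  the advice and the witness, and the tapes of the simulated machine \<open>M\<close>. The advice tape uses the
  symbols \<open>1\<close>, \<open>2\<close> (literal bits), \<open>3\<close> (next bit of the tested word), \<open>4\<close> (next bit of the
  witness), \<open>5\<close> (separator) and \<open>6\<close> (start of an entry); symbol \<open>c\<close> is written in the advice as
  \<open>c\<close> ones followed by a zero. The last three tapes are filled from left to right and then read from right
  to left, so that the input of \<open>M\<close> can be written from right to left and no head has to be rewound.

  States \<open>0\<close> to \<open>6\<close> distribute the input, \<open>7\<close> selects an entry of the advice, \<open>8\<close> to \<open>10\<close> write the input
  of \<open>M\<close>, the following ones simulate \<open>M\<close>, and the last one before halting compares its output
  with the rest of the entry.
\<close>

fun verifier_action :: "tm \<Rightarrow> nat \<Rightarrow> nat list \<Rightarrow> nat \<times> action list" where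
  "verifier_action M s as =
    (let K = tapes M; mk = replicate K keep; mi = (\<lambda>w. w # replicate (K - 1) keep);
         R = [mvR, keep, keep, keep, keep] @ mk;
         halt = (\<lambda>b. (12 + states M, [keep, (Some b, Stay), keep, keep, keep] @ mk)) in
     if s = 0 then (if as ! 0 = 2 then 1 else 6, R)
     else if s = 1 then (if as ! 0 = 2 then 2 else 4, R)
     else if s = 2 then (if as ! 0 = 2 then 3 else 6, R)
     else if s = 3 then (0, [mvR, keep, (Some (as ! 0), Go_Right), keep, keep] @ mk)
     else if s = 4 then (if as ! 0 = 2 then 5 else 6, R)
     else if s = 5 then
       (4, [mvR, keep, keep, if as ! 0 = 2 then (Some (min 6 (as ! 3 + 1)), Stay) else mvR, keep] @ mk)
     else if s = 6 then
       (if as ! 0 = 0 then (7, [keep, keep, mvL, mvL, mvL] @ mk)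
        else (6, [mvR, keep, keep, keep, (Some (as ! 0), Go_Right)] @ mk))
     else if s = 7 then
       (if as ! 3 = 0 then halt 1
        else if as ! 3 = 6 then (if as ! 4 = 2 then 8 else 7, [keep, keep, keep, mvL, mvL] @ mk)
        else (7, [keep, keep, keep, mvL, keep] @ mk))
     else if s = 8 then
       (if as ! 3 = 2 then (8, [keep, keep, keep, mvL, keep] @ mi (Some 2, Go_Left))
        else (9, [keep, keep, keep, mvL, keep] @ mi (Some 1, Go_Left)))
     else if s = 9 then
       (if as ! 3 = 1 \<or> as ! 3 = 2 then (10, [keep, keep, keep, mvL, keep] @ mi (Some (as ! 3), Go_Left))
        else if as ! 3 = 3 then
          (if as ! 2 = 2 then (10, [keep, keep, mvL, mvL, keep] @ mi (Some 2, Go_Left))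
           else (9, [keep, keep, mvL, mvL, keep] @ mk))
        else if as ! 3 = 4 then
          (if as ! 4 = 2 then (10, [keep, keep, keep, mvL, mvL] @ mi (Some 2, Go_Left))
           else (9, [keep, keep, keep, mvL, mvL] @ mk))
        else (11, [keep, keep, keep, mvL, keep] @ mi mvR))
     else if s = 10 then (9, [keep, keep, keep, keep, keep] @ mi (Some 2, Go_Left))
     else if s < 11 + states M then
       (if drop 5 as \<in> tuples {..<symbols M} K
        then (case delta M (s - 11) (drop 5 as) of (s', ws) \<Rightarrow>
          (11 + s', replicate 5 keep @ map (map_prod Some id) ws))
        else halt 1)
     else if as ! 6 = 1 \<or> as ! 6 = 2 then
       (if as ! 3 = as ! 6
        then (11 + states M, [keep, keep, keep, mvL, keep] @ keep # mvR # replicate (K - 2) keep)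
        else halt 1)
     else halt (if as ! 3 = 5 then 2 else 1))"

declare verifier_action.simps [simp del]

definition verifier :: "tm \<Rightarrow> tm" where
  "verifier M = \<lparr>tapes = 5 + tapes M, states = 12 + states M, symbols = max 7 (symbols M),
     delta = (\<lambda>s as. case verifier_action M s as of (s', xs) \<Rightarrow> (s', map2 write_of as xs))\<rparr>"

lemma map2_write_of_in_range:
  assumes "set as \<subseteq> {..<n}" "\<forall>b \<in> set xs. fst b = None \<or> the (fst b) < n"
  shows "fst ` set (map2 write_of as xs) \<subseteq> {..<n}"
  using assms
  by (fastforce simp: write_of_def dest: set_zip_leftD set_zip_rightD split: option.splits)

lemma wf_verifier:
  assumes "wf_tm M"
  shows "wf_tm (verifier M)"
proof -
  have K: "tapes M \<ge> 2" "symbols M \<ge> 3" using assms by (auto simp: wf_tm_def)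
  have *: "s' \<le> 12 + states M \<and> length xs = 5 + tapes M \<and>
      (\<forall>b \<in> set xs. fst b = None \<or> the (fst b) < max 7 (symbols M))"
    if "s < 12 + states M" "as \<in> tuples {..<max 7 (symbols M)} (5 + tapes M)"
      "verifier_action M s as = (s', xs)" for s as s' xs
  \<comment> \<open>Only the simulating states consult \<open>delta M\<close>. The test on
    \<open>drop 5 as\<close> matters there: the alphabet of the verifier may exceed that of
    \<open>M\<close>, and \<open>wf_tm\<close> says nothing about foreign symbols.\<close>
  proof (cases "s \<notin> {0, 1, 2, 3, 4, 5, 6, 7, 8, 9, 10} \<and> s < 11 + states M \<and> drop 5 as \<in> tuples {..<symbols M} (tapes M)")
    case True
    obtain r ws where d: "delta M (s - 11) (drop 5 as) = (r, ws)" by fastforce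
    have "10 < s" 
    proof (rule ccontr)
      assume "\<not> 10 < s"
      then have "s = 0 \<or> s = 1 \<or> s = 2 \<or> s = 3 \<or> s = 4 \<or> s = 5 \<or> s = 6 \<or> s = 7 \<or> s = 8 \<or> s = 9 \<or> s = 10"
        by presburger
      with True show False by blast
    qed
    then have "s - 11 < states M" using True by linarith
    from wf_tm_delta[OF assms this _ d] True
    have "r \<le> states M" "length ws = tapes M" "fst ` set ws \<subseteq> {..<symbols M}" by auto
    then show ?thesis
      using that(3) True d by (fastforce simp: verifier_action.simps Let_def)
  next
    case False
    \<comment> \<open>Besides constants, \<open>as ! 0\<close> and \<open>as ! 3\<close> are the
      only sources of written symbols in the remaining cases.\<close>
    have "as ! 0 < max 7 (symbols M)" "as ! 3 < max 7 (symbols M)"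
      using that(2) nth_mem[of 0 as] nth_mem[of 3 as] by (auto simp: tuples_def simp del: nth_mem)
    then show ?thesis
      using that(1,3) False K
      by (auto simp: verifier_action.simps Let_def set_replicate_conv_if split: if_splits)
  qed
  show ?thesis
    unfolding wf_tm_def
  proof (intro conjI allI impI ballI)
    fix s as assume s: "s < states (verifier M)" and as: "as \<in> tuples {..<symbols (verifier M)} (tapes (verifier M))"
    obtain s' xs where v: "verifier_action M s as = (s', xs)" by fastforce
    from *[OF _ _ v] s as have "s' \<le> 12 + states M" "length xs = 5 + tapes M"
      "\<forall>b \<in> set xs. fst b = None \<or> the (fst b) < max 7 (symbols M)"
      by (auto simp: verifier_def)
    moreover have "set as \<subseteq> {..<max 7 (symbols M)}" "length as = 5 + tapes M"
      using as by (auto simp: verifier_def tuples_def)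
    ultimately show "case delta (verifier M) s as of (s', ws) \<Rightarrow>
          s' \<le> states (verifier M) \<and> length ws = tapes (verifier M) \<and> fst ` set ws \<subseteq> {..<symbols (verifier M)}"
      using map2_write_of_in_range[of as "max 7 (symbols M)" xs] by (simp add: verifier_def v)
  qed (use K in \<open>auto simp: verifier_def\<close>)
qed

lemma map2_rupd_write_of:
  "map2 rupd ts (map2 write_of (map (\<lambda>t. t 0) ts) xs) = map2 ract ts xs"
  by (induction ts xs rule: list_induct2') (auto simp: ract_def)

lemma rstep_verifier:
  assumes "s < 12 + states M" "verifier_action M s (map (\<lambda>t. t 0) ts) = (s', xs)"
  shows "rstep (verifier M) (s, ts) = (s', map2 ract ts xs)"
  using assms by (simp add: verifier_def map2_rupd_write_of)

text \<open>Functional counterpart of states 0 to 5 on \<open>w = encode_pair (x, a)\<close>, each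
  bit of which carries a second flag from the outer pair. \<open>parse_word\<close> expects an inner
  flag and \<open>parse_bit\<close> the bit after it; the cap 6 in \<open>parse_advice\<close> keeps
  the counter inside the alphabet. Both results come out reversed, as they are read from the right
  ends of their tapes.\<close>

fun parse_word :: "bool list \<Rightarrow> bool list \<Rightarrow> bool list \<times> nat list"
  and parse_bit :: "bool list \<Rightarrow> bool list \<Rightarrow> bool list \<times> nat list"
  and parse_advice :: "bool list \<Rightarrow> nat \<Rightarrow> nat list \<Rightarrow> nat list" where
  "parse_word [] x = (x, [])"
| "parse_word (b # w) x = (if b then parse_bit w x else (x, parse_advice w 0 []))"
| "parse_bit [] x = (x, [])"
| "parse_bit (b # w) x = parse_word w (b # x)"
| "parse_advice [] c A = A"
| "parse_advice (b # w) c A = (if b then parse_advice w (min 6 (c + 1)) A else parse_advice w 0 (c # A))"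

definition first :: "bool list \<Rightarrow> bool" where
  "first x \<longleftrightarrow> x \<noteq> [] \<and> hd x"

text \<open>The nondeterministic choice: each start symbol \<open>6\<close> consumes one bit of the
  witness, and the first true bit takes the entry.\<close>

fun select_entry :: "nat list \<Rightarrow> bool list \<Rightarrow> (nat list \<times> bool list) option" where
  "select_entry [] u = None"
| "select_entry (a # A) u =
    (if a = 0 then None
     else if a = 6 then (if first u then Some (A, tl u) else select_entry A (tl u))
     else select_entry A u)"

fun read_param :: "nat list \<Rightarrow> nat \<Rightarrow> nat \<times> nat list" where
  "read_param [] k = (k, [])"
| "read_param (a # A) k = (if a = 2 then read_param A (Suc k) else (k, A))"

text \<open>A true bit emits \<open>True\<close> and a false bit nothing, which is what increasing a
  unary number by the bit requires. An exhausted word reads as false, as a blank cell does. The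
  output grows at its front because the tape of \<open>M\<close> is written leftwards.\<close>

fun fill_template :: "nat list \<Rightarrow> bool list \<Rightarrow> bool list \<Rightarrow> bool list \<Rightarrow> bool list \<times> nat list" where
  "fill_template [] x u y = (y, [])"
| "fill_template (a # A) x u y =
    (if a = 1 then fill_template A x u (False # y)
     else if a = 2 then fill_template A x u (True # y)
     else if a = 3 then fill_template A (tl x) u (if first x then True # y else y)
     else if a = 4 then fill_template A x (tl u) (if first u then True # y else y)
     else (y, A))"

fun matches :: "nat list \<Rightarrow> bool list \<Rightarrow> bool" where
  "matches A [] \<longleftrightarrow> A \<noteq> [] \<and> hd A = 5"
| "matches A (b # w) \<longleftrightarrow> A \<noteq> [] \<and> hd A = bit_symbol b \<and> matches (tl A) w"

text \<open>Defined on malformed words too, as the machine must agree with it on every input;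
  \<open>rev\<close> reflects that the witness is written rightwards and read leftwards.\<close>

definition verify :: "(bool list \<times> nat \<Rightarrow> bool list \<times> nat) \<Rightarrow> bool list \<times> bool list \<Rightarrow> bool" where
  "verify f wu =
    (case parse_word (fst wu) [] of (x, A) \<Rightarrow>
       case select_entry A (rev (snd wu)) of None \<Rightarrow> False
       | Some (B, u) \<Rightarrow>
          (case read_param B 0 of (k, C) \<Rightarrow>
            case fill_template C x u [] of (y, D) \<Rightarrow> matches D (encode_param (f (y, k)))))"

section \<open>Runs of the verifier, phase by phase\<close>

declare rstep.simps [simp del]

lemma rstep_verifier_tapes:
  assumes "s < 12 + states M"
  shows "rstep (verifier M) (s, [i, out, x, a, u] @ m) =
    (case verifier_action M s ([i 0, out 0, x 0, a 0, u 0] @ map (\<lambda>t. t 0) m) of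
       (s', xs) \<Rightarrow> (s', map2 ract ([i, out, x, a, u] @ m) xs))"
  using rstep_verifier[OF assms, of "[i, out, x, a, u] @ m"] by (auto split: prod.split)

lemmas verifier_step_simps = rstep_verifier_tapes[simplified] verifier_action.simps Let_def

lemma bit_symbol_simps [simp]:
  "bit_symbol True = 2" "bit_symbol False = Suc 0" "(bit_symbol b = 0) = False"
  "(bit_symbol b = 2) = b" "(bit_symbol b = Suc 0) = (\<not> b)"
  by (auto simp: bit_symbol_def)

abbreviation bsym :: "bool list \<Rightarrow> nat list" where "bsym \<equiv> map bit_symbol"

abbreviation doubled :: "bool list \<Rightarrow> bool list" where
  "doubled w \<equiv> concat (map (\<lambda>b. [True, b]) w)"

lemma ract_zt_mvR_blank: "ract (zt l [c]) mvR = zt (c # l) [0]"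
  by (simp add: ract_zt zt_trailing_blank)

context
  fixes M :: tm
  assumes wf: "wf_tm M"
begin

lemma tapes_ge_2: "tapes M \<ge> 2"
  using wf by (simp add: wf_tm_def)

text \<open>Two steps per bit: state 4 reads the flag of the outer pair, state 5 the bit itself. The
  scanned cell of the advice tape is the counter of the current symbol; a zero commits it by moving
  on.\<close>

lemma run_parse_advice:
  assumes m: "length m = tapes M"
  shows "\<exists>l' c'. reaches (verifier M) (2 * length w + 1)
    (4, [zt l (bsym (doubled w @ False # v)), out, x, zt A [c], u] @ m)
    (6, [zt l' (bsym v), out, x, zt (parse_advice w c A) [c'], u] @ m)"
proof (induction w arbitrary: l c A)
  case Nil
  have "rstep (verifier M) (4, [zt l (bsym (doubled [] @ False # v)), out, x, zt A [c], u] @ m) =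
      (6, [zt (1 # l) (bsym v), out, x, zt A [c], u] @ m)"
    using m by (simp add: verifier_step_simps ract_zt)
  from reaches_step[OF this] show ?case by fastforce
next
  case (Cons b w)
  let ?c = "if b then min 6 (c + 1) else 0" and ?A = "if b then A else c # A"
  have 1: "rstep (verifier M) (4, [zt l (bsym (doubled (b # w) @ False # v)), out, x, zt A [c], u] @ m) =
      (5, [zt (2 # l) (bsym (b # doubled w @ False # v)), out, x, zt A [c], u] @ m)"
    using m by (simp add: verifier_step_simps ract_zt)
  have 2: "rstep (verifier M) (5, [zt (2 # l) (bsym (b # doubled w @ False # v)), out, x, zt A [c], u] @ m) =
      (4, [zt (bit_symbol b # 2 # l) (bsym (doubled w @ False # v)), out, x, zt ?A [?c], u] @ m)"
    using m by (simp add: verifier_step_simps ract_zt(1,3) ract_zt_mvR_blank zt_trailing_blank(1)[symmetric])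
  obtain l' c' where "reaches (verifier M) (2 * length w + 1)
    (4, [zt (bit_symbol b # 2 # l) (bsym (doubled w @ False # v)), out, x, zt ?A [?c], u] @ m)
    (6, [zt l' (bsym v), out, x, zt (parse_advice w ?c ?A) [c'], u] @ m)"
    using Cons.IH by blast
  from reaches_Suc[OF 1 reaches_Suc[OF 2 this]] show ?case
    by (cases b) (auto intro!: exI[of _ l'] exI[of _ c'])
qed

text \<open>States 0 and 2 are treated together because they alternate, like the mutual recursion of
  \<open>parse_word\<close> and \<open>parse_bit\<close>.\<close>

lemma run_parse_word:
  assumes m: "length m = tapes M"
  shows "(\<exists>l' c'. reaches (verifier M) (2 * length w + 1)
      (0, [zt l (bsym (doubled w @ False # v)), out, zt (bsym x) [], zt [] [], u] @ m)
      (6, [zt l' (bsym v), out, zt (bsym (fst (parse_word w x))) [],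
        zt (snd (parse_word w x)) [c'], u] @ m)) \<and>
    (\<exists>l' c'. reaches (verifier M) (2 * length w + 1)
      (2, [zt l (bsym (doubled w @ False # v)), out, zt (bsym x) [], zt [] [], u] @ m)
      (6, [zt l' (bsym v), out, zt (bsym (fst (parse_bit w x))) [],
        zt (snd (parse_bit w x)) [c'], u] @ m))"
proof (induction w arbitrary: l x)
  case Nil
  have "rstep (verifier M) (s, [zt l (bsym (doubled [] @ False # v)), out, zt (bsym x) [], zt [] [], u] @ m) =
      (6, [zt (1 # l) (bsym v), out, zt (bsym x) [], zt [] [0], u] @ m)" if "s = 0 \<or> s = 2" for s
    using m that by (elim disjE) (simp_all add: verifier_step_simps ract_zt zt_trailing_blank)
  note this[of 0, simplified] this[of 2, simplified]
  from this[THEN reaches_step] show ?case by fastforce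
next
  case (Cons b w)
  let ?i = "\<lambda>l. zt l (bsym (doubled w @ False # v))"
  let ?i1 = "zt (2 # l) (bsym (b # doubled w @ False # v))"
  let ?l = "bit_symbol b # 2 # l"
  have 1: "rstep (verifier M) (s, [zt l (bsym (doubled (b # w) @ False # v)), out, zt (bsym x) [], zt [] [], u] @ m) =
      (Suc s, [?i1, out, zt (bsym x) [], zt [] [], u] @ m)" if "s = 0 \<or> s = 2" for s
    using m that by (elim disjE) (simp_all add: verifier_step_simps ract_zt zt_trailing_blank)
  have 2: "rstep (verifier M) (1, [?i1, out, zt (bsym x) [], zt [] [], u] @ m) =
      (if b then 2 else 4, [?i ?l, out, zt (bsym x) [], zt [] [], u] @ m)"
    using m by (simp add: verifier_step_simps ract_zt zt_trailing_blank)
  have 3: "rstep (verifier M) (3, [?i1, out, zt (bsym x) [], zt [] [], u] @ m) =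
      (0, [?i ?l, out, zt (bsym (b # x)) [], zt [] [], u] @ m)"
    using m by (simp add: verifier_step_simps ract_zt zt_trailing_blank)
  show ?case
  proof (intro conjI)
    obtain l' c' where A: "reaches (verifier M) (2 * length w + 1)
      (4, [?i ?l, out, zt (bsym x) [], zt [] [], u] @ m)
      (6, [zt l' (bsym v), out, zt (bsym x) [], zt (parse_advice w 0 []) [c'], u] @ m)"
      using run_parse_advice[OF m, of w ?l v out "zt (bsym x) []" "[]" 0 u]
      by (auto simp: zt_trailing_blank)
    obtain l'' c'' where B: "reaches (verifier M) (2 * length w + 1)
      (2, [?i ?l, out, zt (bsym x) [], zt [] [], u] @ m)
      (6, [zt l'' (bsym v), out, zt (bsym (fst (parse_bit w x))) [], zt (snd (parse_bit w x)) [c''], u] @ m)"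
      using Cons.IH by blast
    show "\<exists>l' c'. reaches (verifier M) (2 * length (b # w) + 1)
      (0, [zt l (bsym (doubled (b # w) @ False # v)), out, zt (bsym x) [], zt [] [], u] @ m)
      (6, [zt l' (bsym v), out, zt (bsym (fst (parse_word (b # w) x))) [],
        zt (snd (parse_word (b # w) x)) [c'], u] @ m)"
    proof (cases b)
      case True
      from 2 True have "rstep (verifier M) (Suc 0, [?i1, out, zt (bsym x) [], zt [] [], u] @ m) =
        (2, [?i ?l, out, zt (bsym x) [], zt [] [], u] @ m)" by simp
      from reaches_Suc[OF 1[of 0, simplified] reaches_Suc[OF this[simplified] B[simplified]]] True
      show ?thesis by auto
    next
      case False
      from 2 False have "rstep (verifier M) (Suc 0, [?i1, out, zt (bsym x) [], zt [] [], u] @ m) =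
        (4, [?i ?l, out, zt (bsym x) [], zt [] [], u] @ m)" by simp
      from reaches_Suc[OF 1[of 0, simplified] reaches_Suc[OF this[simplified] A[simplified]]] False
      show ?thesis by auto
    qed
    obtain l3 c3 where C: "reaches (verifier M) (2 * length w + 1)
      (0, [?i ?l, out, zt (bsym (b # x)) [], zt [] [], u] @ m)
      (6, [zt l3 (bsym v), out, zt (bsym (fst (parse_word w (b # x)))) [],
        zt (snd (parse_word w (b # x))) [c3], u] @ m)"
      using Cons.IH by blast
    from 1[of 2] have "rstep (verifier M) (2, [zt l (bsym (doubled (b # w) @ False # v)), out, zt (bsym x) [], zt [] [], u] @ m) =
      (3, [?i1, out, zt (bsym x) [], zt [] [], u] @ m)" by (simp add: numeral_3_eq_3)
    from reaches_Suc[OF this reaches_Suc[OF 3 C]]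
    show "\<exists>l' c'. reaches (verifier M) (2 * length (b # w) + 1)
      (2, [zt l (bsym (doubled (b # w) @ False # v)), out, zt (bsym x) [], zt [] [], u] @ m)
      (6, [zt l' (bsym v), out, zt (bsym (fst (parse_bit (b # w) x))) [],
        zt (snd (parse_bit (b # w) x)) [c'], u] @ m)"
      by auto
  qed
qed

text \<open>The blank after the witness is the signal for the tapes of word, advice and witness to
  turn; afterwards all three are read from their right ends.\<close>

lemma run_copy_witness:
  assumes m: "length m = tapes M"
  shows "\<exists>i r r' r''. reaches (verifier M) (length v + 1)
    (6, [zt l (bsym v), out, zt X [], zt A [c], zt (bsym u) []] @ m)
    (7, [i, out, rl X r, rl A r', rl (bsym (rev v @ u)) r''] @ m)"
proof (induction v arbitrary: l u)
  case Nil
  obtain r r' r'' where "ract (zt X []) mvL = rl X r" "ract (zt A [c]) mvL = rl A r'"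
    "ract (zt (bsym u) []) mvL = rl (bsym u) r''"
    using zt_mvL zt_mvL_Nil by meson
  then have "rstep (verifier M) (6, [zt l (bsym []), out, zt X [], zt A [c], zt (bsym u) []] @ m) =
      (7, [zt l [], out, rl X r, rl A r', rl (bsym u) r''] @ m)"
    using m by (simp add: verifier_step_simps)
  from reaches_step[OF this] show ?case by fastforce
next
  case (Cons b v)
  have 1: "rstep (verifier M) (6, [zt l (bsym (b # v)), out, zt X [], zt A [c], zt (bsym u) []] @ m) =
      (6, [zt (bit_symbol b # l) (bsym v), out, zt X [], zt A [c], zt (bsym (b # u)) []] @ m)"
    using m by (simp add: verifier_step_simps ract_zt)
  obtain i r r' r'' where "reaches (verifier M) (length v + 1)
    (6, [zt (bit_symbol b # l) (bsym v), out, zt X [], zt A [c], zt (bsym (b # u)) []] @ m)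
    (7, [i, out, rl X r, rl A r', rl (bsym (rev v @ b # u)) r''] @ m)"
    using Cons.IH by blast
  from reaches_Suc[OF 1 this] show ?case by auto
qed

lemma rl_bsym_eq_2 [simp]: "rl (bsym u) r 0 = 2 \<longleftrightarrow> first u"
  by (cases u) (auto simp: first_def)

lemma rl_bsym_mvL: "\<exists>r'. ract (rl (bsym l) r) mvL = rl (bsym (tl l)) r'"
  using rl_mvL[of "bsym l" r] by (simp add: map_tl)

lemma run_select_entry:
  assumes m: "length m = tapes M"
  shows "case select_entry A u of
      None \<Rightarrow> \<exists>a w. reaches (verifier M) (length A + 1)
        (7, [i, zt [] [], x, rl A r, rl (bsym u) r'] @ m) (12 + states M, [i, zt [] [1], x, a, w] @ m)
    | Some (B, u') \<Rightarrow> length B \<le> length A \<and> (\<exists>r r''. reaches (verifier M) (length A + 1)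
        (7, [i, zt [] [], x, rl A r0, rl (bsym u) r'] @ m) (8, [i, zt [] [], x, rl B r, rl (bsym u') r''] @ m))"
  (is "?P A u r r' r0")
proof (induction A arbitrary: u r r' r0)
  case Nil
  have "rstep (verifier M) (7, [i, zt [] [], x, rl [] r, rl (bsym u) r'] @ m) =
      (12 + states M, [i, zt [] [1], x, rl [] r, rl (bsym u) r'] @ m)"
    using m by (simp add: verifier_step_simps ract_zt)
  from reaches_step[OF this] show ?case by auto
next
  case (Cons a A)
  obtain r1 r2 r3 where r: "ract (rl (a # A) r) mvL = rl A r1" "ract (rl (bsym u) r') mvL = rl (bsym (tl u)) r2"
    "ract (rl (a # A) r0) mvL = rl A r3"
    using rl_mvL[of "a # A"] rl_bsym_mvL by (metis list.sel(3))
  consider "a = 0" | "a = 6" "first u" | "a = 6" "\<not> first u" | "a \<noteq> 0" "a \<noteq> 6" by blast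
  then show ?case
  proof cases
    case 1
    have "rstep (verifier M) (7, [i, zt [] [], x, rl (a # A) r, rl (bsym u) r'] @ m) =
        (12 + states M, [i, zt [] [1], x, rl (a # A) r, rl (bsym u) r'] @ m)"
      using m 1 by (simp add: verifier_step_simps ract_zt)
    from reaches_mono[OF reaches_step[OF this]] 1 show ?thesis by fastforce
  next
    case 2
    have "rstep (verifier M) (7, [i, zt [] [], x, rl (a # A) r0, rl (bsym u) r'] @ m) =
        (8, [i, zt [] [], x, rl A r3, rl (bsym (tl u)) r2] @ m)"
      using m 2 r by (simp add: verifier_step_simps)
    from reaches_mono[OF reaches_step[OF this]] 2 show ?thesis by fastforce
  next
    case 3
    have 4: "rstep (verifier M) (7, [i, zt [] [], x, rl (a # A) r, rl (bsym u) r'] @ m) =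
        (7, [i, zt [] [], x, rl A r1, rl (bsym (tl u)) r2] @ m)"
      "rstep (verifier M) (7, [i, zt [] [], x, rl (a # A) r0, rl (bsym u) r'] @ m) =
        (7, [i, zt [] [], x, rl A r3, rl (bsym (tl u)) r2] @ m)"
      using m 3 r by (simp_all add: verifier_step_simps)
    show ?thesis
      using Cons.IH[where u = "tl u" and r = r1 and r' = r2 and ?r0.0 = r3] 3 reaches_Suc[OF 4(1)] reaches_Suc[OF 4(2)]
      by (fastforce split: option.splits)
  next
    case 4
    have 5: "rstep (verifier M) (7, [i, zt [] [], x, rl (a # A) r, rl (bsym u) r'] @ m) =
        (7, [i, zt [] [], x, rl A r1, rl (bsym u) r'] @ m)"
      "rstep (verifier M) (7, [i, zt [] [], x, rl (a # A) r0, rl (bsym u) r'] @ m) =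
        (7, [i, zt [] [], x, rl A r3, rl (bsym u) r'] @ m)"
      using m 4 r by (simp_all add: verifier_step_simps)
    show ?thesis
      using Cons.IH[where u = u and r = r1 and r' = r' and ?r0.0 = r3] 4 reaches_Suc[OF 5(1)] reaches_Suc[OF 5(2)]
      by (fastforce split: option.splits)
  qed
qed

text \<open>\<open>encode_param (y, k)\<close> ends with the unary parameter, so writing leftwards
  starts with it and then puts the separator in front. The head rests on the blank before the
  written part.\<close>

lemma run_read_param:
  assumes m: "length (m0 # m) = tapes M"
  shows "snd (read_param A k) = B \<Longrightarrow> fst (read_param A k) = k' \<Longrightarrow> length B \<le> length A \<and> k' \<le> length A + k \<and>
    (\<exists>r'. reaches (verifier M) (length A + 1)
    (8, [i, out, x, rl A r, u] @ zt [] (0 # bsym (replicate k True)) # m)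
    (9, [i, out, x, rl B r', u] @ zt [] (0 # bsym (False # replicate k' True)) # m))"
proof (induction A arbitrary: k r)
  case Nil
  obtain r' where "ract (rl [] r) mvL = rl [] r'" using rl_mvL[of "[]"] by auto
  then have "rstep (verifier M) (8, [i, out, x, rl [] r, u] @ zt [] (0 # bsym (replicate k True)) # m) =
      (9, [i, out, x, rl [] r', u] @ zt [] (0 # bsym (False # replicate k True)) # m)"
    using m by (simp add: verifier_step_simps ract_zt flip: m)
  from reaches_step[OF this] Nil show ?case by auto
next
  case (Cons a A)
  obtain r' where r: "ract (rl (a # A) r) mvL = rl A r'" using rl_mvL[of "a # A"] by auto
  show ?case
  proof (cases "a = 2")
    case True
    have "rstep (verifier M) (8, [i, out, x, rl (a # A) r, u] @ zt [] (0 # bsym (replicate k True)) # m) =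
        (8, [i, out, x, rl A r', u] @ zt [] (0 # bsym (replicate (Suc k) True)) # m)"
      using r True by (simp add: verifier_step_simps ract_zt flip: m)
    from reaches_Suc[OF this] Cons.IH[of "Suc k" r'] Cons.prems True show ?thesis by fastforce
  next
    case False
    have "rstep (verifier M) (8, [i, out, x, rl (a # A) r, u] @ zt [] (0 # bsym (replicate k True)) # m) =
        (9, [i, out, x, rl A r', u] @ zt [] (0 # bsym (False # replicate k True)) # m)"
      using r False by (simp add: verifier_step_simps ract_zt flip: m)
    from reaches_mono[OF reaches_step[OF this]] Cons.prems False show ?thesis by fastforce
  qed
qed

lemma run_fill_template:
  assumes m: "length (m0 # m) = tapes M"
  shows "snd (fill_template A x u y) = B \<Longrightarrow> fst (fill_template A x u y) = y' \<Longrightarrow>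
    length B \<le> length A \<and> length y' \<le> length A + length y \<and>
    (\<exists>x' w r'. reaches (verifier M) (2 * length A + 1)
    (9, [i, out, rl (bsym x) rx, rl A r, rl (bsym u) ru] @ zt [] (0 # bsym (doubled y @ z)) # m)
    (11, [i, out, x', rl B r', w] @ zt [] (bsym (doubled y' @ z)) # m))"
proof (induction A arbitrary: x u y r rx ru)
  case Nil
  obtain r' where "ract (rl [] r) mvL = rl [] r'" using rl_mvL[of "[]"] by auto
  then have "rstep (verifier M) (9, [i, out, rl (bsym x) rx, rl [] r, rl (bsym u) ru] @
       zt [] (0 # bsym (doubled y @ z)) # m) =
      (11, [i, out, rl (bsym x) rx, rl [] r', rl (bsym u) ru] @ zt [] (bsym (doubled y @ z)) # m)"
    by (simp add: verifier_step_simps ract_zt zt_trailing_blank flip: m)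
  from reaches_step[OF this] Nil show ?case by fastforce
next
  case (Cons a A)
  obtain r1 r2 r3 where r: "ract (rl (a # A) r) mvL = rl A r1" "ract (rl (bsym x) rx) mvL = rl (bsym (tl x)) r2"
    "ract (rl (bsym u) ru) mvL = rl (bsym (tl u)) r3"
    using rl_mvL[of "a # A"] rl_bsym_mvL by (metis list.sel(3))
  note st = verifier_step_simps ract_zt zt_trailing_blank r
  \<comment> \<open>State 9 writes the bit and state 10 the flag \<open>True\<close> in front of it,
    as \<open>encode_pair\<close> requires.\<close>
  have emit: ?case
    if 1: "rstep (verifier M) (9, [i, out, rl (bsym x) rx, rl (a # A) r, rl (bsym u) ru] @
          zt [] (0 # bsym (doubled y @ z)) # m) =
        (10, [i, out, rl (bsym x1) rx1, rl A r1, rl (bsym u1) ru1] @ zt [] (0 # bsym (b # doubled y @ z)) # m)"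
      and 2: "fill_template (a # A) x u y = fill_template A x1 u1 (b # y)" for x1 rx1 u1 ru1 b
  proof -
    have 3: "rstep (verifier M) (10, [i, out, rl (bsym x1) rx1, rl A r1, rl (bsym u1) ru1] @
          zt [] (0 # bsym (b # doubled y @ z)) # m) =
        (9, [i, out, rl (bsym x1) rx1, rl A r1, rl (bsym u1) ru1] @ zt [] (0 # bsym (doubled (b # y) @ z)) # m)"
      by (simp add: st flip: m)
    show ?thesis
      using Cons.IH[where x = x1 and u = u1 and y = "b # y" and rx = rx1 and r = r1 and ru = ru1] Cons.prems 2 reaches_Suc[OF 1 reaches_Suc[OF 3]]
      by fastforce
  qed
  have skip: ?case
    if 1: "rstep (verifier M) (9, [i, out, rl (bsym x) rx, rl (a # A) r, rl (bsym u) ru] @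
          zt [] (0 # bsym (doubled y @ z)) # m) =
        (9, [i, out, rl (bsym x1) rx1, rl A r1, rl (bsym u1) ru1] @ zt [] (0 # bsym (doubled y @ z)) # m)"
      and 2: "fill_template (a # A) x u y = fill_template A x1 u1 y" for x1 rx1 u1 ru1
    using Cons.IH[where x = x1 and u = u1 and y = y and rx = rx1 and r = r1 and ru = ru1] Cons.prems 2
      reaches_mono[OF reaches_Suc[OF 1], of "2 * length A + 1" _ "2 * length (a # A) + 1"]
    by fastforce
  consider "a = 1 \<or> a = 2" | "a = 3" "first x" | "a = 3" "\<not> first x" | "a = 4" "first u" | "a = 4" "\<not> first u"
    | "a \<notin> {1, 2, 3, 4}" by blast
  then show ?case
  proof cases
    case 1
    show ?thesis by (rule emit[of x rx u ru "a = 2"]) (use 1 in \<open>auto simp: st simp flip: m\<close>)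
  next
    case 2
    show ?thesis by (rule emit[of "tl x" r2 u ru True]) (use 2 r in \<open>auto simp: st simp flip: m\<close>)
  next
    case 3
    show ?thesis
      by (rule skip[of "tl x" r2 u ru]) (use 3 m r in \<open>auto simp: st\<close>)
  next
    case 4
    show ?thesis by (rule emit[of x rx "tl u" r3 True]) (use 4 r in \<open>auto simp: st simp flip: m\<close>)
  next
    case 5
    show ?thesis
      by (rule skip[of x rx "tl u" r3]) (use 5 m r in \<open>auto simp: st\<close>)
  next
    case 6
    have "rstep (verifier M) (9, [i, out, rl (bsym x) rx, rl (a # A) r, rl (bsym u) ru] @
       zt [] (0 # bsym (doubled y @ z)) # m) =
      (11, [i, out, rl (bsym x) rx, rl A r1, rl (bsym u) ru] @ zt [] (bsym (doubled y @ z)) # m)"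
      using 6 by (simp add: st flip: m)
    from reaches_mono[OF reaches_step[OF this]] 6 Cons.prems show ?thesis by fastforce
  qed
qed

lemma run_simulation:
  assumes pre: "length pre = 5"
    and halt: "fst ((step M ^^ T) (initial_config M w)) = states M"
  shows "reaches (verifier M) T (11, pre @ map rel (snd (initial_config M w)))
     (11 + states M, pre @ map rel (snd ((step M ^^ T) (initial_config M w))))"
proof -
  let ?c = "\<lambda>n. (step M ^^ n) (initial_config M w)"
  \<comment> \<open>In the halting state of \<open>M\<close> the verifier already starts to compare,
    so the simulation is followed exactly up to the first halting time instead of
    \<open>T\<close>.\<close>
  define N where "N = (LEAST n. fst (?c n) = states M)"
  have N: "fst (?c N) = states M" "N \<le> T"
    unfolding N_def using halt by (auto intro: LeastI Least_le)
  have less: "fst (?c n) < states M" if "n < N" for n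
  proof -
    have "fst (?c n) \<noteq> states M" using that not_less_Least unfolding N_def by blast
    moreover have "fst (?c n) \<le> states M"
      using valid_config_funpow[OF wf, of n w] by (simp add: valid_config_def)
    ultimately show ?thesis by simp
  qed
  have "(rstep (verifier M) ^^ n) (11, pre @ map rel (snd (initial_config M w))) =
      (11 + fst (?c n), pre @ map rel (snd (?c n)))" if "n \<le> N" for n
    using that
  proof (induction n)
    case 0
    then show ?case by (simp add: initial_config_def)
  next
    case (Suc n)
    obtain s ts where c: "?c n = (s, ts)" by fastforce
    have s: "s < states M" using less[of n] Suc.prems c by simp
    have v: "valid_config M (s, ts)" using valid_config_funpow[OF wf, of n w] c by simp
    obtain s' ws where d: "delta M s (map scanned ts) = (s', ws)" by fastforce
    have len: "length ws = tapes M" "length ts = tapes M"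
      using wf_tm_delta(2)[OF wf s valid_config_scanned[OF v] d] v by (auto simp: valid_config_def)
    have sc: "map (\<lambda>t. t 0) (map rel ts) = map scanned ts" by (simp add: rel_0)
    have "verifier_action M (11 + s) (map (\<lambda>t. t 0) (pre @ map rel ts)) =
        (11 + s', replicate 5 keep @ map (map_prod Some id) ws)"
      using valid_config_scanned[OF v] pre s d
      by (simp add: verifier_action.simps Let_def rel_0 comp_def)
    then have "rstep (verifier M) (11 + s, pre @ map rel ts) =
        (11 + s', map2 ract (pre @ map rel ts) (replicate 5 keep @ map (map_prod Some id) ws))"
      using s by (intro rstep_verifier) auto
    also have "map2 ract (pre @ map rel ts) (replicate 5 keep @ map (map_prod Some id) ws) =
        pre @ map2 ract (map rel ts) (map (map_prod Some id) ws)"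
      using pre by simp
    also have "map2 ract (map rel ts) (map (map_prod Some id) ws) = map rel (map2 update_tape ts ws)"
      by (induction ts ws rule: list_induct2') (auto simp: ract_def write_of_def rel_update_tape)
    finally have "rstep (verifier M) (11 + s, pre @ map rel ts) =
        (11 + s', pre @ map rel (map2 update_tape ts ws))" .
    then show ?case using Suc c s d by simp
  qed
  from this[of N] N step_funpow_mono[OF N] show ?thesis
    unfolding reaches_def by (intro exI[of _ N]) simp
qed

lemma rword_Cons: "rword t (b # w) \<longleftrightarrow> t 0 = bit_symbol b \<and> rword (ract t mvR) w"
proof -
  have "ract t mvR (int i) = t (int i + 1)" for i
    by (auto simp: ract_def write_of_def rupd_def)
  then show ?thesis
    by (auto simp: rword_def less_Suc_eq_0_disj algebra_simps)
qed

text \<open>Both heads advance together. At the blank after the output the separator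
  \<open>5\<close> is demanded, so a proper prefix of the stored word is rejected.\<close>

lemma run_matches:
  assumes "length m = tapes M" "rword (m ! 1) w"
  shows "\<exists>a m'. length m' = tapes M \<and> reaches (verifier M) (length A + 1)
    (11 + states M, [i, zt [] [], x, rl A r, u] @ m)
    (12 + states M, [i, zt [] [bit_symbol (matches A w)], x, a, u] @ m')"
  using assms
proof (induction w arbitrary: A r m)
  case Nil
  obtain m0 m1 m' where m: "m = m0 # m1 # m'"
    using Nil(1) tapes_ge_2 by (metis Suc_le_length_iff numeral_2_eq_2)
  have "m1 0 = 0" using Nil(2) m by (simp add: rword_def)
  then have "rstep (verifier M) (11 + states M, [i, zt [] [], x, rl A r, u] @ m) =
      (12 + states M, [i, zt [] [bit_symbol (matches A [])], x, rl A r, u] @ m)"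
    using Nil(1) m by (cases A) (simp_all add: verifier_step_simps ract_zt)
  from reaches_mono[OF reaches_step[OF this]] Nil(1) show ?case by fastforce
next
  case (Cons b w)
  obtain m0 m1 m' where m: "m = m0 # m1 # m'"
    using Cons.prems(1) tapes_ge_2 by (metis Suc_le_length_iff numeral_2_eq_2)
  have m1: "m1 0 = bit_symbol b" "rword (ract m1 mvR) w"
    using Cons.prems(2) m by (simp_all add: rword_Cons)
  have b: "bit_symbol b = 1 \<or> bit_symbol b = 2" by (simp add: bit_symbol_def)
  obtain r' where r': "ract (rl A r) mvL = rl (tl A) r'" using rl_mvL by blast
  have K: "tapes M = Suc (Suc (length m'))" using Cons.prems(1) m by simp
  show ?case
  proof (cases "A \<noteq> [] \<and> hd A = bit_symbol b")
    case True
    then have "rl A r 0 = bit_symbol b" by (cases A) auto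
    then have 1: "rstep (verifier M) (11 + states M, [i, zt [] [], x, rl A r, u] @ m) =
        (11 + states M, [i, zt [] [], x, rl (tl A) r', u] @ (m0 # ract m1 mvR # m'))"
      using b m m1 K r' by (auto simp: verifier_step_simps)
    obtain a m2 where "length m2 = tapes M" "reaches (verifier M) (length (tl A) + 1)
      (11 + states M, [i, zt [] [], x, rl (tl A) r', u] @ (m0 # ract m1 mvR # m'))
      (12 + states M, [i, zt [] [bit_symbol (matches (tl A) w)], x, a, u] @ m2)"
      using Cons.IH[of "m0 # ract m1 mvR # m'" "tl A" r'] m1 K by auto
    with reaches_Suc[OF 1] True show ?thesis by (cases A) fastforce+
  next
    case False
    then have "rl A r 0 \<noteq> bit_symbol b" by (cases A) auto
    then have "rstep (verifier M) (11 + states M, [i, zt [] [], x, rl A r, u] @ m) =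
      (12 + states M, [i, zt [] [bit_symbol (matches A (b # w))], x, rl A r, u] @ m)"
      using b m m1 Cons.prems(1) False by (auto simp: verifier_step_simps ract_zt)
    from reaches_mono[OF reaches_step[OF this]] Cons.prems(1) show ?thesis by fastforce
  qed
qed

end

lemma length_parse_advice: "length (parse_advice w c A) \<le> length w + length A"
proof (induction w arbitrary: c A)
  case (Cons b w)
  show ?case using Cons[of "min 6 (c + 1)" A] Cons[of 0 "c # A"] by simp
qed simp

lemma length_parse_word:
  "length (snd (parse_word w x)) \<le> length w \<and> length (snd (parse_bit w x)) \<le> length w"
proof (induction w arbitrary: x)
  case (Cons b w)
  then show ?case using length_parse_advice[of w 0 "[]"] by (auto intro: le_SucI)
qed simp

lemma poly_nat_mono: "a \<le> b \<Longrightarrow> poly (p :: nat poly) a \<le> poly p b"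
  by (induction p) (auto intro!: add_mono mult_mono)

text \<open>All phases but the simulation take linear time, and the simulated input is only linearly
  longer than the own input, so the running time of \<open>M\<close> stays polynomial in
  \<open>N\<close>.\<close>

lemma run_verify:
  fixes wu :: "bool list \<times> bool list"
  assumes wf: "wf_tm M"
    and out: "\<And>xk. outputs_within M (poly p (length (encode_param xk))) (encode_param xk) (encode_param (f xk))"
  defines "N \<equiv> length (encode_pair wu)"
  shows "\<exists>ts. length ts \<ge> 2 \<and> rword (ts ! 1) [verify f wu] \<and>
    reaches (verifier M) (10 * N + 20 + poly p (3 * N + 3))
      (0, zt [] (bsym (encode_pair wu)) # replicate (4 + tapes M) (zt [] [])) (states (verifier M), ts)"
proof -
  obtain w v where wu: "wu = (w, v)" by fastforce
  have N: "N = 2 * length w + 1 + length v"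
    unfolding N_def wu by (simp add: length_concat comp_def sum_list_triv)
  obtain x A where xA: "parse_word w [] = (x, A)" by fastforce
  have A: "length A \<le> length w" using length_parse_word[of w "[]"] xA by simp
  let ?m = "replicate (tapes M) (zt [] [])"
  have K: "tapes M \<ge> 2" using wf by (simp add: wf_tm_def)
  have init: "zt [] (bsym (encode_pair wu)) # replicate (4 + tapes M) (zt [] []) =
      [zt [] (bsym (doubled w @ False # v)), zt [] [], zt [] [], zt [] [], zt [] []] @ ?m"
    by (simp add: wu numeral_eq_Suc)
  obtain l c where 1: "reaches (verifier M) (2 * length w + 1)
      (0, [zt [] (bsym (doubled w @ False # v)), zt [] [], zt [] [], zt [] [], zt [] []] @ ?m)
      (6, [zt l (bsym v), zt [] [], zt (bsym x) [], zt A [c], zt [] []] @ ?m)"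
    using conjunct1[OF run_parse_word[OF wf, of ?m w "[]" v "zt [] []" "[]" "zt [] []"]] xA by auto
  obtain i r1 r2 r3 where 2: "reaches (verifier M) (length v + 1)
      (6, [zt l (bsym v), zt [] [], zt (bsym x) [], zt A [c], zt [] []] @ ?m)
      (7, [i, zt [] [], rl (bsym x) r1, rl A r2, rl (bsym (rev v)) r3] @ ?m)"
    using run_copy_witness[OF wf, of ?m v l "zt [] []" "bsym x" A c "[]"] by auto
  note 12 = reaches_trans[OF 1 2]
  show ?thesis
  proof (cases "select_entry A (rev v)")
    case None
    then obtain a u where 3: "reaches (verifier M) (length A + 1)
        (7, [i, zt [] [], rl (bsym x) r1, rl A r2, rl (bsym (rev v)) r3] @ ?m)
        (12 + states M, [i, zt [] [1], rl (bsym x) r1, a, u] @ ?m)"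
      using run_select_entry[OF wf, where m = ?m and A = A and u = "rev v" and i = i
          and x = "rl (bsym x) r1" and r' = r3 and r = r2] by auto
    have "\<not> verify f wu" using None xA by (simp add: verify_def wu)
    then have "rword (zt [] [1]) [verify f wu]" using rword_zt[of "[]" "[False]"] by simp
    then show ?thesis
      using reaches_mono[OF reaches_trans[OF 12 3]] A N init
      by (intro exI[of _ "[i, zt [] [1], rl (bsym x) r1, a, u] @ ?m"]) (simp add: verifier_def)
  next
    case (Some Bu)
    obtain B u where Bu: "Bu = (B, u)" by fastforce
    obtain k C where kC: "read_param B 0 = (k, C)" by fastforce
    obtain y D where yD: "fill_template C x u [] = (y, D)" by fastforce
    obtain r4 r5 where B: "length B \<le> length A" and 3: "reaches (verifier M) (length A + 1)
        (7, [i, zt [] [], rl (bsym x) r1, rl A r2, rl (bsym (rev v)) r3] @ ?m)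
        (8, [i, zt [] [], rl (bsym x) r1, rl B r4, rl (bsym u) r5] @ ?m)"
      using run_select_entry[OF wf, where m = ?m and A = A and u = "rev v" and i = i
          and x = "rl (bsym x) r1" and r' = r3 and ?r0.0 = r2] Some Bu by auto
    let ?mr = "replicate (tapes M - 1) (zt [] [])"
    have m: "?m = zt [] (0 # bsym (replicate 0 True)) # ?mr"
      using K by (cases "tapes M") (auto simp: zt_trailing_blank)
    have lm: "length (zt [] [] # ?mr) = tapes M" using K by simp
    obtain r6 where C: "length C \<le> length B" "k \<le> length B" and 4: "reaches (verifier M) (length B + 1)
        (8, [i, zt [] [], rl (bsym x) r1, rl B r4, rl (bsym u) r5] @ ?m)
        (9, [i, zt [] [], rl (bsym x) r1, rl C r6, rl (bsym u) r5] @ zt [] (0 # bsym (False # replicate k True)) # ?mr)"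
      using run_read_param[OF wf lm, of B 0 C k i "zt [] []" "rl (bsym x) r1" r4 "rl (bsym u) r5"] kC
      unfolding m by auto
    let ?e = "encode_param (y, k)"
    have e: "?e = doubled y @ (False # replicate k True)" by (simp add: unary_def)
    obtain x' w' r7 where D: "length D \<le> length C" "length y \<le> length C" and 5: "reaches (verifier M) (2 * length C + 1)
        (9, [i, zt [] [], rl (bsym x) r1, rl C r6, rl (bsym u) r5] @ zt [] (0 # bsym (False # replicate k True)) # ?mr)
        (11, [i, zt [] [], x', rl D r7, w'] @ zt [] (bsym ?e) # ?mr)"
      using run_fill_template[OF wf lm, of C x u "[]" D y i "zt [] []" r1 r6 r5 "False # replicate k True"] yD
      unfolding e by auto
    \<comment> \<open>The length is 2|y| + 1 + k, and |y| and k are at most the number of symbols on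
      the advice tape.\<close>
    have len_e: "length ?e \<le> 3 * N + 3"
      using A B C D N unfolding e by (simp add: length_concat comp_def sum_list_triv)
    let ?T = "poly p (length ?e)"
    have T: "?T \<le> poly p (3 * N + 3)" by (rule poly_nat_mono[OF len_e])
    let ?c = "(step M ^^ ?T) (initial_config M ?e)"
    have halt: "fst ?c = states M" and tw: "tape_word (snd ?c ! 1) (encode_param (f (y, k)))"
      using out[of "(y, k)"] by (auto simp: outputs_within_def split: prod.splits)
    have "map rel (snd (initial_config M ?e)) = zt [] (bsym ?e) # ?mr"
      by (simp add: initial_config_def rel_word_tape del: encode_param.simps)
    then have 6: "reaches (verifier M) ?T
        (11, [i, zt [] [], x', rl D r7, w'] @ zt [] (bsym ?e) # ?mr)
        (11 + states M, [i, zt [] [], x', rl D r7, w'] @ map rel (snd ?c))"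
      using run_simulation[OF wf _ halt, of "[i, zt [] [], x', rl D r7, w']"] by simp
    have lc: "length (map rel (snd ?c)) = tapes M"
      using valid_config_funpow[OF wf] by (simp add: valid_config_def)
    have "rword (map rel (snd ?c) ! 1) (encode_param (f (y, k)))"
      using tw lc K by (simp add: tape_word_rel del: encode_param.simps)
    then obtain a m' where m': "length m' = tapes M" and 7: "reaches (verifier M) (length D + 1)
        (11 + states M, [i, zt [] [], x', rl D r7, w'] @ map rel (snd ?c))
        (12 + states M, [i, zt [] [bit_symbol (matches D (encode_param (f (y, k))))], x', a, w'] @ m')"
      using run_matches[OF wf lc] by blast
    have v: "verify f wu = matches D (encode_param (f (y, k)))"
      using Some Bu kC yD xA by (simp add: verify_def wu)
    have "rword (zt [] [bit_symbol (verify f wu)]) [verify f wu]" using rword_zt[of "[]" "[verify f wu]"] by simp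
    then show ?thesis
      using reaches_mono[OF reaches_trans[OF 12 reaches_trans[OF 3 reaches_trans[OF 4 reaches_trans[OF 5 reaches_trans[OF 6 7]]]]]]
        A B C D N init T v m'
      by (intro exI[of _ "[i, zt [] [bit_symbol (verify f wu)], x', a, w'] @ m'"]) (simp add: verifier_def)
  qed
qed

theorem poly_time_verify:
  assumes "poly_time_computable encode_param encode_param f"
  shows "poly_time_computable encode_pair encode_bool (verify f)"
proof -
  obtain M p where wf: "wf_tm M" and
    out: "\<And>xk. outputs_within M (poly p (length (encode_param xk))) (encode_param xk) (encode_param (f xk))"
    using assms unfolding poly_time_computable_def by blast
  let ?p = "[:20, 10:] + pcompose p [:3, 3:]"
  have "outputs_within (verifier M) (poly ?p (length (encode_pair wu))) (encode_pair wu) (encode_bool (verify f wu))" for wu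
  proof -
    obtain ts n where "length ts \<ge> 2" "rword (ts ! 1) [verify f wu]"
      "n \<le> 10 * length (encode_pair wu) + 20 + poly p (3 * length (encode_pair wu) + 3)"
      "(rstep (verifier M) ^^ n) (0, zt [] (bsym (encode_pair wu)) # replicate (4 + tapes M) (zt [] [])) =
        (states (verifier M), ts)"
      using run_verify[OF wf out, of wu] unfolding reaches_def by blast
    then show ?thesis
      by (intro outputs_within_rstepI[of n _ _ ts])
        (simp_all add: verifier_def encode_bool_def poly_pcompose algebra_simps)
  qed
  with wf_verifier[OF wf] show ?thesis unfolding poly_time_computable_def by blast
qed

section \<open>Polynomially bounded functions\<close>

definition poly_bounded :: "(nat \<Rightarrow> nat) \<Rightarrow> bool" where
  "poly_bounded f \<longleftrightarrow> (\<exists>p :: nat poly. \<forall>n. f n \<le> poly p n)"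

lemma poly_bounded_poly: "poly_bounded (poly p)"
  unfolding poly_bounded_def by blast

lemma poly_bounded_const: "poly_bounded (\<lambda>_. c)"
  unfolding poly_bounded_def by (rule exI[of _ "[:c:]"]) simp

lemma poly_bounded_id: "poly_bounded (\<lambda>n. n)"
  unfolding poly_bounded_def by (rule exI[of _ "[:0, 1:]"]) simp

lemma poly_bounded_add: "poly_bounded f \<Longrightarrow> poly_bounded g \<Longrightarrow> poly_bounded (\<lambda>n. f n + g n)"
  unfolding poly_bounded_def by (metis add_mono poly_add)

lemma poly_bounded_mult: "poly_bounded f \<Longrightarrow> poly_bounded g \<Longrightarrow> poly_bounded (\<lambda>n. f n * g n)"
  unfolding poly_bounded_def by (metis mult_le_mono poly_mult)

lemma poly_bounded_power: "poly_bounded f \<Longrightarrow> poly_bounded (\<lambda>n. f n ^ c)"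
  by (induction c) (auto intro: poly_bounded_mult poly_bounded_const)

lemma poly_bounded_le: "poly_bounded g \<Longrightarrow> (\<And>n. f n \<le> g n) \<Longrightarrow> poly_bounded f"
  unfolding poly_bounded_def by (meson order_trans)

lemma poly_bounded_comp_poly: "poly_bounded f \<Longrightarrow> poly_bounded (\<lambda>n. poly p (f n))"
proof -
  assume "poly_bounded f"
  then obtain r where "\<And>n. f n \<le> poly r n" unfolding poly_bounded_def by blast
  then have "poly p (f n) \<le> poly (pcompose p r) n" for n
    by (simp add: poly_pcompose poly_nat_mono)
  then show ?thesis unfolding poly_bounded_def by blast
qed

lemmas poly_bounded_intros = poly_bounded_add poly_bounded_mult poly_bounded_power poly_bounded_poly
  poly_bounded_const poly_bounded_id poly_bounded_comp_poly

section \<open>A non-uniform Cook--Levin theorem\<close>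

type_synonym 'v clause = "('v \<times> bool) list"

definition sat_lit :: "('v \<Rightarrow> bool) \<Rightarrow> 'v \<times> bool \<Rightarrow> bool" where
  "sat_lit \<alpha> l \<longleftrightarrow> \<alpha> (fst l) = snd l"

definition sat_clause :: "('v \<Rightarrow> bool) \<Rightarrow> 'v clause \<Rightarrow> bool" where
  "sat_clause \<alpha> C \<longleftrightarrow> (\<exists>l \<in> set C. sat_lit \<alpha> l)"

definition sat :: "('v \<Rightarrow> bool) \<Rightarrow> 'v clause set \<Rightarrow> bool" where
  "sat \<alpha> F \<longleftrightarrow> (\<forall>C \<in> F. sat_clause \<alpha> C)"

definition clauses_over :: "'v set \<Rightarrow> nat \<Rightarrow> 'v clause set" where
  "clauses_over A c = {C. set C \<subseteq> A \<times> UNIV \<and> length C \<le> c}"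

text \<open>\<open>In i\<close> is the i-th bit of the tested word; the others give state, scanned
  symbol, head position and cell content at a time. The atoms \<open>Sc\<close> spare the transition
  clauses from ranging over the head positions of all tapes at once.\<close>

datatype atom = In nat | St nat nat | Sc nat nat nat | Hd nat nat int | Ct nat nat int nat

definition imp :: "'v list \<Rightarrow> 'v \<Rightarrow> 'v clause" where
  "imp as b = map (\<lambda>a. (a, False)) as @ [(b, True)]"

lemma sat_clause_imp: "sat_clause \<alpha> (imp as b) \<longleftrightarrow> ((\<forall>a \<in> set as. \<alpha> a) \<longrightarrow> \<alpha> b)"
  by (auto simp: sat_clause_def imp_def sat_lit_def)

text \<open>The halting state idles, so the tableau can always describe exactly \<open>T\<close>
  steps.\<close>

definition transition :: "tm \<Rightarrow> nat \<Rightarrow> nat list \<Rightarrow> nat \<times> (nat \<times> move) list" where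
  "transition M q as = (if q < states M then delta M q as else (q, map (\<lambda>a. (a, Stay)) as))"

definition scan_premises :: "tm \<Rightarrow> nat \<Rightarrow> nat \<Rightarrow> nat list \<Rightarrow> atom list" where
  "scan_premises M t q as = St t q # map (\<lambda>j. Sc t j (as ! j)) [0..<tapes M]"

text \<open>
  The clauses describe a run of \<open>T\<close> steps on an input \<open>encode_pair (x, u)\<close> with \<open>length x = s\<close>,
  \<open>length u \<le> l\<close>, restricted to the positions \<open>-B, \<dots>, B\<close>. Apart from the choice of \<open>u\<close> and the
  last rule they are Horn clauses, so that every model contains the atoms describing the actual run.
\<close>

inductive_set tableau :: "tm \<Rightarrow> nat \<Rightarrow> nat \<Rightarrow> nat \<Rightarrow> nat \<Rightarrow> atom clause set"
  for M s l T B where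
  init_state: "imp [] (St 0 0) \<in> tableau M s l T B"
| init_head: "j < tapes M \<Longrightarrow> imp [] (Hd 0 j 0) \<in> tableau M s l T B"
| init_blank: "0 < j \<Longrightarrow> j < tapes M \<Longrightarrow> \<bar>p\<bar> \<le> int B \<Longrightarrow> imp [] (Ct 0 j p 0) \<in> tableau M s l T B"
| init_outside: "p < 0 \<or> p > 2 * int s + int l \<Longrightarrow> \<bar>p\<bar> \<le> int B \<Longrightarrow> imp [] (Ct 0 0 p 0) \<in> tableau M s l T B"
| init_flag: "i < s \<Longrightarrow> imp [] (Ct 0 0 (2 * int i) 2) \<in> tableau M s l T B"
| init_true: "i < s \<Longrightarrow> imp [In i] (Ct 0 0 (2 * int i + 1) 2) \<in> tableau M s l T B"
| init_false: "i < s \<Longrightarrow> [(In i, True), (Ct 0 0 (2 * int i + 1) 1, True)] \<in> tableau M s l T B"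
| init_sep: "imp [] (Ct 0 0 (2 * int s) 1) \<in> tableau M s l T B"
| init_witness: "i < l \<Longrightarrow> map (\<lambda>a. (Ct 0 0 (2 * int s + 1 + int i) a, True)) [0, 1, 2] \<in> tableau M s l T B"
| init_end: "2 * int s + 1 \<le> p \<Longrightarrow> p < int B \<Longrightarrow> imp [Ct 0 0 p 0] (Ct 0 0 (p + 1) 0) \<in> tableau M s l T B"
| scan: "t < T \<Longrightarrow> j < tapes M \<Longrightarrow> \<bar>p\<bar> \<le> int B \<Longrightarrow> a < symbols M \<Longrightarrow>
    imp [Hd t j p, Ct t j p a] (Sc t j a) \<in> tableau M s l T B"
| next_state: "t < T \<Longrightarrow> q \<le> states M \<Longrightarrow> as \<in> tuples {..<symbols M} (tapes M) \<Longrightarrow>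
    imp (scan_premises M t q as) (St (Suc t) (fst (transition M q as))) \<in> tableau M s l T B"
| next_head: "t < T \<Longrightarrow> q \<le> states M \<Longrightarrow> as \<in> tuples {..<symbols M} (tapes M) \<Longrightarrow> j < tapes M \<Longrightarrow> \<bar>p\<bar> < int B \<Longrightarrow>
    imp (Hd t j p # scan_premises M t q as) (Hd (Suc t) j (p + move_offset (snd (snd (transition M q as) ! j))))
      \<in> tableau M s l T B"
| next_written: "t < T \<Longrightarrow> q \<le> states M \<Longrightarrow> as \<in> tuples {..<symbols M} (tapes M) \<Longrightarrow> j < tapes M \<Longrightarrow> \<bar>p\<bar> \<le> int B \<Longrightarrow>
    imp (Hd t j p # scan_premises M t q as) (Ct (Suc t) j p (fst (snd (transition M q as) ! j)))
      \<in> tableau M s l T B"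
| next_unchanged: "t < T \<Longrightarrow> j < tapes M \<Longrightarrow> \<bar>p\<bar> \<le> int B \<Longrightarrow> \<bar>p'\<bar> \<le> int B \<Longrightarrow> p \<noteq> p' \<Longrightarrow> a < symbols M \<Longrightarrow>
    imp [Hd t j p, Ct t j p' a] (Ct (Suc t) j p' a) \<in> tableau M s l T B"
| accept: "\<bar>p\<bar> \<le> int B \<Longrightarrow> [(Hd T 1 p, False), (Ct T 1 p 1, False)] \<in> tableau M s l T B"

definition atoms :: "tm \<Rightarrow> nat \<Rightarrow> nat \<Rightarrow> nat \<Rightarrow> atom set" where
  "atoms M s T B = In ` {..<s} \<union> (\<lambda>(t, q). St t q) ` ({..T} \<times> {..states M})
     \<union> (\<lambda>(t, j, a). Sc t j a) ` ({..T} \<times> {..<tapes M} \<times> {..<symbols M})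
     \<union> (\<lambda>(t, j, p). Hd t j p) ` ({..T} \<times> {..<tapes M} \<times> {- int B..int B})
     \<union> (\<lambda>(t, j, p, a). Ct t j p a) ` ({..T} \<times> {..<tapes M} \<times> {- int B..int B} \<times> {..<symbols M})"

lemma atoms_simps [simp]:
  "In i \<in> atoms M s T B \<longleftrightarrow> i < s"
  "St t q \<in> atoms M s T B \<longleftrightarrow> t \<le> T \<and> q \<le> states M"
  "Sc t j a \<in> atoms M s T B \<longleftrightarrow> t \<le> T \<and> j < tapes M \<and> a < symbols M"
  "Hd t j p \<in> atoms M s T B \<longleftrightarrow> t \<le> T \<and> j < tapes M \<and> \<bar>p\<bar> \<le> int B"
  "Ct t j p a \<in> atoms M s T B \<longleftrightarrow> t \<le> T \<and> j < tapes M \<and> \<bar>p\<bar> \<le> int B \<and> a < symbols M"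
  by (auto simp: atoms_def abs_le_iff image_iff)

lemma finite_atoms: "finite (atoms M s T B)"
  by (simp add: atoms_def)

lemma card_atoms: "card (atoms M s T B) \<le> s + (T + 1) * (states M + 1) + (T + 1) * (tapes M * symbols M)
   + (T + 1) * (tapes M * (2 * B + 1)) + (T + 1) * (tapes M * ((2 * B + 1) * symbols M))"
proof -
  have c: "card {- int B..int B} = 2 * B + 1" by simp
  have "card (In ` {..<s}) \<le> s" using card_image_le[of "{..<s}" In] by simp
  moreover have "card ((\<lambda>(t, q). St t q) ` ({..T} \<times> {..states M})) \<le> (T + 1) * (states M + 1)"
    by (rule order_trans[OF card_image_le]) (simp_all add: card_cartesian_product)
  moreover have "card ((\<lambda>(t, j, a). Sc t j a) ` ({..T} \<times> {..<tapes M} \<times> {..<symbols M})) \<le> (T + 1) * (tapes M * symbols M)"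
    by (rule order_trans[OF card_image_le]) (simp_all add: card_cartesian_product)
  moreover have "card ((\<lambda>(t, j, p). Hd t j p) ` ({..T} \<times> {..<tapes M} \<times> {- int B..int B})) \<le> (T + 1) * (tapes M * (2 * B + 1))"
    by (rule order_trans[OF card_image_le]) (simp_all add: card_cartesian_product c del: card_atLeastAtMost_int)
  moreover have "card ((\<lambda>(t, j, p, a). Ct t j p a) ` ({..T} \<times> {..<tapes M} \<times> {- int B..int B} \<times> {..<symbols M}))
      \<le> (T + 1) * (tapes M * ((2 * B + 1) * symbols M))"
    by (rule order_trans[OF card_image_le]) (simp_all add: card_cartesian_product c del: card_atLeastAtMost_int)
  ultimately show ?thesis
    unfolding atoms_def
    by (intro order_trans[OF card_Un_le] add_mono) auto
qed

lemma transition_props: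
  assumes "wf_tm M" "q \<le> states M" "as \<in> tuples {..<symbols M} (tapes M)"
  shows "fst (transition M q as) \<le> states M" "length (snd (transition M q as)) = tapes M"
    "j < tapes M \<Longrightarrow> fst (snd (transition M q as) ! j) < symbols M"
proof -
  obtain q' ws where d: "transition M q as = (q', ws)" by fastforce
  have "q' \<le> states M \<and> length ws = tapes M \<and> fst ` set ws \<subseteq> {..<symbols M}"
  proof (cases "q < states M")
    case True
    then show ?thesis using wf_tm_delta[OF assms(1) True assms(3)] d by (simp add: transition_def)
  next
    case False
    then show ?thesis using assms(2,3) d by (auto simp: transition_def tuples_def)
  qed
  then show "fst (transition M q as) \<le> states M" "length (snd (transition M q as)) = tapes M"
    "j < tapes M \<Longrightarrow> fst (snd (transition M q as) ! j) < symbols M"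
    using d nth_mem[of j ws] by (auto simp: subset_iff image_iff simp del: nth_mem)
qed

lemma step_transition:
  assumes "valid_config M (q, ts)"
  shows "step M (q, ts) = (fst (transition M q (map scanned ts)), map2 update_tape ts (snd (transition M q (map scanned ts))))"
proof (cases "q < states M")
  case False
  have "map2 update_tape ts (map (\<lambda>a. (a, Stay)) (map scanned ts)) = ts"
    by (induction ts) (auto simp: update_tape_def scanned_def)
  then show ?thesis using False by (simp add: transition_def comp_def)
qed (auto simp: transition_def split: prod.split)

text \<open>The width depends on \<open>M\<close> alone; hence polynomially many atoms also bound
  the number of clauses polynomially. The bound on \<open>B\<close> keeps all cells of the input in
  range.\<close>

lemma tableau_clauses:
  assumes wf: "wf_tm M" and B: "2 * s + l + 2 \<le> B"
  shows "tableau M s l T B \<subseteq> clauses_over (atoms M s T B) (tapes M + 5)"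
proof
  fix C assume "C \<in> tableau M s l T B"
  have K: "tapes M \<ge> 2" "symbols M \<ge> 3" using wf by (auto simp: wf_tm_def)
  have prem: "set (scan_premises M t q as) \<subseteq> atoms M s T B" "length (scan_premises M t q as) = tapes M + 1"
    if "t < T" "q \<le> states M" "as \<in> tuples {..<symbols M} (tapes M)" for t q as
    using that by (auto simp: scan_premises_def tuples_def subset_iff)
  have imp: "imp bs b \<in> clauses_over (atoms M s T B) (tapes M + 5)"
    if "set bs \<subseteq> atoms M s T B" "b \<in> atoms M s T B" "length bs \<le> tapes M + 2" for bs b
    using that by (auto simp: clauses_over_def imp_def)
  from \<open>C \<in> tableau M s l T B\<close> show "C \<in> clauses_over (atoms M s T B) (tapes M + 5)"
  proof cases
    case (next_state t q as)
    then show ?thesis using prem[of t q as] transition_props[OF wf, of q as] by (auto intro!: imp)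
  next
    case (next_head t q as j p)
    have "\<bar>p + move_offset m\<bar> \<le> int B" for m using next_head by (cases m) auto
    then show ?thesis using prem[of t q as] transition_props[OF wf, of q as] next_head by (auto intro!: imp)
  next
    case (next_written t q as j p)
    then show ?thesis using prem[of t q as] transition_props[OF wf, of q as] by (auto intro!: imp)
  qed (use K B in \<open>auto intro!: imp\<close>, (auto simp: clauses_over_def)[])+
qed

section \<open>The actual run as the intended model, and its presence in every model\<close>

context
  fixes M :: tm and x u :: "bool list"
begin

definition run :: "nat \<Rightarrow> config" where
  "run t = (step M ^^ t) (initial_config M (encode_pair (x, u)))"

fun run_holds :: "atom \<Rightarrow> bool" where
  "run_holds (In i) = x ! i"
| "run_holds (St t q) = (fst (run t) = q)"
| "run_holds (Sc t j a) = (scanned (snd (run t) ! j) = a)"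
| "run_holds (Hd t j p) = (snd (snd (run t) ! j) = p)"
| "run_holds (Ct t j p a) = (fst (snd (run t) ! j) p = a)"

lemma initial_content:
  "fst (word_tape (encode_pair (x, u))) p =
     (if p < 0 \<or> p > 2 * int (length x) + int (length u) then 0
      else if p < 2 * int (length x) then (if even p then 2 else bit_symbol (x ! nat (p div 2)))
      else if p = 2 * int (length x) then 1 else bit_symbol (u ! nat (p - 2 * int (length x) - 1)))"
proof -
  have d: "length (doubled x) = 2 * length x" for x :: "bool list" by (induction x) auto
  have n: "doubled x ! i = (even i \<or> x ! (i div 2))" if "i < 2 * length x" for i and x :: "bool list"
    using that
  proof (induction x arbitrary: i)
    case (Cons b x)
    show ?case
    proof (cases "i < 2")
      case True
      then have "i = 0 \<or> i = 1" by linarith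
      then show ?thesis by auto
    next
      case False
      then obtain i' where "i = Suc (Suc i')" by (metis Suc_lessI add_2_eq_Suc le_add_diff_inverse not_less)
      then show ?thesis using Cons by simp
    qed
  qed simp
  consider "p < 0 \<or> p > 2 * int (length x) + int (length u)" | "0 \<le> p" "p < 2 * int (length x)"
    | "p = 2 * int (length x)" | "2 * int (length x) < p" "p \<le> 2 * int (length x) + int (length u)" by linarith
  then show ?thesis
  proof cases
    case 1
    then show ?thesis by (auto simp: word_tape_def d)
  next
    case 2
    then obtain i where i: "p = int i" using nonneg_int_cases by blast
    then have "i < 2 * length x" using 2 by linarith
    moreover have "nat (p div 2) = i div 2" using i by (simp add: nat_div_distrib)
    ultimately show ?thesis using 2 i n[of i x] by (auto simp: word_tape_def nth_append d)
  next
    case 3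
    then show ?thesis by (auto simp: word_tape_def nth_append d nat_mult_distrib)
  next
    case 4
    then obtain i where i: "p = 2 * int (length x) + 1 + int i"
      using zle_iff_zadd[of "2 * int (length x) + 1" p] by auto
    then have "nat p = Suc (2 * length x + i)" by (simp add: nat_add_distrib)
    then show ?thesis using 4 i by (auto simp: word_tape_def nth_append d)
  qed
qed

lemma run_0: "run 0 = (0, word_tape (encode_pair (x, u)) # replicate (tapes M - 1) (word_tape []))"
  by (simp add: run_def initial_config_def)

lemma run_Suc:
  assumes "wf_tm M"
  shows "fst (run t) \<le> states M" "length (snd (run t)) = tapes M"
    "map scanned (snd (run t)) \<in> tuples {..<symbols M} (tapes M)"
    "j < tapes M \<Longrightarrow> fst (snd (run t) ! j) p < symbols M"
    "fst (run (Suc t)) = fst (transition M (fst (run t)) (map scanned (snd (run t))))"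
    "j < tapes M \<Longrightarrow> snd (run (Suc t)) ! j =
      update_tape (snd (run t) ! j) (snd (transition M (fst (run t)) (map scanned (snd (run t)))) ! j)"
proof -
  have v: "valid_config M (run t)" unfolding run_def by (rule valid_config_funpow[OF assms])
  then show le: "fst (run t) \<le> states M" and len: "length (snd (run t)) = tapes M"
    and "j < tapes M \<Longrightarrow> fst (snd (run t) ! j) p < symbols M"
    by (auto simp: valid_config_def)
  show sc: "map scanned (snd (run t)) \<in> tuples {..<symbols M} (tapes M)"
    using valid_config_scanned[of M "fst (run t)" "snd (run t)"] v by simp
  have "run (Suc t) = step M (fst (run t), snd (run t))" by (simp add: run_def)
  also note step_transition[of M "fst (run t)" "snd (run t)"]
  finally have s: "run (Suc t) = (fst (transition M (fst (run t)) (map scanned (snd (run t)))),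
      map2 update_tape (snd (run t)) (snd (transition M (fst (run t)) (map scanned (snd (run t))))))"
    using v by simp
  then show "fst (run (Suc t)) = fst (transition M (fst (run t)) (map scanned (snd (run t))))" by simp
  show "j < tapes M \<Longrightarrow> snd (run (Suc t)) ! j =
      update_tape (snd (run t) ! j) (snd (transition M (fst (run t)) (map scanned (snd (run t)))) ! j)"
    using s len transition_props(2)[OF assms le sc] by simp
qed

lemma abs_head_le: "wf_tm M \<Longrightarrow> j < tapes M \<Longrightarrow> \<bar>snd (snd (run t) ! j)\<bar> \<le> int t"
proof (induction t)
  case 0
  then show ?case by (cases j) (auto simp: run_0 word_tape_def)
next
  case (Suc t)
  obtain m where m: "snd (snd (run (Suc t)) ! j) = snd (snd (run t) ! j) + move_offset m"
    using run_Suc(6)[OF Suc.prems, of t] by (simp add: update_tape_def)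
  have "\<bar>move_offset m\<bar> \<le> 1" by (cases m) auto
  then show ?case
    using Suc.IH[OF Suc.prems] abs_triangle_ineq[of "snd (snd (run t) ! j)" "move_offset m"]
    unfolding m by simp
qed

lemma run_output:
  assumes "outputs_within M T' (encode_pair (x, u)) [b]" "T' \<le> T" "wf_tm M"
  shows "fst (snd (run T) ! 1) (snd (snd (run T) ! 1)) = bit_symbol b"
proof -
  have 1: "fst (run T') = states M" "tape_word (snd (run T') ! 1) [b]"
    using assms(1) by (auto simp: outputs_within_def run_def split: prod.splits)
  moreover have "run T = run T'"
    using 1(1) assms(2) unfolding run_def by (intro step_funpow_mono) auto
  ultimately show ?thesis by (simp add: tape_word_def)
qed

lemma sat_tableau_run:
  assumes wf: "wf_tm M" and len: "length x = s" "length u \<le> l"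
    and acc: "fst (snd (run T) ! 1) (snd (snd (run T) ! 1)) = 2"
  shows "sat run_holds (tableau M s l T B)"
  unfolding sat_def
proof
  have K: "tapes M \<ge> 2" "symbols M \<ge> 3" using wf by (auto simp: wf_tm_def)
  have prem: "fst (run t) = q \<and> map scanned (snd (run t)) = as"
    if "\<forall>a \<in> set (scan_premises M t q as). run_holds a" "as \<in> tuples {..<symbols M} (tapes M)" for t q as
    using that run_Suc(2)[OF wf, of t]
    by (auto simp: scan_premises_def tuples_def intro!: nth_equalityI)
  have c0: "fst (snd (run 0) ! 0) p = fst (word_tape (encode_pair (x, u))) p" for p
    by (simp add: run_0)
  note c = c0[unfolded initial_content]
  fix C assume "C \<in> tableau M s l T B"
  then show "sat_clause run_holds C"
  proof cases
    case (init_blank j p)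
    then show ?thesis by (cases j) (auto simp: sat_clause_imp run_0 word_tape_def)
  next
    case (init_head j)
    then show ?thesis by (cases j) (auto simp: sat_clause_imp run_0 word_tape_def)
  next
    case (init_outside p)
    then show ?thesis using len by (auto simp: sat_clause_imp c)
  next
    case (init_false i)
    then show ?thesis using len by (auto simp: sat_clause_def sat_lit_def c)
  next
    case (init_witness i)
    have "fst (snd (run 0) ! 0) (2 * int s + 1 + int i) \<in> {0, 1, 2}"
      by (auto simp: c bit_symbol_def)
    then show ?thesis using init_witness by (auto simp: sat_clause_def sat_lit_def)
  next
    case (init_end p)
    then show ?thesis using len by (auto simp: sat_clause_imp c split: if_splits)
  next
    case (scan t j p a)
    then show ?thesis by (auto simp: sat_clause_imp scanned_def)
  next
    case (next_state t q as)
    then show ?thesis using prem[of t q as] run_Suc[OF wf] by (auto simp: sat_clause_imp)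
  next
    case (next_head t q as j p)
    then show ?thesis using prem[of t q as] run_Suc[OF wf] by (auto simp: sat_clause_imp update_tape_def)
  next
    case (next_written t q as j p)
    then show ?thesis using prem[of t q as] run_Suc[OF wf] by (auto simp: sat_clause_imp update_tape_def)
  next
    case (next_unchanged t j p p' a)
    then show ?thesis using run_Suc[OF wf] by (auto simp: sat_clause_imp update_tape_def)
  next
    case (accept p)
    then show ?thesis using acc by (auto simp: sat_clause_def sat_lit_def)
  next
    case init_state
    then show ?thesis by (simp add: sat_clause_imp run_0)
  next
    case (init_flag i)
    then show ?thesis using len c[of "2 * int i"] by (simp add: sat_clause_imp)
  next
    case (init_true i)
    then show ?thesis using len c[of "2 * int i + 1"] by (simp add: sat_clause_imp)
  next
    case init_sep
    then show ?thesis using len c[of "2 * int s"] by (simp add: sat_clause_imp)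
  qed
qed

text \<open>Induction on time along the Horn rules. Since \<open>T < B\<close>, no head reaches the
  border, where \<open>next_head\<close> has no clause. A model may contain further atoms; only the
  presence of the true ones is claimed.\<close>

lemma run_in_model:
  assumes wf: "wf_tm M" and sat: "sat \<alpha> (tableau M s l T B)" and B: "T < B"
    and init: "\<And>p. \<bar>p\<bar> \<le> int B \<Longrightarrow> \<alpha> (Ct 0 0 p (fst (word_tape (encode_pair (x, u))) p))"
  shows "t \<le> T \<Longrightarrow> \<alpha> (St t (fst (run t))) \<and>
    (\<forall>j < tapes M. \<alpha> (Hd t j (snd (snd (run t) ! j))) \<and>
      (\<forall>p. \<bar>p\<bar> \<le> int B \<longrightarrow> \<alpha> (Ct t j p (fst (snd (run t) ! j) p))))"
proof (induction t)
  have s: "sat_clause \<alpha> C" if "C \<in> tableau M s l T B" for C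
    using sat that by (simp add: sat_def)
  case 0
  have "\<alpha> (Hd 0 j 0)" if "j < tapes M" for j
    using s[OF init_head[OF that]] by (simp add: sat_clause_imp)
  moreover have "\<alpha> (Ct 0 j p (fst (snd (run 0) ! j) p))" if "j < tapes M" "\<bar>p\<bar> \<le> int B" for j p
  proof (cases j)
    case 0
    then show ?thesis using init that by (simp add: run_0)
  next
    case (Suc j')
    then show ?thesis using s[OF init_blank[of j M p B]] that by (auto simp: sat_clause_imp run_0 word_tape_def)
  qed
  moreover have "snd (snd (run 0) ! j) = 0" if "j < tapes M" for j
    using that by (cases j) (auto simp: run_0 word_tape_def)
  ultimately show ?case using s[OF init_state] by (auto simp: sat_clause_imp run_0)
next
  have s: "sat_clause \<alpha> C" if "C \<in> tableau M s l T B" for C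
    using sat that by (simp add: sat_def)
  case (Suc t)
  let ?as = "map scanned (snd (run t))" and ?q = "fst (run t)"
  let ?ws = "snd (transition M ?q ?as)"
  note r = run_Suc[OF wf, where t = t]
  have t: "t < T" and IH: "\<alpha> (St t ?q)" "\<And>j. j < tapes M \<Longrightarrow> \<alpha> (Hd t j (snd (snd (run t) ! j)))"
    "\<And>j p. j < tapes M \<Longrightarrow> \<bar>p\<bar> \<le> int B \<Longrightarrow> \<alpha> (Ct t j p (fst (snd (run t) ! j) p))"
    using Suc by auto
  have h: "\<bar>snd (snd (run t) ! j)\<bar> < int B" if "j < tapes M" for j
    using abs_head_le[OF wf that, of t] t B by linarith
  have "\<alpha> (Sc t j (?as ! j))" if "j < tapes M" for j
    using s[OF scan[OF t that, of "snd (snd (run t) ! j)" B "?as ! j"]] IH(2)[OF that]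
      IH(3)[OF that, of "snd (snd (run t) ! j)"] h[OF that] that r
    by (auto simp: sat_clause_imp scanned_def)
  then have prem: "\<forall>a \<in> set (scan_premises M t ?q ?as). \<alpha> a"
    using IH(1) by (auto simp: scan_premises_def)
  have "\<alpha> (St (Suc t) (fst (run (Suc t))))"
    using s[OF next_state[OF t r(1,3)]] prem r(5) by (simp add: sat_clause_imp)
  moreover have "\<alpha> (Hd (Suc t) j (snd (snd (run (Suc t)) ! j)))" if "j < tapes M" for j
    using s[OF next_head[OF t r(1,3) that h[OF that]]] prem IH(2)[OF that] r(6)[OF that]
    by (simp add: sat_clause_imp update_tape_def)
  moreover have "\<alpha> (Ct (Suc t) j p (fst (snd (run (Suc t)) ! j) p))" if j: "j < tapes M" and p: "\<bar>p\<bar> \<le> int B" for j p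
  proof (cases "p = snd (snd (run t) ! j)")
    case True
    then show ?thesis
      using s[OF next_written[OF t r(1,3) j p]] prem IH(2)[OF j] r(6)[OF j]
      by (simp add: sat_clause_imp update_tape_def)
  next
    case False
    then show ?thesis
      using s[OF next_unchanged[OF t j _ p, of "snd (snd (run t) ! j)" "fst (snd (run t) ! j) p"]]
        IH(2)[OF j] IH(3)[OF j p] h[OF j] r(4,6)[OF j]
      by (simp add: sat_clause_imp update_tape_def)
  qed
  ultimately show ?case by blast
qed

end

lemma initial_in_model:
  assumes sat: "sat \<alpha> (tableau M s l T B)" and B: "2 * s + l + 2 \<le> B"
    and x: "length x = s" "\<And>i. i < s \<Longrightarrow> \<alpha> (In i) = x ! i"
  obtains u where "length u \<le> l"
    "\<And>p. \<bar>p\<bar> \<le> int B \<Longrightarrow> \<alpha> (Ct 0 0 p (fst (word_tape (encode_pair (x, u))) p))"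
proof -
  have s: "sat_clause \<alpha> C" if "C \<in> tableau M s l T B" for C
    using sat that by (simp add: sat_def)
  let ?c = "\<lambda>i. Ct 0 0 (2 * int s + 1 + int i)"
  \<comment> \<open>The guessed witness ends at the first cell after the separator that carries a
    blank; \<open>init_outside\<close> provides one at offset \<open>l\<close>.\<close>
  define n where "n = (LEAST i. \<alpha> (?c i 0))"
  have "\<alpha> (?c l 0)"
    using s[OF init_outside[of "2 * int s + 1 + int l" s l B]] B by (simp add: sat_clause_imp)
  then have n: "\<alpha> (?c n 0)" "n \<le> l" unfolding n_def by (auto intro: LeastI Least_le)
  \<comment> \<open>A model may put both bit symbols on a cell; then \<open>2\<close> wins, and
    where it is missing \<open>init_witness\<close> forces \<open>1\<close>.\<close>
  define u where "u = map (\<lambda>i. \<alpha> (?c i 2)) [0..<n]"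
  have u: "\<alpha> (?c i (bit_symbol (u ! i)))" if "i < n" for i
  proof -
    have "\<not> \<alpha> (?c i 0)" using that not_less_Least unfolding n_def by blast
    then show ?thesis
      using s[OF init_witness[of i l]] that n(2)
      by (auto simp: sat_clause_def sat_lit_def u_def bit_symbol_def)
  qed
  \<comment> \<open>\<open>init_end\<close> carries the first blank on to position \<open>B\<close>,
    so the tape contains the blanks behind \<open>u\<close>, whatever else the model puts
    there.\<close>
  have end_blank: "\<alpha> (?c (n + d) 0)" if "2 * s + 1 + n + d \<le> B" for d
    using that
  proof (induction d)
    case (Suc d)
    then show ?case
      using s[OF init_end[of s "2 * int s + 1 + int (n + d)" B]] by (simp add: sat_clause_imp algebra_simps)
  qed (use n in simp)
  show ?thesis
  proof (rule that[of u])
    fix p :: int assume p: "\<bar>p\<bar> \<le> int B"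
    have len: "length u = n" by (simp add: u_def)
    consider "p < 0" | i where "p = 2 * int i" "i < s" | i where "p = 2 * int i + 1" "i < s" | "p = 2 * int s"
      | i where "p = 2 * int s + 1 + int i" "i < n" | d where "p = 2 * int s + 1 + int (n + d)"
    proof -
      consider "p < 0" | "0 \<le> p" "p < 2 * int s" | "p = 2 * int s" | "2 * int s + 1 \<le> p" by linarith
      then show thesis
      proof cases
        case 2
        then obtain j where j: "p = int j" using nonneg_int_cases by blast
        then have "p = 2 * int (j div 2) \<or> p = 2 * int (j div 2) + 1" "j div 2 < s" using 2 by auto
        then show ?thesis using that(2,3) by blast
      next
        case 4
        then obtain j where j: "p = 2 * int s + 1 + int j" using zle_iff_zadd by blast
        show ?thesis
        proof (cases "j < n")
          case False
          then show ?thesis using j that(6)[of "j - n"] by simp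
        qed (use j that in blast)
      qed (use that in auto)
    qed
    then show "\<alpha> (Ct 0 0 p (fst (word_tape (encode_pair (x, u))) p))"
    proof cases
      case 1
      then show ?thesis using s[OF init_outside[of p s l B]] p by (simp add: sat_clause_imp initial_content del: encode_pair.simps)
    next
      case (2 i)
      then show ?thesis using s[OF init_flag[of i s]] x(1) by (simp add: sat_clause_imp initial_content del: encode_pair.simps)
    next
      case (3 i)
      have "x ! i \<longrightarrow> \<alpha> (Ct 0 0 p 2)"
        using s[OF init_true[OF 3(2)]] x(2)[OF 3(2)] 3(1) by (simp add: sat_clause_imp)
      moreover have "x ! i \<or> \<alpha> (Ct 0 0 p 1)"
        using s[OF init_false[OF 3(2)]] x(2)[OF 3(2)] 3(1) by (simp add: sat_clause_def sat_lit_def)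
      ultimately have "\<alpha> (Ct 0 0 p (bit_symbol (x ! i)))" by (auto simp: bit_symbol_def)
      then show ?thesis using 3 x(1) by (simp add: initial_content del: encode_pair.simps)
    next
      case 4
      then show ?thesis using s[OF init_sep] x(1) by (simp add: sat_clause_imp initial_content del: encode_pair.simps)
    next
      case (5 i)
      then show ?thesis using u[of i] x(1) len by (simp add: initial_content del: encode_pair.simps)
    next
      case (6 d)
      then show ?thesis using end_blank[of d] x(1) len p by (simp add: initial_content del: encode_pair.simps)
    qed
  qed (use n in \<open>simp add: u_def\<close>)
qed

lemma tableau_correct:
  assumes wf: "wf_tm M" and B: "2 * s + l + 2 \<le> B" "T < B" and x: "length x = s"
    and out: "\<And>u. length u \<le> l \<Longrightarrow> \<exists>T' \<le> T. outputs_within M T' (encode_pair (x, u)) [V u]"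
  shows "(\<exists>u. length u \<le> l \<and> V u) \<longleftrightarrow>
    (\<exists>\<alpha>. (\<forall>i < s. \<alpha> (In i) = x ! i) \<and> sat \<alpha> (tableau M s l T B))"
proof
  assume "\<exists>u. length u \<le> l \<and> V u"
  then obtain u where u: "length u \<le> l" "V u" by blast
  obtain T' where "T' \<le> T" "outputs_within M T' (encode_pair (x, u)) [V u]" using out[OF u(1)] by blast
  from run_output[OF this(2,1) wf] u(2)
  have "fst (snd (run M x u T) ! 1) (snd (snd (run M x u T) ! 1)) = 2" by simp
  from sat_tableau_run[OF wf x u(1) this]
  show "\<exists>\<alpha>. (\<forall>i < s. \<alpha> (In i) = x ! i) \<and> sat \<alpha> (tableau M s l T B)"
    by (intro exI[of _ "run_holds M x u"]) auto
next
  assume "\<exists>\<alpha>. (\<forall>i < s. \<alpha> (In i) = x ! i) \<and> sat \<alpha> (tableau M s l T B)"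
  then obtain \<alpha> where \<alpha>: "\<And>i. i < s \<Longrightarrow> \<alpha> (In i) = x ! i" "sat \<alpha> (tableau M s l T B)" by blast
  obtain u where u: "length u \<le> l"
    "\<And>p. \<bar>p\<bar> \<le> int B \<Longrightarrow> \<alpha> (Ct 0 0 p (fst (word_tape (encode_pair (x, u))) p))"
    using initial_in_model[OF \<alpha>(2) B(1) x \<alpha>(1)] by blast
  let ?r = "snd (run M x u T) ! 1"
  have K: "1 < tapes M" using wf by (simp add: wf_tm_def)
  have p: "\<bar>snd ?r\<bar> \<le> int B" using abs_head_le[OF wf K, of x u T] B(2) by linarith
  have "\<alpha> (Hd T 1 (snd ?r))" "\<alpha> (Ct T 1 (snd ?r) (fst ?r (snd ?r)))"
    using run_in_model[OF wf \<alpha>(2) B(2) u(2), of T] K p by auto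
  moreover have "sat_clause \<alpha> [(Hd T 1 (snd ?r), False), (Ct T 1 (snd ?r) 1, False)]"
    using \<alpha>(2) accept[OF p] by (simp add: sat_def)
  \<comment> \<open>\<open>accept\<close> excludes only the symbol \<open>1\<close>; the output is a
    single bit, so this means acceptance.\<close>
  ultimately have "fst ?r (snd ?r) \<noteq> 1" by (auto simp: sat_clause_def sat_lit_def)
  moreover obtain T' where T': "T' \<le> T" "outputs_within M T' (encode_pair (x, u)) [V u]"
    using out[OF u(1)] by blast
  note run_output[OF T'(2,1) wf]
  ultimately have "V u" by (auto simp: bit_symbol_def split: if_splits)
  with u(1) show "\<exists>u. length u \<le> l \<and> V u" by blast
qed

section \<open>Variables as natural numbers\<close>

lemma sat_clause_map: "sat_clause \<beta> (map (map_prod g id) C) \<longleftrightarrow> sat_clause (\<beta> \<circ> g) C"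
  by (auto simp: sat_clause_def sat_lit_def)

lemma sat_clause_cong:
  "(\<And>v. v \<in> fst ` set C \<Longrightarrow> \<alpha> v = \<beta> v) \<Longrightarrow> sat_clause \<alpha> C \<longleftrightarrow> sat_clause \<beta> C"
  by (auto simp: sat_clause_def sat_lit_def)

lemma sat_cong:
  assumes "F \<subseteq> clauses_over A c" "\<And>v. v \<in> A \<Longrightarrow> \<alpha> v = \<beta> v"
  shows "sat \<alpha> F \<longleftrightarrow> sat \<beta> F"
proof -
  have "sat_clause \<alpha> C \<longleftrightarrow> sat_clause \<beta> C" if "C \<in> F" for C
  proof (rule sat_clause_cong)
    have "set C \<subseteq> A \<times> UNIV" using that assms(1) by (auto simp: clauses_over_def)
    then show "\<alpha> v = \<beta> v" if "v \<in> fst ` set C" for v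
      using that by (intro assms(2)) auto
  qed
  then show ?thesis by (simp add: sat_def)
qed

text \<open>One clause set serves all words of length \<open>s\<close>, which enter only through the
  values of the variables below \<open>s\<close>. The width \<open>c\<close> does not depend on
  \<open>s\<close>, so the number of clauses is polynomial along with \<open>n\<close>.\<close>

theorem NP_CNF:
  assumes "L \<in> NP"
  obtains n c where "poly_bounded n" "\<And>s. s \<le> n s"
    "\<And>s. \<exists>F \<subseteq> clauses_over {..<n s} c. \<forall>x. length x = s \<longrightarrow>
      (x \<in> L \<longleftrightarrow> (\<exists>\<alpha>. (\<forall>i < s. \<alpha> i = x ! i) \<and> sat \<alpha> F))"
proof -
  obtain V p where "poly_time_computable encode_pair encode_bool V" and
    L: "\<And>x. x \<in> L \<longleftrightarrow> (\<exists>u. length u \<le> poly p (length x) \<and> V (x, u))"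
    using assms unfolding NP_def by blast
  then obtain M r where wf: "wf_tm M" and
    out: "\<And>xu. outputs_within M (poly r (length (encode_pair xu))) (encode_pair xu) [V xu]"
    unfolding poly_time_computable_def encode_bool_def by blast
  define T where "T s = poly r (2 * s + 1 + poly p s)" for s
  \<comment> \<open>Room for the whole input and for every head position within \<open>T s\<close>
    steps, as \<open>tableau_correct\<close> demands.\<close>
  define B where "B s = T s + 2 * s + poly p s + 2" for s
  let ?A = "\<lambda>s. atoms M s (T s) (B s)"
  define n where "n s = s + card (?A s)" for s
  have "poly_bounded n"
  proof (rule poly_bounded_le)
    show "n s \<le> s + (s + (T s + 1) * (states M + 1) + (T s + 1) * (tapes M * symbols M)
      + (T s + 1) * (tapes M * (2 * B s + 1)) + (T s + 1) * (tapes M * ((2 * B s + 1) * symbols M)))" for s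
      unfolding n_def using card_atoms by (intro add_left_mono)
  qed (unfold B_def T_def, intro poly_bounded_intros)
  moreover have "\<exists>F \<subseteq> clauses_over {..<n s} (tapes M + 5). \<forall>x. length x = s \<longrightarrow>
      (x \<in> L \<longleftrightarrow> (\<exists>\<alpha>. (\<forall>i < s. \<alpha> i = x ! i) \<and> sat \<alpha> F))" for s
  proof -
    obtain e where e: "bij_betw e (?A s) {0..<card (?A s)}"
      using ex_bij_betw_finite_nat[OF finite_atoms] by blast
    \<comment> \<open>Input atoms get the numbers below \<open>s\<close> and all others are moved
      above them; hence the summand \<open>s\<close> in \<open>n s\<close>.\<close>
    define g where "g a = (case a of In i \<Rightarrow> i | _ \<Rightarrow> s + e a)" for a
    have g_In: "g (In i) = i" for i by (simp add: g_def)
    have g_cases: "(\<exists>i < s. a = In i \<and> g a = i) \<or> g a = s + e a" if "a \<in> ?A s" for a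
      using that by (cases a) (auto simp: g_def)
    have inj: "inj_on g (?A s)"
    proof (rule inj_onI)
      fix a b assume ab: "a \<in> ?A s" "b \<in> ?A s" "g a = g b"
      have "a = b" if "e a = e b" using inj_onD[OF bij_betw_imp_inj_on[OF e] that ab(1,2)] .
      then show "a = b"
        using g_cases[OF ab(1)] g_cases[OF ab(2)] ab(3) by (elim disjE exE conjE) simp_all
    qed
    have g_less: "g a < n s" if "a \<in> ?A s" for a
    proof -
      have "e a < card (?A s)" using bij_betwE[OF e] that by auto
      then show ?thesis using g_cases[OF that] by (auto simp: n_def)
    qed
    let ?F = "tableau M s (poly p s) (T s) (B s)"
    let ?G = "map (map_prod g id) ` ?F"
    have F: "?F \<subseteq> clauses_over (?A s) (tapes M + 5)"
      by (rule tableau_clauses[OF wf]) (simp add: B_def)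
    have "?G \<subseteq> clauses_over {..<n s} (tapes M + 5)"
    proof (rule image_subsetI)
      fix C assume "C \<in> ?F"
      with F have "set C \<subseteq> ?A s \<times> UNIV" "length C \<le> tapes M + 5" by (auto simp: clauses_over_def)
      then show "map (map_prod g id) C \<in> clauses_over {..<n s} (tapes M + 5)"
        using g_less by (auto simp: clauses_over_def)
    qed
    moreover have "x \<in> L \<longleftrightarrow> (\<exists>\<beta>. (\<forall>i < s. \<beta> i = x ! i) \<and> sat \<beta> ?G)" if x: "length x = s" for x
    proof -
      have "length (encode_pair (x, u)) = 2 * s + 1 + length u" for u
        using x by (simp add: length_concat comp_def sum_list_triv)
      then have "\<exists>T' \<le> T s. outputs_within M T' (encode_pair (x, u)) [V (x, u)]" if "length u \<le> poly p s" for u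
        using out[of "(x, u)"] that unfolding T_def
        by (intro exI[of _ "poly r (length (encode_pair (x, u)))"] conjI poly_nat_mono) auto
      then have "x \<in> L \<longleftrightarrow> (\<exists>\<alpha>. (\<forall>i < s. \<alpha> (In i) = x ! i) \<and> sat \<alpha> ?F)"
        unfolding L x by (intro tableau_correct[OF wf _ _ x]) (auto simp: B_def)
      also have "\<dots> \<longleftrightarrow> (\<exists>\<beta>. (\<forall>i < s. \<beta> i = x ! i) \<and> sat \<beta> ?G)"
      proof
        assume "\<exists>\<alpha>. (\<forall>i < s. \<alpha> (In i) = x ! i) \<and> sat \<alpha> ?F"
        then obtain \<alpha> where \<alpha>: "\<forall>i < s. \<alpha> (In i) = x ! i" "sat \<alpha> ?F" by blast
        let ?\<beta> = "\<alpha> \<circ> the_inv_into (?A s) g"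
        have eq: "(?\<beta> \<circ> g) a = \<alpha> a" if "a \<in> ?A s" for a
          using the_inv_into_f_f[OF inj that] by simp
        then have "sat (?\<beta> \<circ> g) ?F" using \<alpha>(2) sat_cong[OF F] by blast
        then have "sat ?\<beta> ?G" by (simp add: sat_def sat_clause_map)
        moreover have "?\<beta> i = x ! i" if "i < s" for i
          using eq[of "In i"] that \<alpha>(1) by (simp add: g_In)
        ultimately show "\<exists>\<beta>. (\<forall>i < s. \<beta> i = x ! i) \<and> sat \<beta> ?G" by blast
      next
        assume "\<exists>\<beta>. (\<forall>i < s. \<beta> i = x ! i) \<and> sat \<beta> ?G"
        then obtain \<beta> where "\<forall>i < s. \<beta> i = x ! i" "sat \<beta> ?G" by blast
        then show "\<exists>\<alpha>. (\<forall>i < s. \<alpha> (In i) = x ! i) \<and> sat \<alpha> ?F"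
          by (intro exI[of _ "\<beta> \<circ> g"]) (auto simp: g_In sat_def sat_clause_map)
      qed
      finally show ?thesis .
    qed
    ultimately show ?thesis by blast
  qed
  moreover have "s \<le> n s" for s by (simp add: n_def)
  ultimately show thesis using that by blast
qed

section \<open>Composing instances into a formula\<close>

lemma clauses_over_mono: "A \<subseteq> A' \<Longrightarrow> c \<le> c' \<Longrightarrow> clauses_over A c \<subseteq> clauses_over A' c'"
  unfolding clauses_over_def by fastforce

lemma finite_clauses_over: "finite A \<Longrightarrow> finite (clauses_over A c)"
  unfolding clauses_over_def by (intro finite_lists_length_le) simp

lemma card_clauses_over:
  assumes "finite A"
  shows "card (clauses_over A c) \<le> (c + 1) * (2 * card A + 1) ^ c"
proof -
  have "card (clauses_over A c) = (\<Sum>i\<le>c. card (A \<times> (UNIV :: bool set)) ^ i)"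
    unfolding clauses_over_def using assms by (intro card_lists_length_le) simp
  also have "card (A \<times> (UNIV :: bool set)) = 2 * card A"
    by (simp add: card_cartesian_product)
  also have "(\<Sum>i\<le>c. (2 * card A) ^ i) \<le> (\<Sum>i\<le>c. (2 * card A + 1) ^ c)"
    by (intro sum_mono order_trans[OF power_mono power_increasing]) auto
  finally show ?thesis by simp
qed

text \<open>The usual splitting with fresh variables: \<open>N + i\<close> says that some literal
  from index \<open>i\<close> on still has to hold. The first obligation is asserted, the last
  refuted.\<close>

definition chain :: "nat \<Rightarrow> nat clause \<Rightarrow> nat clause set" where
  "chain N C = {[(N, True)], [(N + length C, False)]} \<union>
     (\<lambda>i. [(N + i, False), C ! i, (N + Suc i, True)]) ` {..<length C}"

lemma chain_clauses:
  assumes "C \<in> clauses_over {..<N} c"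
  shows "chain N C \<subseteq> clauses_over {..<N + length C + 1} 3"
proof -
  have "a < Suc (N + length C)" if "i < length C" "(a, b) = C ! i" for i a b
  proof -
    have "(a, b) \<in> {..<N} \<times> UNIV" using assms nth_mem[OF that(1)] that(2) by (auto simp: clauses_over_def)
    then show ?thesis by auto
  qed
  then show ?thesis
    by (auto simp: chain_def clauses_over_def)
qed

lemma sat_chain:
  assumes C: "C \<in> clauses_over {..<N} c"
  shows "(\<exists>\<beta>. (\<forall>v < N. \<beta> v = \<alpha> v) \<and> sat \<beta> (chain N C)) \<longleftrightarrow> sat_clause \<alpha> C"
proof
  assume "\<exists>\<beta>. (\<forall>v < N. \<beta> v = \<alpha> v) \<and> sat \<beta> (chain N C)"
  then obtain \<beta> where \<beta>: "\<forall>v < N. \<beta> v = \<alpha> v" "sat \<beta> (chain N C)" by blast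
  have s: "\<beta> N" "\<not> \<beta> (N + length C)"
    "\<And>i. i < length C \<Longrightarrow> \<beta> (N + i) \<Longrightarrow> sat_lit \<beta> (C ! i) \<or> \<beta> (N + Suc i)"
    using \<beta>(2) by (auto simp: sat_def chain_def sat_clause_def sat_lit_def)
  have "sat_clause \<beta> C"
  proof (rule ccontr)
    assume "\<not> sat_clause \<beta> C"
    then have n: "\<not> sat_lit \<beta> (C ! i)" if "i < length C" for i
      using that by (auto simp: sat_clause_def)
    have "\<beta> (N + i)" if "i \<le> length C" for i
      using that
    proof (induction i)
      case (Suc i)
      then show ?case using s(3)[of i] n[of i] by simp
    qed (use s in simp)
    with s(2) show False by blast
  qed
  moreover have "sat_clause \<beta> C \<longleftrightarrow> sat_clause \<alpha> C"
    using C \<beta>(1) by (intro sat_clause_cong) (auto simp: clauses_over_def)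
  ultimately show "sat_clause \<alpha> C" by blast
next
  assume "sat_clause \<alpha> C"
  then obtain j where j: "j < length C" "sat_lit \<alpha> (C ! j)"
    by (auto simp: sat_clause_def in_set_conv_nth)
  have fst_less: "fst (C ! j) < N"
    using C nth_mem[OF j(1)] by (cases "C ! j") (auto simp: clauses_over_def)
  \<comment> \<open>The obligation is passed on up to the true literal \<open>j\<close> and dropped
    there.\<close>
  define \<beta> where "\<beta> v = (if v < N then \<alpha> v else v \<le> N + j)" for v
  have "sat_lit \<beta> (C ! j)" using j(2) fst_less by (simp add: sat_lit_def \<beta>_def)
  then have "sat_clause \<beta> [(N + i, False), C ! i, (N + Suc i, True)]" for i
    by (cases i j rule: linorder_cases) (auto simp: sat_clause_def sat_lit_def \<beta>_def)
  then have "sat \<beta> (chain N C)"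
    using j(1) by (auto simp: sat_def chain_def) (auto simp: sat_clause_def sat_lit_def \<beta>_def)
  then show "\<exists>\<beta>. (\<forall>v < N. \<beta> v = \<alpha> v) \<and> sat \<beta> (chain N C)"
    by (intro exI[of _ \<beta>]) (simp add: \<beta>_def)
qed

text \<open>Equivalence for each assignment of the old variables, stronger than equisatisfiability,
  because the transfer clauses over these variables are added later.\<close>

lemma CNF_to_3CNF:
  assumes "set Cs \<subseteq> clauses_over {..<N} c"
  defines "N' \<equiv> N + sum_list (map (\<lambda>C. length C + 1) Cs)"
  shows "\<exists>F \<subseteq> clauses_over {..<N'} 3.
    \<forall>\<alpha>. (\<exists>\<beta>. (\<forall>v < N. \<beta> v = \<alpha> v) \<and> sat \<beta> F) \<longleftrightarrow> sat \<alpha> (set Cs)"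
  using assms(1) unfolding N'_def
proof (induction Cs)
  case Nil
  then show ?case by (intro exI[of _ "{}"]) (auto simp: sat_def)
next
  case (Cons C Cs)
  let ?N = "N + sum_list (map (\<lambda>C. length C + 1) Cs)"
  obtain F where F: "F \<subseteq> clauses_over {..<?N} 3"
    "\<And>\<alpha>. (\<exists>\<beta>. (\<forall>v < N. \<beta> v = \<alpha> v) \<and> sat \<beta> F) \<longleftrightarrow> sat \<alpha> (set Cs)"
    using Cons by auto
  have C0: "C \<in> clauses_over {..<N} c" using Cons.prems by simp
  then have C: "C \<in> clauses_over {..<?N} c" by (rule subsetD[OF clauses_over_mono, rotated -1]) auto
  let ?F = "F \<union> chain ?N C"
  have C_cong: "sat_clause \<alpha> C \<longleftrightarrow> sat_clause \<beta> C" if "\<forall>v < N. \<beta> v = \<alpha> v" for \<alpha> \<beta>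
    using sat_cong[of "{C}" "{..<N}" c \<alpha> \<beta>] C0 that by (simp add: sat_def)
  have "?F \<subseteq> clauses_over {..<N + sum_list (map (\<lambda>C. length C + 1) (C # Cs))} 3"
    using chain_clauses[OF C] F(1)
    by (auto simp: add.commute add.left_commute intro: subsetD[OF clauses_over_mono, rotated -1])
  moreover have "(\<exists>\<beta>. (\<forall>v < N. \<beta> v = \<alpha> v) \<and> sat \<beta> ?F) \<longleftrightarrow> sat \<alpha> (set (C # Cs))" for \<alpha>
  proof
    assume "\<exists>\<beta>. (\<forall>v < N. \<beta> v = \<alpha> v) \<and> sat \<beta> ?F"
    then obtain \<beta> where \<beta>: "\<forall>v < N. \<beta> v = \<alpha> v" "sat \<beta> F" "sat \<beta> (chain ?N C)"
      by (auto simp: sat_def)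
    then have "sat \<alpha> (set Cs)" using F(2) by blast
    moreover have "sat_clause \<beta> C" using sat_chain[OF C, of \<beta>] \<beta>(3) by blast
    ultimately show "sat \<alpha> (set (C # Cs))" using C_cong[OF \<beta>(1)] by (simp add: sat_def)
  next
    assume "sat \<alpha> (set (C # Cs))"
    then have s: "sat_clause \<alpha> C" "sat \<alpha> (set Cs)" by (auto simp: sat_def)
    then obtain \<beta> where \<beta>: "\<forall>v < N. \<beta> v = \<alpha> v" "sat \<beta> F" using F(2) by blast
    then have "sat_clause \<beta> C" using s C_cong by blast
    then obtain \<gamma> where \<gamma>: "\<forall>v < ?N. \<gamma> v = \<beta> v" "sat \<gamma> (chain ?N C)" using sat_chain[OF C] by blast
    have "sat \<gamma> F" using sat_cong[OF F(1), of \<gamma> \<beta>] \<gamma>(1) \<beta>(2) by simp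
    with \<gamma> \<beta> show "\<exists>\<beta>. (\<forall>v < N. \<beta> v = \<alpha> v) \<and> sat \<beta> ?F"
      by (intro exI[of _ \<gamma>]) (auto simp: sat_def)
  qed
  ultimately show ?case by blast
qed

text \<open>
  Instances are indexed by \<open>I \<in> [m]\<^sup>k\<close>. The variable \<open>sel_var m s j i\<close> says that the \<open>j\<close>-th coordinate
  \<open>i\<close> is selected, \<open>bit_var s i p b\<close> that if \<open>i\<close> is selected as first coordinate, then bit \<open>p\<close> of the
  selected instance is \<open>b\<close>. Since the value of this bit is already part of \<open>bit_var\<close>, the clause that
  transfers a bit of instance \<open>I\<close> needs only \<open>k\<close> literals.
\<close>

definition bit_var :: "nat \<Rightarrow> nat \<Rightarrow> nat \<Rightarrow> bool \<Rightarrow> nat" where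
  "bit_var s i p b = 2 * (i * s + p) + (if b then 1 else 0)"

definition sel_var :: "nat \<Rightarrow> nat \<Rightarrow> nat \<Rightarrow> nat \<Rightarrow> nat" where
  "sel_var m s j i = 2 * (m * s) + (j * m + i)"

definition main_var :: "nat \<Rightarrow> nat \<Rightarrow> nat \<Rightarrow> nat \<Rightarrow> nat" where
  "main_var m s k a = 2 * (m * s) + k * m + a"

definition transfer_clause :: "nat \<Rightarrow> nat \<Rightarrow> nat \<Rightarrow> nat list \<Rightarrow> nat \<Rightarrow> bool \<Rightarrow> nat clause" where
  "transfer_clause m s k I p b =
     (bit_var s (I ! 0) p b, True) # map (\<lambda>j. (sel_var m s j (I ! j), False)) [1..<k]"

definition transfer_clauses :: "nat \<Rightarrow> nat \<Rightarrow> nat \<Rightarrow> (nat list \<Rightarrow> bool list) \<Rightarrow> nat clause set" where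
  "transfer_clauses m s k xs =
     (\<lambda>(I, p). transfer_clause m s k I p (xs I ! p)) ` (tuples {..<m} k \<times> {..<s})"

text \<open>The part shared by all families of words. The last group asks for at least one selected
  value per coordinate; several are harmless, since every selected index has its bits
  transferred.\<close>

definition skeleton :: "nat \<Rightarrow> nat \<Rightarrow> nat \<Rightarrow> nat clause set \<Rightarrow> nat clause set" where
  "skeleton m s k F = map (map_prod (main_var m s k) id) ` F
     \<union> (\<lambda>(i, p, b). [(sel_var m s 0 i, False), (bit_var s i p b, False), (main_var m s k p, b)]) `
         ({..<m} \<times> {..<s} \<times> UNIV)
     \<union> (\<lambda>j. map (\<lambda>i. (sel_var m s j i, True)) [0..<m]) ` {..<k}"

definition encodes_OR :: "bool list set \<Rightarrow> nat \<Rightarrow> nat \<Rightarrow> nat \<Rightarrow> nat clause set \<Rightarrow> bool" where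
  "encodes_OR L m s k F \<longleftrightarrow> (\<forall>xs. (\<forall>I \<in> tuples {..<m} k. length (xs I) = s) \<longrightarrow>
     ((\<exists>I \<in> tuples {..<m} k. xs I \<in> L) \<longleftrightarrow> (\<exists>\<alpha>. sat \<alpha> (F \<union> transfer_clauses m s k xs))))"

lemma mixed_radix_less: "i < m \<Longrightarrow> p < s \<Longrightarrow> i * s + p < m * (s :: nat)"
proof -
  assume "i < m" "p < s"
  then have "i * s + p < (i + 1) * s" by simp
  also have "\<dots> \<le> m * s" using \<open>i < m\<close> by (intro mult_right_mono) auto
  finally show ?thesis .
qed

lemma bit_var_less: "i < m \<Longrightarrow> p < s \<Longrightarrow> bit_var s i p b < 2 * (m * s)"
  using mixed_radix_less[of i m p s] by (auto simp: bit_var_def)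

lemma sel_var_bounds: "j < k \<Longrightarrow> i < m \<Longrightarrow> 2 * (m * s) \<le> sel_var m s j i \<and> sel_var m s j i < 2 * (m * s) + k * m"
  using mixed_radix_less[of j k i m] by (auto simp: sel_var_def)

lemma transfer_clause_over:
  assumes "1 \<le> k" "I \<in> tuples {..<m} k" "p < s"
  shows "transfer_clause m s k I p b \<in> clauses_over {..<2 * (m * s) + k * m} k"
proof -
  have "I ! j < m" if "j < k" for j
    using assms(2) that nth_mem[of j I] by (auto simp: tuples_def simp del: nth_mem)
  then show ?thesis
    using assms(1,3) bit_var_less[of "I ! 0" m p s b] sel_var_bounds[of _ k _ m s]
    by (auto simp: transfer_clause_def clauses_over_def trans_less_add1)
qed

text \<open>One selected value per coordinate yields an index whose transfer clauses lose all their
  selector literals, so its bits are forced onto the main variables.\<close>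

lemma skeleton_sound:
  assumes sat: "sat \<alpha> (skeleton m s k F \<union> transfer_clauses m s k xs)" and k: "1 \<le> k"
  obtains I where "I \<in> tuples {..<m} k" "\<And>p. p < s \<Longrightarrow> \<alpha> (main_var m s k p) = xs I ! p"
    "sat (\<alpha> \<circ> main_var m s k) F"
proof -
  have "\<exists>i < m. \<alpha> (sel_var m s j i)" if "j < k" for j
  proof -
    have "map (\<lambda>i. (sel_var m s j i, True)) [0..<m] \<in> skeleton m s k F"
      using that by (auto simp: skeleton_def)
    with sat have "sat_clause \<alpha> (map (\<lambda>i. (sel_var m s j i, True)) [0..<m])"
      by (simp add: sat_def)
    then show ?thesis by (auto simp: sat_clause_def sat_lit_def)
  qed
  then obtain i where i: "\<And>j. j < k \<Longrightarrow> i j < m \<and> \<alpha> (sel_var m s j (i j))" by metis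
  define I where "I = map i [0..<k]"
  have I: "I \<in> tuples {..<m} k" using i by (auto simp: I_def tuples_def)
  have nth: "I ! j = i j" if "j < k" for j using that by (simp add: I_def)
  have "\<alpha> (main_var m s k p) = xs I ! p" if "p < s" for p
  proof -
    have "sat_clause \<alpha> (transfer_clause m s k I p (xs I ! p))"
      using sat I that by (auto simp: sat_def transfer_clauses_def)
    then have "\<alpha> (bit_var s (i 0) p (xs I ! p))"
      using i nth k by (auto simp: sat_clause_def sat_lit_def transfer_clause_def)
    moreover have "[(sel_var m s 0 (i 0), False), (bit_var s (i 0) p (xs I ! p), False),
        (main_var m s k p, xs I ! p)] \<in> skeleton m s k F"
      using i[of 0] k that by (auto simp: skeleton_def image_iff)
    then have "sat_clause \<alpha> [(sel_var m s 0 (i 0), False), (bit_var s (i 0) p (xs I ! p), False),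
        (main_var m s k p, xs I ! p)]" using sat by (simp add: sat_def)
    ultimately show ?thesis using i[of 0] k by (auto simp: sat_clause_def sat_lit_def)
  qed
  moreover have "sat \<alpha> (map (map_prod (main_var m s k) id) ` F)"
    using sat by (simp add: sat_def skeleton_def)
  then have "sat (\<alpha> \<circ> main_var m s k) F"
    by (simp add: sat_def sat_clause_map)
  ultimately show thesis using that I by blast
qed

lemma skeleton_complete:
  assumes k: "1 \<le> k" and I: "I \<in> tuples {..<m} k" and \<alpha>: "\<And>p. p < s \<Longrightarrow> \<alpha> p = xs I ! p" "sat \<alpha> F"
  shows "\<exists>\<beta>. sat \<beta> (skeleton m s k F \<union> transfer_clauses m s k xs)"
proof -
  \<comment> \<open>The three ranges invert the numberings of \<open>bit_var\<close>,
    \<open>sel_var\<close> and \<open>main_var\<close>. In rows other than \<open>I ! 0\<close> both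
    values of each bit hold, which satisfies their transfer clauses; the false selectors of these
    rows satisfy the clauses that would carry the contradiction to the main variables.\<close>
  define \<beta> where "\<beta> w = (if w < 2 * (m * s) then w div 2 div s \<noteq> I ! 0 \<or> \<alpha> (w div 2 mod s) = odd w
    else if w < 2 * (m * s) + k * m then I ! ((w - 2 * (m * s)) div m) = (w - 2 * (m * s)) mod m
    else \<alpha> (w - (2 * (m * s) + k * m)))" for w
  have bit: "\<beta> (bit_var s i p b) \<longleftrightarrow> i \<noteq> I ! 0 \<or> \<alpha> p = b" if "i < m" "p < s" for i p b
  proof -
    have "bit_var s i p b div 2 = i * s + p" "odd (bit_var s i p b) = b" by (auto simp: bit_var_def)
    moreover have "(i * s + p) div s = i" "(i * s + p) mod s = p" using that by auto
    ultimately show ?thesis using bit_var_less[OF that, of b] by (simp add: \<beta>_def)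
  qed
  have sel: "\<beta> (sel_var m s j i) \<longleftrightarrow> I ! j = i" if "j < k" "i < m" for j i
  proof -
    have "sel_var m s j i - 2 * (m * s) = j * m + i" by (simp add: sel_var_def)
    moreover have "(j * m + i) div m = j" "(j * m + i) mod m = i" using that by auto
    ultimately show ?thesis using sel_var_bounds[OF that, of s] by (simp add: \<beta>_def)
  qed
  have main: "\<beta> (main_var m s k a) = \<alpha> a" for a by (simp add: \<beta>_def main_var_def)
  have nth: "J ! j < m" if "J \<in> tuples {..<m} k" "j < k" for J j
    using that nth_mem[of j J] by (auto simp: tuples_def simp del: nth_mem)
  have "sat_clause \<beta> (transfer_clause m s k J p (xs J ! p))" if J: "J \<in> tuples {..<m} k" and p: "p < s" for J p
  proof (cases "J = I")
    case True
    then have "\<beta> (bit_var s (I ! 0) p (xs I ! p))" using bit[OF nth[OF I]] p \<alpha>(1) k by simp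
    then show ?thesis using True by (simp add: sat_clause_def sat_lit_def transfer_clause_def)
  next
    case False
    then obtain j where j: "j < k" "J ! j \<noteq> I ! j"
      using J I by (auto simp: tuples_def list_eq_iff_nth_eq)
    show ?thesis
    proof (cases "j = 0")
      case True
      then have "\<beta> (bit_var s (J ! 0) p (xs J ! p))" using bit[OF nth[OF J]] p j by simp
      then show ?thesis by (simp add: sat_clause_def sat_lit_def transfer_clause_def)
    next
      case False
      then have "\<not> \<beta> (sel_var m s j (J ! j))" using sel[OF j(1) nth[OF J j(1)]] j(2) by simp
      then show ?thesis using False j(1) by (auto simp: sat_clause_def sat_lit_def transfer_clause_def)
    qed
  qed
  then have "sat \<beta> (transfer_clauses m s k xs)" by (auto simp: sat_def transfer_clauses_def)
  moreover have "sat \<beta> (skeleton m s k F)"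
    unfolding sat_def
  proof
    fix C assume "C \<in> skeleton m s k F"
    then consider D where "D \<in> F" "C = map (map_prod (main_var m s k) id) D"
      | i p b where "i < m" "p < s"
          "C = [(sel_var m s 0 i, False), (bit_var s i p b, False), (main_var m s k p, b)]"
      | j where "j < k" "C = map (\<lambda>i. (sel_var m s j i, True)) [0..<m]"
      by (auto simp: skeleton_def)
    then show "sat_clause \<beta> C"
    proof cases
      case 1
      have "\<beta> \<circ> main_var m s k = \<alpha>" using main by auto
      then show ?thesis using 1 \<alpha>(2) by (simp add: sat_clause_map sat_def)
    next
      case 2
      then show ?thesis using k bit[of i p b] sel[of 0 i] main by (auto simp: sat_clause_def sat_lit_def)
    next
      case 3
      then show ?thesis using sel[of j "I ! j"] nth[OF I] by (auto simp: sat_clause_def sat_lit_def)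
    qed
  qed
  ultimately show ?thesis by (auto simp: sat_def)
qed

text \<open>The clauses for the selection have \<open>m\<close> literals; they are the reason for
  the later conversion to 3-clauses.\<close>

lemma skeleton_over:
  assumes F: "F \<subseteq> clauses_over {..<n} c" and sn: "s \<le> n" and k: "1 \<le> k"
  shows "skeleton m s k F \<subseteq> clauses_over {..<2 * (m * s) + k * m + n} (c + m + 3)"
proof -
  have b: "bit_var s i p b < 2 * (m * s) + k * m + n" if "i < m" "p < s" for i p b
    using bit_var_less[OF that, of b] by simp
  have v: "sel_var m s j i < 2 * (m * s) + k * m + n" if "j < k" "i < m" for j i
    using sel_var_bounds[OF that, of s] by simp
  have a: "main_var m s k i < 2 * (m * s) + k * m + n" if "i < n" for i
    using that by (simp add: main_var_def)
  have "map (map_prod (main_var m s k) id) C \<in> clauses_over {..<2 * (m * s) + k * m + n} (c + m + 3)" if "C \<in> F" for C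
  proof -
    have "set C \<subseteq> {..<n} \<times> UNIV" "length C \<le> c" using F that by (auto simp: clauses_over_def)
    then show ?thesis using a by (auto simp: clauses_over_def)
  qed
  then show ?thesis
    unfolding skeleton_def
  proof (intro Un_least image_subsetI)
    fix x assume "x \<in> {..<m} \<times> {..<s} \<times> (UNIV :: bool set)"
    then show "(case x of (i, p, b) \<Rightarrow> [(sel_var m s 0 i, False), (bit_var s i p b, False), (main_var m s k p, b)])
        \<in> clauses_over {..<2 * (m * s) + k * m + n} (c + m + 3)"
      using a b v k sn by (auto simp: clauses_over_def)
  next
    fix j assume "j \<in> {..<k}"
    then show "map (\<lambda>i. (sel_var m s j i, True)) [0..<m] \<in> clauses_over {..<2 * (m * s) + k * m + n} (c + m + 3)"
      using v by (auto simp: clauses_over_def)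
  qed
qed

section \<open>Counting the variables of the composed formula\<close>

lemma sum_Un_le_nat:
  fixes f :: "'a \<Rightarrow> nat"
  shows "finite A \<Longrightarrow> finite B \<Longrightarrow> sum f (A \<union> B) \<le> sum f A + sum f B"
  using sum.union_inter[of A B f] by linarith

lemma sum_clause_lengths:
  assumes "finite F" "\<And>C. C \<in> F \<Longrightarrow> length C \<le> c"
  shows "sum (\<lambda>C. length C + 1) F \<le> card F * (c + 1)"
  using sum_bounded_above[of F "\<lambda>C. length C + 1" "c + 1"] assms by simp

text \<open>Linear growth of \<open>N\<close> in \<open>m\<close> is the point, although m^k words
  are composed: the formula of the language occurs once, and only selectors, bit variables and the
  fresh variables of their clauses grow with \<open>m\<close>.\<close>

theorem OR_CNF:
  assumes "L \<in> NP" and k: "1 \<le> k"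
  shows "\<exists>P. poly_bounded P \<and> (\<forall>s m. 1 \<le> m \<longrightarrow> (\<exists>N F. F \<subseteq> clauses_over {..<N} 3 \<and> 2 * (m * s) + k * m \<le> N \<and> N \<le> m * P s \<and>
      encodes_OR L m s k F))"
proof -
  obtain n c where n: "poly_bounded n" "\<And>s. s \<le> n s"
    and F: "\<And>s. \<exists>F \<subseteq> clauses_over {..<n s} c. \<forall>x. length x = s \<longrightarrow>
      (x \<in> L \<longleftrightarrow> (\<exists>\<alpha>. (\<forall>i < s. \<alpha> i = x ! i) \<and> sat \<alpha> F))"
    using NP_CNF[OF assms(1)] by blast
  \<comment> \<open>Fresh variables for the formula of the language: at most (c+1)(2n+1)^c clauses,
    each with at most c+1 of them.\<close>
  define Q where "Q s = (c + 1) * (2 * n s + 1) ^ c * (c + 1)" for s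
  define P where "P s = 10 * s + 3 * k + n s + Q s" for s
  have "poly_bounded P"
    unfolding P_def Q_def using n(1) by (intro poly_bounded_intros)
  moreover have "\<exists>N F. F \<subseteq> clauses_over {..<N} 3 \<and> 2 * (m * s) + k * m \<le> N \<and> N \<le> m * P s \<and>
      encodes_OR L m s k F"
    if m: "1 \<le> m" for s m
  proof -
    obtain F where F: "F \<subseteq> clauses_over {..<n s} c" "\<forall>x. length x = s \<longrightarrow>
      (x \<in> L \<longleftrightarrow> (\<exists>\<alpha>. (\<forall>i < s. \<alpha> i = x ! i) \<and> sat \<alpha> F))"
      using F[of s] by (elim exE conjE)
    let ?S = "skeleton m s k F" and ?N = "2 * (m * s) + k * m + n s"
    have fF: "finite F" using F(1) finite_clauses_over finite_subset by blast
    have over: "?S \<subseteq> clauses_over {..<?N} (c + m + 3)" by (rule skeleton_over[OF F(1) n(2) k])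
    then have fS: "finite ?S" using finite_clauses_over finite_subset by blast
    then obtain Cs where Cs: "set Cs = ?S" "distinct Cs" using finite_distinct_list by blast
    let ?N' = "?N + sum_list (map (\<lambda>C. length C + 1) Cs)"
    obtain F3 where F3: "F3 \<subseteq> clauses_over {..<?N'} 3"
      "\<And>\<alpha>. (\<exists>\<beta>. (\<forall>v < ?N. \<beta> v = \<alpha> v) \<and> sat \<beta> F3) \<longleftrightarrow> sat \<alpha> ?S"
      using CNF_to_3CNF[of Cs ?N "c + m + 3"] over Cs(1) by auto
    have "sum_list (map (\<lambda>C. length C + 1) Cs) = sum (\<lambda>C. length C + 1) ?S"
      using Cs sum_list_distinct_conv_sum_set by metis
    also have "\<dots> \<le> (c + 1) * (2 * n s + 1) ^ c * (c + 1) + m * s * 2 * 4 + k * (m + 1)"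
    proof -
      let ?A = "map (map_prod (main_var m s k) id) ` F"
      let ?B = "(\<lambda>(i, p, b). [(sel_var m s 0 i, False), (bit_var s i p b, False), (main_var m s k p, b)]) `
         ({..<m} \<times> {..<s} \<times> (UNIV :: bool set))"
      let ?C = "(\<lambda>j. map (\<lambda>i. (sel_var m s j i, True)) [0..<m]) ` {..<k}"
      let ?l = "\<lambda>C :: nat clause. length C + 1"
      have "sum ?l ?A \<le> card ?A * (c + 1)"
        using fF F(1) by (intro sum_clause_lengths) (auto simp: clauses_over_def)
      also have "\<dots> \<le> card F * (c + 1)" using card_image_le[OF fF] by (intro mult_right_mono) auto
      also have "\<dots> \<le> (c + 1) * (2 * n s + 1) ^ c * (c + 1)"
        using card_mono[OF finite_clauses_over[of "{..<n s}" c] F(1)] card_clauses_over[of "{..<n s}" c]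
        by (intro mult_right_mono) auto
      finally have A: "sum ?l ?A \<le> (c + 1) * (2 * n s + 1) ^ c * (c + 1)" .
      have "sum ?l ?B \<le> card ?B * (3 + 1)" by (intro sum_clause_lengths) auto
      also have "\<dots> \<le> (m * s * 2) * 4"
        by (intro mult_mono order_trans[OF card_image_le]) (auto simp: card_cartesian_product)
      finally have B: "sum ?l ?B \<le> m * s * 2 * 4" .
      have "sum ?l ?C \<le> card ?C * (m + 1)" by (intro sum_clause_lengths) auto
      also have "\<dots> \<le> k * (m + 1)"
        by (intro mult_right_mono order_trans[OF card_image_le]) auto
      finally have C: "sum ?l ?C \<le> k * (m + 1)" .
      have "sum ?l ?S \<le> sum ?l (?A \<union> ?B) + sum ?l ?C"
        unfolding skeleton_def using fF by (intro sum_Un_le_nat) auto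
      also have "sum ?l (?A \<union> ?B) \<le> sum ?l ?A + sum ?l ?B"
        using fF by (intro sum_Un_le_nat) auto
      finally show ?thesis using A B C by linarith
    qed
    finally have size: "?N' \<le> 2 * (m * s) + k * m + n s + ((c + 1) * (2 * n s + 1) ^ c * (c + 1) + m * s * 2 * 4 + k * (m + 1))"
      by simp
    also have "\<dots> \<le> m * P s"
    proof -
      have le: "a \<le> m * a" for a using m by simp
      have "m * P s = 10 * (m * s) + 3 * (m * k) + m * n s + m * Q s" "k * (m + 1) = m * k + k" "k * m = m * k"
        by (simp_all add: P_def algebra_simps)
      then show ?thesis using le[of "n s"] le[of k] le[of "Q s"] unfolding Q_def[symmetric] by linarith
    qed
    finally have N': "?N' \<le> m * P s" .
    have corr: "(\<exists>I \<in> tuples {..<m} k. xs I \<in> L) \<longleftrightarrow> (\<exists>\<alpha>. sat \<alpha> (F3 \<union> transfer_clauses m s k xs))"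
      if xs: "\<forall>I \<in> tuples {..<m} k. length (xs I) = s" for xs
    proof -
      \<comment> \<open>The transfer clauses avoid the fresh variables, so extending an assignment
        to these keeps them true.\<close>
      have tr: "transfer_clauses m s k xs \<subseteq> clauses_over {..<?N} k"
        using transfer_clause_over[OF k] clauses_over_mono[of "{..<2 * (m * s) + k * m}" "{..<?N}" k k]
        by (auto simp: transfer_clauses_def subset_iff)
      have "(\<exists>I \<in> tuples {..<m} k. xs I \<in> L) \<longleftrightarrow> (\<exists>\<alpha>. sat \<alpha> (?S \<union> transfer_clauses m s k xs))"
      proof
        assume "\<exists>I \<in> tuples {..<m} k. xs I \<in> L"
        then obtain I where I: "I \<in> tuples {..<m} k" "xs I \<in> L" by blast
        then obtain \<alpha> where "\<forall>i < s. \<alpha> i = xs I ! i" "sat \<alpha> F" using F(2) xs by blast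
        then show "\<exists>\<alpha>. sat \<alpha> (?S \<union> transfer_clauses m s k xs)"
          by (intro skeleton_complete[OF k I(1)]) auto
      next
        assume "\<exists>\<alpha>. sat \<alpha> (?S \<union> transfer_clauses m s k xs)"
        then obtain \<alpha> where \<alpha>: "sat \<alpha> (?S \<union> transfer_clauses m s k xs)" by blast
        obtain I where "I \<in> tuples {..<m} k" "\<And>p. p < s \<Longrightarrow> \<alpha> (main_var m s k p) = xs I ! p"
          "sat (\<alpha> \<circ> main_var m s k) F"
          using skeleton_sound[OF \<alpha> k] by blast
        then show "\<exists>I \<in> tuples {..<m} k. xs I \<in> L"
          using F(2) xs by (intro bexI[of _ I]) (auto intro!: exI[of _ "\<alpha> \<circ> main_var m s k"])
      qed
      also have "\<dots> \<longleftrightarrow> (\<exists>\<alpha>. sat \<alpha> (F3 \<union> transfer_clauses m s k xs))"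
      proof
        assume "\<exists>\<alpha>. sat \<alpha> (?S \<union> transfer_clauses m s k xs)"
        then obtain \<alpha> where \<alpha>: "sat \<alpha> ?S" "sat \<alpha> (transfer_clauses m s k xs)" by (auto simp: sat_def)
        then obtain \<beta> where \<beta>: "\<forall>v < ?N. \<beta> v = \<alpha> v" "sat \<beta> F3" using F3(2) by blast
        moreover have "sat \<beta> (transfer_clauses m s k xs)"
          using sat_cong[OF tr, of \<beta> \<alpha>] \<beta>(1) \<alpha>(2) by simp
        ultimately show "\<exists>\<alpha>. sat \<alpha> (F3 \<union> transfer_clauses m s k xs)" by (auto simp: sat_def)
      next
        assume "\<exists>\<alpha>. sat \<alpha> (F3 \<union> transfer_clauses m s k xs)"
        then obtain \<alpha> where \<alpha>: "sat \<alpha> F3" "sat \<alpha> (transfer_clauses m s k xs)" by (auto simp: sat_def)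
        then have "sat \<alpha> ?S" using F3(2) by blast
        with \<alpha> show "\<exists>\<alpha>. sat \<alpha> (?S \<union> transfer_clauses m s k xs)" by (auto simp: sat_def)
      qed
      finally show ?thesis .
    qed
    show ?thesis
      using F3(1) N' corr by (intro exI[of _ ?N'] exI[of _ F3]) (auto simp: encodes_OR_def)
  qed
  ultimately show ?thesis by (intro exI[of _ P] conjI allI impI)
qed

section \<open>From formulas to constrained colorings\<close>

lemma listset_conv_list_all2: "listset Ds = {xs. list_all2 (\<in>) xs Ds}"
proof (induction Ds)
  case (Cons D Ds)
  then show ?case by (auto simp: set_Cons_def list_all2_Cons2)
qed simp

lemma finite_card_listset:
  "\<forall>D \<in> set Ds. finite D \<Longrightarrow> finite (listset Ds) \<and> card (listset Ds) = prod_list (map card Ds)"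
proof (induction Ds)
  case (Cons D Ds)
  have "set_Cons D (listset Ds) = (\<lambda>(x, xs). x # xs) ` (D \<times> listset Ds)"
    by (auto simp: set_Cons_def)
  moreover have "inj_on (\<lambda>(x, xs). x # xs) (D \<times> listset Ds)" by (auto simp: inj_on_def)
  ultimately show ?case using Cons by (simp add: card_image card_cartesian_product)
qed simp

lemma prod_list_1_2:
  "\<forall>a \<in> set as. a = 1 \<or> a = 2 \<Longrightarrow> prod_list as = (2 :: nat) ^ card {i. i < length as \<and> as ! i = 2}"
proof (induction as)
  case (Cons a as)
  have "{i. i < length (a # as) \<and> (a # as) ! i = 2} =
      (if a = 2 then {0} else {}) \<union> Suc ` {i. i < length as \<and> as ! i = 2}"
    by (auto simp: less_Suc_eq_0_disj nth_Cons')
  moreover have "card (Suc ` {i. i < length as \<and> as ! i = 2}) = card {i. i < length as \<and> as ! i = 2}"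
    by (intro card_image) simp
  ultimately show ?case using Cons by (auto simp: card_insert_if)
qed simp

text \<open>Inside the box of a definable OR, \<open>f\<close> is the unique tuple outside
  \<open>R\<close>, and \<open>g j\<close> is the other value at a position in \<open>J\<close>.
  Reading \<open>g j\<close> as true and \<open>f j\<close> as false turns \<open>R\<close> into a
  disjunction over \<open>J\<close>.\<close>

locale OR_gadget =
  fixes q r k :: nat and R :: "nat list set" and J :: "nat set" and f g :: "nat \<Rightarrow> nat"
  assumes q: "1 \<le> q" and k: "1 \<le> k" and R: "R \<subseteq> tuples {1..q} r"
    and invariant: "permutation_invariant q r R"
    and J: "J \<subseteq> {..<r}" "card J = k"
    and f: "\<And>j. j < r \<Longrightarrow> f j \<in> {1..q}"
    and g: "\<And>j. j \<in> J \<Longrightarrow> g j \<in> {1..q} \<and> g j \<noteq> f j"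
    and R_iff: "\<And>xs. length xs = r \<Longrightarrow> (\<And>j. j < r \<Longrightarrow> xs ! j = f j \<or> j \<in> J \<and> xs ! j = g j) \<Longrightarrow>
      xs \<in> R \<longleftrightarrow> (\<exists>j < r. xs ! j \<noteq> f j)"

text \<open>The box has 2^k points, 2^k - 1 of them in \<open>R\<close>; the single missing one
  serves as \<open>f\<close>.\<close>

lemma OR_gadget_exists:
  assumes "1 \<le> q" "1 \<le> k" "R \<subseteq> tuples {1..q} r" "permutation_invariant q r R" "OR_definable q r R k"
  obtains J f g where "OR_gadget q r k R J f g"
proof -
  obtain Ds where Ds: "length Ds = r" "\<And>D. D \<in> set Ds \<Longrightarrow> D \<subseteq> {1..q} \<and> (card D = 1 \<or> card D = 2)"
    "card {i. i < r \<and> card (Ds ! i) = 2} = k" "card (listset Ds \<inter> R) = 2 ^ k - 1"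
    using assms(5) unfolding OR_definable_def by auto
  define J where "J = {i. i < r \<and> card (Ds ! i) = 2}"
  have fin: "finite (listset Ds)" "card (listset Ds) = prod_list (map card Ds)"
    using finite_card_listset[of Ds] Ds(2) finite_subset[of _ "{1..q}"] by auto
  have "{i. i < length (map card Ds) \<and> map card Ds ! i = 2} = J"
    using Ds(1) by (auto simp: J_def)
  then have "card (listset Ds) = 2 ^ k"
    using prod_list_1_2[of "map card Ds"] Ds(2,3) fin(2) J_def by auto
  then have "card (listset Ds - R) = 1"
    using Ds(4) fin(1) card_Diff_subset_Int[of "listset Ds" R] by simp
  then obtain xs where xs: "listset Ds - R = {xs}" by (auto simp: card_1_singleton_iff)
  have mem: "ys \<in> listset Ds \<longleftrightarrow> length ys = r \<and> (\<forall>j < r. ys ! j \<in> Ds ! j)" for ys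
    using Ds(1) by (auto simp: listset_conv_list_all2 list_all2_conv_all_nth)
  have xs_mem: "length xs = r" "\<And>j. j < r \<Longrightarrow> xs ! j \<in> Ds ! j" using xs mem by auto
  have sub: "Ds ! j \<subseteq> {1..q}" "card (Ds ! j) = 1 \<or> card (Ds ! j) = 2" if "j < r" for j
    using Ds(1,2) that by auto
  have "\<exists>b. b \<in> {1..q} \<and> b \<noteq> xs ! j \<and> Ds ! j = {xs ! j, b}" if "j \<in> J" for j
  proof -
    have j: "j < r" "card (Ds ! j) = 2" using that by (auto simp: J_def)
    then obtain a b where "Ds ! j = {a, b}" "a \<noteq> b" by (auto simp: card_2_iff)
    then show ?thesis using xs_mem(2)[OF j(1)] sub(1)[OF j(1)] by auto
  qed
  then obtain g where g: "\<And>j. j \<in> J \<Longrightarrow> g j \<in> {1..q} \<and> g j \<noteq> xs ! j \<and> Ds ! j = {xs ! j, g j}" by metis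
  have single: "Ds ! j = {xs ! j}" if "j < r" "j \<notin> J" for j
    using that sub[OF that(1)] xs_mem(2)[OF that(1)] by (auto simp: J_def card_1_singleton_iff)
  show thesis
  proof (rule that[of J "\<lambda>j. xs ! j" g], unfold_locales)
    fix ys assume ys: "length ys = r" "\<And>j. j < r \<Longrightarrow> ys ! j = xs ! j \<or> j \<in> J \<and> ys ! j = g j"
    have "ys ! j \<in> Ds ! j" if "j < r" for j
      using ys(2)[OF that] xs_mem(2)[OF that] g by auto
    then have "ys \<in> listset Ds" using mem ys(1) by blast
    then have "ys \<in> R \<longleftrightarrow> ys \<noteq> xs" using xs by blast
    then show "ys \<in> R \<longleftrightarrow> (\<exists>j < r. ys ! j \<noteq> xs ! j)" using ys(1) xs_mem(1) by (auto simp: list_eq_iff_nth_eq)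
  next
    show "1 \<le> q" "1 \<le> k" "R \<subseteq> tuples {1..q} r" "permutation_invariant q r R" by (fact assms)+
    show "J \<subseteq> {..<r}" by (auto simp: J_def)
    show "card J = k" using Ds(3) by (simp add: J_def)
    show "xs ! j \<in> {1..q}" if "j < r" for j using xs_mem(2)[OF that] sub(1)[OF that] by (rule subsetD[rotated])
    show "g j \<in> {1..q} \<and> g j \<noteq> xs ! j" if "j \<in> J" for j using g[OF that] by (elim conjE) (intro conjI)
  qed
qed

context OR_gadget
begin

lemma finite_J: "finite J" using J(1) finite_subset by blast

definition js :: "nat list" where "js = sorted_list_of_set J"

lemma js: "set js = J" "distinct js" "length js = k"
  using finite_J J(2) by (auto simp: js_def)

lemma r_pos: "0 < r"
proof -
  have "J \<noteq> {}" using J(2) k by auto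
  then show ?thesis using J(1) by auto
qed

text \<open>
  Vertices: the palette vertices \<open>0, \<dots>, q - 1\<close> form a clique, and for each literal there is one
  vertex for each position \<open>j \<in> J\<close>, which has color \<open>g j\<close> if the literal is true and \<open>f j\<close> otherwise.
  The numbers of the vertices of consecutive variables are consecutive.
\<close>

definition palette :: "nat \<Rightarrow> nat" where
  "palette a = a - 1"

definition lit_vertex :: "nat \<Rightarrow> nat \<times> bool \<Rightarrow> nat \<Rightarrow> nat" where
  "lit_vertex N l j = q + (((if snd l then 0 else r) + j) * N + fst l)"

text \<open>Vertices are reserved for all \<open>r\<close> positions and both signs, which keeps the
  numbering a plain mixed-radix one; those for positions outside \<open>J\<close> are
  isolated.\<close>

definition order :: "nat \<Rightarrow> nat" where
  "order N = q + 2 * r * N"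

text \<open>Once the palette has its proper colors, the second family leaves a literal vertex only
  \<open>f j\<close> and \<open>g j\<close>; the third makes opposite literals differ at each
  position of \<open>J\<close>.\<close>

definition edge_pairs :: "nat \<Rightarrow> (nat \<times> nat) set" where
  "edge_pairs N = (\<lambda>(a, b). (palette a, palette b)) ` {(a, b). a \<in> {1..q} \<and> b \<in> {1..q} \<and> a \<noteq> b}
     \<union> (\<lambda>(l, j, a). (lit_vertex N l j, palette a)) `
         {(l, j, a). fst l < N \<and> j \<in> J \<and> a \<in> {1..q} \<and> a \<noteq> f j \<and> a \<noteq> g j}
     \<union> (\<lambda>(v, j). (lit_vertex N (v, True) j, lit_vertex N (v, False) j)) ` ({..<N} \<times> J)"

lemma edge_pairsI:
  "a \<in> {1..q} \<Longrightarrow> b \<in> {1..q} \<Longrightarrow> a \<noteq> b \<Longrightarrow> (palette a, palette b) \<in> edge_pairs N"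
  "fst l < N \<Longrightarrow> j \<in> J \<Longrightarrow> a \<in> {1..q} \<Longrightarrow> a \<noteq> f j \<Longrightarrow> a \<noteq> g j \<Longrightarrow> (lit_vertex N l j, palette a) \<in> edge_pairs N"
  "v < N \<Longrightarrow> j \<in> J \<Longrightarrow> (lit_vertex N (v, True) j, lit_vertex N (v, False) j) \<in> edge_pairs N"
  unfolding edge_pairs_def
  by (rule UnI1, rule UnI1, rule image_eqI[of _ _ "(a, b)"], simp, simp)
    (rule UnI1, rule UnI2, rule image_eqI[of _ _ "(l, j, a)"], simp, simp,
      rule UnI2, rule image_eqI[of _ _ "(v, j)"], simp, simp)

lemma edge_pairs_cases:
  assumes "(u, v) \<in> edge_pairs N"
  obtains a b where "u = palette a" "v = palette b" "a \<in> {1..q}" "b \<in> {1..q}" "a \<noteq> b"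
  | l j a where "u = lit_vertex N l j" "v = palette a" "fst l < N" "j \<in> J" "a \<in> {1..q}" "a \<noteq> f j" "a \<noteq> g j"
  | w j where "u = lit_vertex N (w, True) j" "v = lit_vertex N (w, False) j" "w < N" "j \<in> J"
proof -
  from assms consider x where "(u, v) = (\<lambda>(a, b). (palette a, palette b)) x"
      "x \<in> {(a, b). a \<in> {1..q} \<and> b \<in> {1..q} \<and> a \<noteq> b}"
    | x where "(u, v) = (\<lambda>(l, j, a). (lit_vertex N l j, palette a)) x"
      "x \<in> {(l, j, a). fst l < N \<and> j \<in> J \<and> a \<in> {1..q} \<and> a \<noteq> f j \<and> a \<noteq> g j}"
    | x where "(u, v) = (\<lambda>(v, j). (lit_vertex N (v, True) j, lit_vertex N (v, False) j)) x" "x \<in> {..<N} \<times> J"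
    unfolding edge_pairs_def by (elim UnE imageE)
  then show thesis
  proof cases
    case (1 x)
    then show ?thesis using that(1)[of "fst x" "snd x"] by (auto simp: case_prod_beta)
  next
    case (2 x)
    then show ?thesis using that(2)[of "fst x" "fst (snd x)" "snd (snd x)"] by (auto simp: case_prod_beta)
  next
    case (3 x)
    then show ?thesis using that(3)[of "fst x" "snd x"] by (auto simp: case_prod_beta)
  qed
qed

text \<open>A position without a literal gets the palette vertex of color \<open>f j\<close>, a
  constant false, so clauses shorter than \<open>k\<close> fit the same relation.\<close>

definition tuple_of :: "nat \<Rightarrow> (nat \<Rightarrow> (nat \<times> bool) option) \<Rightarrow> nat list" where
  "tuple_of N \<sigma> = map (\<lambda>j. case \<sigma> j of None \<Rightarrow> palette (f j) | Some l \<Rightarrow> lit_vertex N l j) [0..<r]"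

definition clause_tuple :: "nat \<Rightarrow> nat clause \<Rightarrow> nat list" where
  "clause_tuple N C = tuple_of N (map_of (zip js C))"

text \<open>The clause that \<open>v\<close> holds at \<open>i\<close> or its negation at
  \<open>j\<close>. Since opposite literals differ at \<open>j\<close>, truth at \<open>j\<close>
  implies truth at \<open>i\<close>; both orders together make all copies of a variable
  agree.\<close>

definition link_tuples :: "nat \<Rightarrow> nat list set" where
  "link_tuples N = (\<lambda>(v, i, j). tuple_of N [i \<mapsto> (v, True), j \<mapsto> (v, False)]) `
     {(v, i, j). v < N \<and> i \<in> J \<and> j \<in> J \<and> i \<noteq> j}"

lemma lit_vertex_less: "fst l < N \<Longrightarrow> j < r \<Longrightarrow> lit_vertex N l j < order N"
proof -
  assume "fst l < N" "j < r"
  then have "((if snd l then 0 else r) + j) * N + fst l < 2 * r * N"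
    by (intro mixed_radix_less) auto
  then show ?thesis unfolding lit_vertex_def order_def by (rule add_strict_left_mono)
qed

lemma palette_less: "a \<in> {1..q} \<Longrightarrow> palette a < q" "palette a < q \<Longrightarrow> palette a < order N"
  by (auto simp: palette_def order_def)

lemma lit_vertex_neq:
  "fst l < N \<Longrightarrow> a \<in> {1..q} \<Longrightarrow> lit_vertex N l j \<noteq> palette a"
  "v < N \<Longrightarrow> lit_vertex N (v, True) j \<noteq> lit_vertex N (v, False) j"
proof -
  show "fst l < N \<Longrightarrow> a \<in> {1..q} \<Longrightarrow> lit_vertex N l j \<noteq> palette a"
    using palette_less(1)[of a] by (simp add: lit_vertex_def)
  have "0 < r * N" if "v < N" using r_pos that by simp
  then show "v < N \<Longrightarrow> lit_vertex N (v, True) j \<noteq> lit_vertex N (v, False) j"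
    by (simp add: lit_vertex_def add_mult_distrib)
qed

lemma edge_pairs_bounds:
  assumes "(u, v) \<in> edge_pairs N"
  shows "u < order N" "v < order N" "u \<noteq> v"
proof -
  have Jr: "j < r" if "j \<in> J" for j using that J(1) by auto
  from assms have "u < order N \<and> v < order N \<and> u \<noteq> v"
  proof (cases rule: edge_pairs_cases)
    case (1 a b)
    then show ?thesis using palette_less by (auto simp: palette_def)
  next
    case (2 l j a)
    then show ?thesis
      using lit_vertex_less[of l N j] Jr palette_less lit_vertex_neq(1)[of l N a j] by auto
  next
    case (3 w j)
    then show ?thesis
      using lit_vertex_less[of "(w, True)" N j] lit_vertex_less[of "(w, False)" N j] Jr lit_vertex_neq(2)[of w N j] by auto
  qed
  then show "u < order N" "v < order N" "u \<noteq> v" by auto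
qed

lemma simple_graph_edge_pairs: "simple_graph {..<order N} ((\<lambda>(u, v). {u, v}) ` edge_pairs N)"
  unfolding simple_graph_def
proof (intro conjI ballI finite_lessThan)
  fix e assume "e \<in> (\<lambda>(u, v). {u, v}) ` edge_pairs N"
  then obtain u v where "e = {u, v}" "(u, v) \<in> edge_pairs N" by auto
  with edge_pairs_bounds[OF this(2)] show "e \<subseteq> {..<order N}" "card e = 2" by auto
qed

lemma tuple_of_in_tuples:
  assumes "\<And>j l. j < r \<Longrightarrow> \<sigma> j = Some l \<Longrightarrow> fst l < N"
  shows "tuple_of N \<sigma> \<in> tuples {..<order N} r"
proof -
  have "(case \<sigma> j of None \<Rightarrow> palette (f j) | Some l \<Rightarrow> lit_vertex N l j) < order N" if "j < r" for j
    using assms[OF that] lit_vertex_less[OF _ that] palette_less(2)[OF palette_less(1)[OF f[OF that]]]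
    by (auto split: option.split)
  then show ?thesis by (auto simp: tuple_of_def tuples_def)
qed

lemma map_of_zip_js: "map_of (zip js C) j = Some l \<Longrightarrow> j \<in> J \<and> l \<in> set C"
proof -
  assume "map_of (zip js C) j = Some l"
  from map_of_SomeD[OF this] show ?thesis
    using set_zip_leftD[of j l js C] set_zip_rightD[of j l js C] js(1) by blast
qed

lemma clause_tuple_in_tuples: "C \<in> clauses_over {..<N} c \<Longrightarrow> clause_tuple N C \<in> tuples {..<order N} r"
  unfolding clause_tuple_def
proof (rule tuple_of_in_tuples)
  fix j l assume "C \<in> clauses_over {..<N} c" "map_of (zip js C) j = Some l"
  then show "fst l < N" using map_of_zip_js[of C j l] by (cases l) (auto simp: clauses_over_def)
qed

lemma link_tuples_in_tuples: "link_tuples N \<subseteq> tuples {..<order N} r"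
proof
  fix xs assume "xs \<in> link_tuples N"
  then obtain v i j where "v < N" "xs = tuple_of N [i \<mapsto> (v, True), j \<mapsto> (v, False)]"
    by (auto simp: link_tuples_def)
  then show "xs \<in> tuples {..<order N} r"
    by (simp, intro tuple_of_in_tuples) (auto split: if_splits)
qed

text \<open>On the clique the coloring permutes the colors. Composing with the inverse permutation
  restores the names, and invariance of \<open>R\<close> preserves the constraints.\<close>

lemma normalize_coloring:
  assumes col: "proper_coloring q V E c" "\<forall>xs \<in> F. map c xs \<in> R"
    and pal: "\<forall>a \<in> {1..q}. \<forall>b \<in> {1..q}. a \<noteq> b \<longrightarrow> {palette a, palette b} \<in> E" "palette ` {1..q} \<subseteq> V"
  shows "\<exists>c'. c' ` V \<subseteq> {1..q} \<and> (\<forall>u v. {u, v} \<in> E \<longrightarrow> c' u \<noteq> c' v) \<and>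
    (\<forall>xs \<in> F. map c' xs \<in> R) \<and> (\<forall>a \<in> {1..q}. c' (palette a) = a)"
proof -
  define \<pi> where "\<pi> a = c (palette a)" for a
  have cV: "c ` V \<subseteq> {1..q}" and cE: "\<And>u v. {u, v} \<in> E \<Longrightarrow> c u \<noteq> c v"
    using col(1) by (auto simp: proper_coloring_def)
  have inj: "inj_on \<pi> {1..q}"
  proof (rule inj_onI, rule ccontr)
    fix a b assume "a \<in> {1..q}" "b \<in> {1..q}" "\<pi> a = \<pi> b" "a \<noteq> b"
    then show False using cE pal(1) unfolding \<pi>_def by blast
  qed
  have "\<pi> ` {1..q} \<subseteq> {1..q}" using pal(2) cV by (auto simp: \<pi>_def)
  then have img: "\<pi> ` {1..q} = {1..q}" using inj by (intro endo_inj_surj) auto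
  define \<rho> where "\<rho> x = (if x \<in> {1..q} then inv_into {1..q} \<pi> x else x)" for x
  have "bij_betw (inv_into {1..q} \<pi>) {1..q} {1..q}"
    using bij_betw_inv_into[of \<pi> "{1..q}" "{1..q}"] inj img by (simp add: bij_betw_def)
  then have bij: "bij_betw \<rho> {1..q} {1..q}"
    by (rule bij_betw_cong[THEN iffD1, rotated]) (simp add: \<rho>_def)
  have perm: "\<rho> permutes {1..q}"
    by (rule bij_imp_permutes[OF bij]) (auto simp: \<rho>_def)
  show ?thesis
  proof (intro exI[of _ "\<rho> \<circ> c"] conjI allI impI ballI)
    show "(\<rho> \<circ> c) ` V \<subseteq> {1..q}" using image_mono[OF cV, of \<rho>] bij_betw_imp_surj_on[OF bij] by (simp add: image_comp)
    show "(\<rho> \<circ> c) u \<noteq> (\<rho> \<circ> c) v" if "{u, v} \<in> E" for u v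
      using cE[OF that] permutes_inj[OF perm] by (auto dest: injD)
    show "map (\<rho> \<circ> c) xs \<in> R" if "xs \<in> F" for xs
    proof -
      have "map c xs \<in> R" using col(2) that by blast
      moreover have "map c xs \<in> tuples {1..q} r" using calculation R by blast
      ultimately have "map \<rho> (map c xs) \<in> R"
        using invariant perm unfolding permutation_invariant_def by blast
      then show ?thesis by simp
    qed
    show "(\<rho> \<circ> c) (palette a) = a" if "a \<in> {1..q}" for a
      using inv_into_f_f[OF inj that] img that by (auto simp: \<rho>_def \<pi>_def[symmetric])
  qed
qed

theorem colorable_iff_sat:
  assumes F: "F \<subseteq> clauses_over {..<N} k"
  shows "constrained_colorable q R {..<order N} ((\<lambda>(u, v). {u, v}) ` edge_pairs N)
      (link_tuples N \<union> clause_tuple N ` F) \<longleftrightarrow> (\<exists>\<alpha>. sat \<alpha> F)"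
proof
  let ?V = "{..<order N}" and ?E = "(\<lambda>(u, v). {u, v}) ` edge_pairs N"
  let ?F = "link_tuples N \<union> clause_tuple N ` F"
  have Jr: "j < r" if "j \<in> J" for j using that J(1) by auto
  {
    assume "constrained_colorable q R ?V ?E ?F"
    then obtain c0 where c0: "proper_coloring q ?V ?E c0" "\<forall>xs \<in> ?F. map c0 xs \<in> R"
      by (auto simp: constrained_colorable_def)
    have E: "{u, v} \<in> ?E" if "(u, v) \<in> edge_pairs N" for u v
      using that by (force simp: image_iff)
    have pal: "\<forall>a \<in> {1..q}. \<forall>b \<in> {1..q}. a \<noteq> b \<longrightarrow> {palette a, palette b} \<in> ?E"
      by (intro ballI impI E edge_pairsI(1))
    have pal_V: "palette ` {1..q} \<subseteq> ?V" using palette_less by auto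
    obtain c where c: "c ` ?V \<subseteq> {1..q}" "\<forall>u v. {u, v} \<in> ?E \<longrightarrow> c u \<noteq> c v"
      "\<forall>xs \<in> ?F. map c xs \<in> R" "\<forall>a \<in> {1..q}. c (palette a) = a"
      using normalize_coloring[OF c0 pal pal_V] by (elim exE conjE)
    have edge: "c u \<noteq> c v" if "(u, v) \<in> edge_pairs N" for u v
      using c(2)[rule_format, OF E[OF that]] .
    \<comment> \<open>The palette vertices of all colors other than \<open>f j\<close> and
      \<open>g j\<close> are neighbors.\<close>
    have range: "c (lit_vertex N l j) = f j \<or> c (lit_vertex N l j) = g j" if "fst l < N" "j \<in> J" for l j
    proof (rule ccontr)
      assume *: "\<not> ?thesis"
      let ?a = "c (lit_vertex N l j)"
      have a: "?a \<in> {1..q}" using c(1) lit_vertex_less[OF that(1) Jr[OF that(2)]] by auto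
      have "(lit_vertex N l j, palette ?a) \<in> edge_pairs N"
        using that a * by (intro edge_pairsI(2)) auto
      from edge[OF this] c(4) a show False by simp
    qed
    define T where "T l j \<longleftrightarrow> c (lit_vertex N l j) \<noteq> f j" for l j
    have neg: "T (v, True) j \<or> T (v, False) j" "\<not> (T (v, True) j \<and> T (v, False) j)" if "v < N" "j \<in> J" for v j
    proof -
      from edge[OF edge_pairsI(3)[OF that]] range[of "(v, True)" j] range[of "(v, False)" j] that
      show "T (v, True) j \<or> T (v, False) j" "\<not> (T (v, True) j \<and> T (v, False) j)" by (auto simp: T_def)
    qed
    have tuple: "\<exists>j l. \<sigma> j = Some l \<and> T l j"
      if "tuple_of N \<sigma> \<in> ?F" and \<sigma>: "\<And>j l. \<sigma> j = Some l \<Longrightarrow> j \<in> J \<and> fst l < N" for \<sigma>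
    proof -
      let ?xs = "map c (tuple_of N \<sigma>)"
      have nth: "?xs ! j = (case \<sigma> j of None \<Rightarrow> f j | Some l \<Rightarrow> c (lit_vertex N l j))" if "j < r" for j
        using c(4) f[OF that] that by (auto simp: tuple_of_def split: option.split)
      have "?xs \<in> R \<longleftrightarrow> (\<exists>j < r. ?xs ! j \<noteq> f j)"
        using nth \<sigma> range by (intro R_iff) (auto simp: tuple_of_def split: option.splits)
      moreover have "?xs \<in> R" by (rule c(3)[rule_format, OF that(1)])
      ultimately obtain j where "j < r" "?xs ! j \<noteq> f j" by auto
      then show ?thesis using nth by (auto simp: T_def split: option.splits)
    qed
    obtain j0 where j0: "j0 \<in> J" using J(2) k by fastforce
    \<comment> \<open>Any position of \<open>J\<close> serves, since the link tuples make
      \<open>T\<close> agree at all of them.\<close>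
    define \<alpha> where "\<alpha> v = T (v, True) j0" for v
    have link: "T (v, True) i \<or> T (v, False) j" if "v < N" "i \<in> J" "j \<in> J" "i \<noteq> j" for v i j
    proof -
      let ?\<sigma> = "[i \<mapsto> (v, True), j \<mapsto> (v, False)]"
      have "?\<sigma> j' = Some l \<Longrightarrow> j' \<in> J \<and> fst l < N" for j' l using that by (auto split: if_splits)
      moreover have "tuple_of N ?\<sigma> \<in> link_tuples N"
        unfolding link_tuples_def using that by (intro image_eqI[of _ _ "(v, i, j)"]) auto
      ultimately have "\<exists>j' l. ?\<sigma> j' = Some l \<and> T l j'" by (intro tuple UnI1)
      then show ?thesis by (auto split: if_splits)
    qed
    have T: "T (v, b) j \<longleftrightarrow> \<alpha> v = b" if "v < N" "j \<in> J" for v b j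
      using link[of v j j0] link[of v j0 j] neg[of v j] neg[of v j0] that j0
      by (cases "j = j0"; cases b) (auto simp: \<alpha>_def)
    have "sat \<alpha> F"
      unfolding sat_def
    proof
      fix C assume C: "C \<in> F"
      have v: "fst l < N" if "l \<in> set C" for l using C F that by (cases l) (auto simp: clauses_over_def)
      have "\<exists>j l. map_of (zip js C) j = Some l \<and> T l j"
      proof (rule tuple)
        show "tuple_of N (map_of (zip js C)) \<in> ?F"
          using imageI[OF C, of "clause_tuple N"] by (simp add: clause_tuple_def)
        show "j \<in> J \<and> fst l < N" if "map_of (zip js C) j = Some l" for j l
          using map_of_zip_js[OF that] v by simp
      qed
      then obtain j l where jl: "map_of (zip js C) j = Some l" "T l j" by (elim exE conjE)
      have "j \<in> J" "l \<in> set C" using map_of_zip_js[OF jl(1)] by auto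
      then show "sat_clause \<alpha> C"
        using T[of "fst l" j "snd l"] jl(2) v[of l] by (auto simp: sat_clause_def sat_lit_def)
    qed
    then show "\<exists>\<alpha>. sat \<alpha> F" by blast
  }
  assume "\<exists>\<alpha>. sat \<alpha> F"
  then obtain \<alpha> where \<alpha>: "sat \<alpha> F" by blast
  \<comment> \<open>Inverts the numbering of the vertices; the isolated ones get the default color
    1.\<close>
  define c where "c w = (if w < q then w + 1 else
    let i = (w - q) div N; j = i mod r; b = (i < r); v = (w - q) mod N in
    if j \<in> J then (if \<alpha> v = b then g j else f j) else 1)" for w
  have c_pal: "c (palette a) = a" if "a \<in> {1..q}" for a using that by (auto simp: c_def palette_def)
  have c_lit: "c (lit_vertex N l j) = (if sat_lit \<alpha> l then g j else f j)" if "fst l < N" "j \<in> J" for l j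
  proof -
    let ?i = "(if snd l then 0 else r) + j"
    have "(?i * N + fst l) div N = ?i" "(?i * N + fst l) mod N = fst l" using that(1) by auto
    moreover have "?i mod r = j" "(?i < r) = snd l" using Jr[OF that(2)] by auto
    ultimately show ?thesis using that(2) by (simp add: c_def lit_vertex_def sat_lit_def Let_def)
  qed
  have "c ` ?V \<subseteq> {1..q}"
  proof
    fix x assume "x \<in> c ` ?V"
    then obtain w where "x = c w" by blast
    then show "x \<in> {1..q}"
      using f[OF Jr, of "(w - q) div N mod r"] g[of "(w - q) div N mod r"] q
      by (auto simp: c_def Let_def)
  qed
  moreover have edge: "c u \<noteq> c v" if "(u, v) \<in> edge_pairs N" for u v
    using that
  proof (cases rule: edge_pairs_cases)
    case (3 w j)
    then show ?thesis using c_lit[of "(w, True)" j] c_lit[of "(w, False)" j] g[of j] by (auto simp: sat_lit_def)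
  qed (use c_pal c_lit in auto)
  have "c u \<noteq> c v" if uv: "{u, v} \<in> ?E" for u v
  proof -
    from uv obtain x y where "(x, y) \<in> edge_pairs N" "{u, v} = {x, y}" by auto
    with edge[of x y] show ?thesis by (auto simp: doubleton_eq_iff)
  qed
  ultimately have proper: "proper_coloring q ?V ?E c" by (auto simp: proper_coloring_def)
  have tuple: "map c (tuple_of N \<sigma>) \<in> R"
    if \<sigma>: "\<And>j l. \<sigma> j = Some l \<Longrightarrow> j \<in> J \<and> fst l < N" and "\<sigma> j = Some l" "sat_lit \<alpha> l" for \<sigma> j l
  proof -
    let ?xs = "map c (tuple_of N \<sigma>)"
    have nth: "?xs ! j = (case \<sigma> j of None \<Rightarrow> f j | Some l \<Rightarrow> if sat_lit \<alpha> l then g j else f j)" if "j < r" for j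
      using c_pal c_lit \<sigma> f[OF that] that by (auto simp: tuple_of_def split: option.split)
    have "?xs \<in> R \<longleftrightarrow> (\<exists>j < r. ?xs ! j \<noteq> f j)"
      using nth \<sigma> by (intro R_iff) (auto simp: tuple_of_def split: option.splits)
    moreover have "j \<in> J" using \<sigma>[OF that(2)] by simp
    then have "j < r \<and> ?xs ! j \<noteq> f j" using Jr[of j] nth[of j] that(2,3) g[of j] by simp
    then have "\<exists>j < r. ?xs ! j \<noteq> f j" by (rule exI)
    ultimately show ?thesis by (rule iffD2)
  qed
  have "map c xs \<in> R" if xs: "xs \<in> link_tuples N" for xs
  proof -
    obtain v i j where vij: "v < N" "i \<in> J" "j \<in> J" "i \<noteq> j" "xs = tuple_of N [i \<mapsto> (v, True), j \<mapsto> (v, False)]"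
      using xs by (auto simp: link_tuples_def)
    let ?\<sigma> = "[i \<mapsto> (v, True), j \<mapsto> (v, False)]"
    have \<sigma>: "j' \<in> J \<and> fst l < N" if "?\<sigma> j' = Some l" for j' l using that vij by (auto split: if_splits)
    show ?thesis
    proof (cases "\<alpha> v")
      case True
      show ?thesis
        unfolding vij(5) by (rule tuple[of ?\<sigma> i "(v, True)"]) (use \<sigma> vij True in \<open>simp_all add: sat_lit_def\<close>)
    next
      case False
      show ?thesis
        unfolding vij(5) by (rule tuple[of ?\<sigma> j "(v, False)"]) (use \<sigma> vij False in \<open>simp_all add: sat_lit_def\<close>)
    qed
  qed
  moreover have "map c (clause_tuple N C) \<in> R" if C: "C \<in> F" for C
  proof -
    have v: "fst l < N" if "l \<in> set C" for l using C F that by (cases l) (auto simp: clauses_over_def)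
    have len: "length C \<le> length js" using C F js(3) by (auto simp: clauses_over_def)
    have "sat_clause \<alpha> C" using \<alpha> C by (simp add: sat_def)
    then obtain i where i: "i < length C" "sat_lit \<alpha> (C ! i)" by (auto simp: sat_clause_def in_set_conv_nth)
    have "(js ! i, C ! i) \<in> set (zip js C)" using i len by (auto simp: set_zip)
    moreover have "distinct (map fst (zip js C))" using js(2) by (simp add: map_fst_zip_take)
    ultimately have "map_of (zip js C) (js ! i) = Some (C ! i)" by (simp add: map_of_is_SomeI)
    then show ?thesis
      unfolding clause_tuple_def
    proof (rule tuple[rotated])
      show "j \<in> J \<and> fst l < N" if "map_of (zip js C) j = Some l" for j l
        using map_of_zip_js[OF that] v by simp
    qed (rule i(2))
  qed
  ultimately show "constrained_colorable q R ?V ?E ?F"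
    using proper by (auto simp: constrained_colorable_def)
qed

end

section \<open>Advice\<close>

text \<open>\<open>Bit l\<close> marks a place in a unary number that is to be increased by the bit
  with label \<open>l\<close>.\<close>

datatype 'l tsym = Lit bool | Bit 'l

fun expand :: "('l \<Rightarrow> bool) \<Rightarrow> 'l tsym list \<Rightarrow> bool list" where
  "expand d [] = []"
| "expand d (Lit b # ts) = b # expand d ts"
| "expand d (Bit l # ts) = (if d l then True # expand d ts else expand d ts)"

fun labels :: "'l tsym list \<Rightarrow> 'l list" where
  "labels [] = []"
| "labels (Lit b # ts) = labels ts"
| "labels (Bit l # ts) = l # labels ts"

lemma expand_append [simp]: "expand d (ts @ us) = expand d ts @ expand d us"
  by (induction d ts rule: expand.induct) auto

lemma labels_append [simp]: "labels (ts @ us) = labels ts @ labels us"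
  by (induction ts rule: labels.induct) auto

lemma labels_rev: "labels (rev ts) = rev (labels ts)"
  by (induction ts rule: labels.induct) auto

lemma expand_Lit [simp]: "expand d (map Lit w) = w"
  by (induction w) auto

lemma labels_Lit [simp]: "labels (map Lit w) = []"
  by (induction w) auto

lemma expand_concat: "expand d (concat tss) = concat (map (expand d) tss)"
  by (induction tss) auto

lemma labels_concat: "labels (concat tss) = concat (map labels tss)"
  by (induction tss) auto

lemma length_labels: "length (labels ts) \<le> length ts"
  by (induction ts rule: labels.induct) auto

fun symbol_of :: "'i \<Rightarrow> ('i \<times> nat) tsym \<Rightarrow> nat" where
  "symbol_of i (Lit b) = bit_symbol b"
| "symbol_of i (Bit l) = (if fst l = i then 3 else 4)"

lemma first_simps [simp]: "first (b # x) = b" "first [] = False"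
  by (auto simp: first_def)

text \<open>Bits are consumed in the order of their labels, so the tested word and the witness are
  the two filtered label lists. Output is built at the front, hence \<open>rev ts\<close>.\<close>

lemma fill_template_symbols:
  "fill_template (map (symbol_of i) ts @ 5 # A) (map d (filter (\<lambda>l. fst l = i) (labels ts)) @ x)
     (map d (filter (\<lambda>l. fst l \<noteq> i) (labels ts)) @ u) y = (expand d (rev ts) @ y, A)"
proof (induction ts arbitrary: y)
  case (Cons t ts)
  then show ?case by (cases t) (auto simp: bit_symbol_def)
qed simp

text \<open>False bits agree with what is read after the end of the witness, so every witness may be
  taken to be long enough.\<close>

lemma fill_template_padding: "fill_template A x (u @ replicate n False) y = fill_template A x u y"
proof (induction A arbitrary: x u y n)
  case (Cons a A)
  have 1: "first (u @ replicate n False) = first u" by (cases u; cases n) auto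
  show ?case
  proof (cases u)
    case Nil
    have "fill_template A x (False # replicate m False) y = fill_template A x [] y"
      "fill_template A x (replicate m False) y = fill_template A x [] y" for x y m
      using Cons[of x "[]" "Suc m" y] Cons[of x "[]" m y] by simp_all
    then show ?thesis using Nil 1 by (cases n) auto
  next
    case (Cons b u')
    have "fill_template A x (b # u' @ replicate n False) y = fill_template A x (b # u') y" for x y
      using Cons.IH[of x "b # u'" n y] by simp
    then show ?thesis using Cons Cons.IH 1 by auto
  qed
qed simp

lemma read_param_replicate: "read_param (replicate n 2 @ 5 # A) k = (k + n, A)"
  by (induction n arbitrary: k) auto

lemma matches_bsym: "matches (bsym w @ 5 # A) w' \<longleftrightarrow> w = w'"
proof (induction w' arbitrary: w)
  case Nil
  show ?case by (cases w) (auto simp: bit_symbol_def)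
next
  case (Cons b w')
  then show ?case by (cases w) (auto simp: bit_symbol_def split: if_splits)
qed

lemma select_entry_skip:
  "\<forall>b \<in> set B. b \<noteq> 0 \<and> b \<noteq> 6 \<Longrightarrow> select_entry (B @ A) u = select_entry A u"
  by (induction B) auto

text \<open>Reversed because the advice tape is written rightwards and then read leftwards.\<close>

definition advice_code :: "nat list \<Rightarrow> bool list" where
  "advice_code A = concat (map (\<lambda>c. replicate c True @ [False]) (rev A))"

lemma parse_advice_unary:
  "c + n \<le> 6 \<Longrightarrow> parse_advice (replicate n True @ False # w) c A = parse_advice w 0 ((c + n) # A)"
proof (induction n arbitrary: c)
  case (Suc n)
  then have "min 6 (c + 1) = Suc c" by simp
  with Suc.IH[of "Suc c"] Suc.prems show ?case by simp
qed simp

lemma parse_advice_concat: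
  "\<forall>c \<in> set cs. c \<le> 6 \<Longrightarrow>
    parse_advice (concat (map (\<lambda>c. replicate c True @ [False]) cs)) 0 A = rev cs @ A"
  by (induction cs arbitrary: A) (auto simp: parse_advice_unary)

lemma parse_word_doubled: "parse_word (doubled x @ False # w) y = (rev x @ y, parse_advice w 0 [])"
  by (induction x arbitrary: y) auto

lemma parse_word_encode_pair:
  "\<forall>c \<in> set A. c \<le> 6 \<Longrightarrow> parse_word (encode_pair (x, advice_code A)) [] = (rev x, A)"
  by (simp add: advice_code_def parse_word_doubled parse_advice_concat)

lemma length_advice_code:
  assumes "\<forall>c \<in> set A. c \<le> 6"
  shows "length A \<le> length (advice_code A)" "length (advice_code A) \<le> 7 * length A"
proof -
  have "length (concat (map (\<lambda>c. replicate c True @ [False]) cs)) \<le> 7 * length cs \<and>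
      length cs \<le> length (concat (map (\<lambda>c. replicate c True @ [False]) cs))" if "\<forall>c \<in> set cs. c \<le> 6" for cs :: "nat list"
    using that by (induction cs) auto
  from this[of "rev A"] assms
  show "length A \<le> length (advice_code A)" "length (advice_code A) \<le> 7 * length A"
    by (auto simp: advice_code_def)
qed

text \<open>
  An entry \<open>(z, i)\<close> of the advice stands for the words \<open>x\<close> that can be completed to a family \<open>xs\<close> with
  \<open>xs i = x\<close> whose composition is mapped to \<open>z\<close>.
\<close>

definition entry_body :: "nat \<Rightarrow> ('i \<times> nat) tsym list \<Rightarrow> (bool list \<times> nat) \<times> 'i \<Rightarrow> nat list" where
  "entry_body n ts e = replicate n 2 @ 5 # map (symbol_of (snd e)) (rev ts) @ 5 # bsym (encode_param (fst e)) @ [5]"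

definition entry :: "nat \<Rightarrow> ('i \<times> nat) tsym list \<Rightarrow> (bool list \<times> nat) \<times> 'i \<Rightarrow> nat list" where
  "entry n ts e = 6 # entry_body n ts e"

definition advice :: "nat \<Rightarrow> ('i \<times> nat) tsym list \<Rightarrow> ((bool list \<times> nat) \<times> 'i) list \<Rightarrow> bool list" where
  "advice n ts es = advice_code (concat (map (entry n ts) es))"

lemma symbol_of_range: "symbol_of i t \<in> {1..5}"
  by (cases t) (auto simp: bit_symbol_def)

lemma entry_tail: "b \<in> set (entry_body n ts e) \<Longrightarrow> b \<in> {1..5}"
  using symbol_of_range[of "snd e"] by (auto simp: entry_body_def bit_symbol_def simp del: encode_param.simps)

lemma entry_le_6: "\<forall>c \<in> set (concat (map (entry n ts) es)). c \<le> 6"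
proof
  fix c assume "c \<in> set (concat (map (entry n ts) es))"
  then obtain e where "c \<in> set (entry n ts e)" by auto
  then have "c = 6 \<or> c \<in> set (entry_body n ts e)" by (simp add: entry_def)
  then show "c \<le> 6" using entry_tail by fastforce
qed

lemma select_entry_sound:
  "select_entry (concat (map (entry n ts) es)) u = Some (B, u') \<Longrightarrow>
    \<exists>e \<in> set es. \<exists>A. B = entry_body n ts e @ A"
proof (induction es arbitrary: u)
  case (Cons e es)
  let ?A = "concat (map (entry n ts) es)"
  have skip: "select_entry (entry_body n ts e @ ?A) v = select_entry ?A v" for v
    using entry_tail by (intro select_entry_skip) fastforce
  have "concat (map (entry n ts) (e # es)) = 6 # entry_body n ts e @ ?A"
    by (simp add: entry_def)
  from Cons.prems[unfolded this]
  have sel: "(if first u then Some (entry_body n ts e @ ?A, tl u) else select_entry (entry_body n ts e @ ?A) (tl u)) = Some (B, u')"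
    by simp
  show ?case
  proof (cases "first u")
    case True
    then show ?thesis using sel by auto
  next
    case False
    then have "select_entry ?A (tl u) = Some (B, u')" using sel skip by simp
    from Cons.IH[OF this] show ?thesis by auto
  qed
qed simp

text \<open>To choose an entry, the witness declines all earlier start symbols.\<close>

lemma select_entry_complete:
  "select_entry (concat (map (entry n ts) (es @ e # es'))) (replicate (length es) False @ True # u) =
     Some (entry_body n ts e @ concat (map (entry n ts) es'), u)"
proof (induction es)
  case Nil
  show ?case by (simp add: entry_def)
next
  case (Cons e1 es)
  let ?A = "concat (map (entry n ts) (es @ e # es'))"
  have "select_entry (entry_body n ts e1 @ ?A) v = select_entry ?A v" for v
    using entry_tail by (intro select_entry_skip) fastforce
  moreover have "concat (map (entry n ts) ((e1 # es) @ e # es')) = 6 # entry_body n ts e1 @ ?A"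
    by (simp add: entry_def)
  ultimately show ?case using Cons by simp
qed

section \<open>What the verifier accepts\<close>

lemma filter_fst_product:
  "distinct Is \<Longrightarrow> i \<in> set Is \<Longrightarrow> filter (\<lambda>l. fst l = i) (List.product Is ps) = map (Pair i) ps"
proof (induction Is)
  case (Cons j Is)
  have "filter (\<lambda>l. fst l = i) (List.product Is ps) = []" if "i \<notin> set Is" for Is
    using that by (auto simp: filter_empty_conv)
  with Cons show ?case by (cases "i = j") (auto simp: filter_map comp_def)
qed simp

definition composed :: "('i \<times> nat) tsym list \<Rightarrow> ('i \<Rightarrow> bool list) \<Rightarrow> bool list" where
  "composed ts xs = expand (\<lambda>l. xs (fst l) ! snd l) ts"

text \<open>Template and words appear reversed because the input of \<open>M\<close> is produced
  leftwards. The padding by \<open>a\<close> and the surplus \<open>v'\<close> allow for too few or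
  too many guessed bits.\<close>

lemma verify_entry:
  assumes lab: "labels ts = List.product Is [0..<s]" "distinct Is" and i: "i \<in> set Is"
    and sel: "select_entry (concat (map (entry n ts) es)) (rev u) = Some (entry_body n ts (z, i) @ A, v)"
    and v: "map (\<lambda>l. xs (fst l) ! snd l) (filter (\<lambda>l. fst l \<noteq> i) (rev (List.product Is [0..<s]))) @ v'
      = v @ replicate a False"
    and x: "xs i = x" "length x = s"
  shows "verify f (encode_pair (x, advice n ts es), u) \<longleftrightarrow> f (composed ts xs, n) = z"
proof -
  let ?d = "\<lambda>l. xs (fst l) ! snd l"
  let ?C = "map (symbol_of i) (rev ts) @ 5 # bsym (encode_param z) @ 5 # A"
  have 1: "parse_word (encode_pair (x, advice n ts es)) [] = (rev x, concat (map (entry n ts) es))"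
    unfolding advice_def by (rule parse_word_encode_pair[OF entry_le_6])
  have "entry_body n ts (z, i) @ A = replicate n 2 @ 5 # ?C" by (simp add: entry_body_def)
  then have 2: "read_param (entry_body n ts (z, i) @ A) 0 = (n, ?C)"
    by (simp add: read_param_replicate del: encode_param.simps)
  have "filter (\<lambda>l. fst l = i) (labels (rev ts)) = rev (filter (\<lambda>l. fst l = i) (List.product Is [0..<s]))"
    by (simp add: labels_rev lab(1) rev_filter)
  then have "map ?d (filter (\<lambda>l. fst l = i) (labels (rev ts))) = rev (map ?d (map (Pair i) [0..<s]))"
    by (simp only: filter_fst_product[OF lab(2) i] rev_map)
  also have "map ?d (map (Pair i) [0..<s]) = x" using x map_nth[of x] by (simp add: comp_def)
  finally have 3: "rev x = map ?d (filter (\<lambda>l. fst l = i) (labels (rev ts))) @ []" by simp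
  have 4: "v @ replicate a False = map ?d (filter (\<lambda>l. fst l \<noteq> i) (labels (rev ts))) @ v'"
    using v by (simp add: labels_rev lab(1))
  have "fill_template ?C (rev x) v [] = fill_template ?C (rev x) (v @ replicate a False) []"
    by (simp add: fill_template_padding)
  also have "\<dots> = (composed ts xs, bsym (encode_param z) @ 5 # A)"
    unfolding 3 4 using fill_template_symbols[of i "rev ts" "bsym (encode_param z) @ 5 # A" ?d "[]" v' "[]"]
    by (simp add: composed_def del: encode_param.simps)
  finally show ?thesis
    using 1 2 sel inj_encode_param
    by (simp add: verify_def matches_bsym inj_eq del: encode_param.simps encode_pair.simps) auto
qed

theorem verify_advice:
  assumes lab: "labels ts = List.product Is [0..<s]" "distinct Is" and es: "snd ` set es \<subseteq> set Is"
    and x: "length x = s"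
  shows "(\<exists>u. length u \<le> length (encode_pair (x, advice n ts es)) \<and> verify f (encode_pair (x, advice n ts es), u)) \<longleftrightarrow>
    (\<exists>(z, i) \<in> set es. \<exists>xs. (\<forall>j \<in> set Is. length (xs j) = s) \<and> xs i = x \<and> f (composed ts xs, n) = z)"
proof
  assume "\<exists>u. length u \<le> length (encode_pair (x, advice n ts es)) \<and> verify f (encode_pair (x, advice n ts es), u)"
  then obtain u where u: "verify f (encode_pair (x, advice n ts es), u)" by blast
  have "parse_word (encode_pair (x, advice n ts es)) [] = (rev x, concat (map (entry n ts) es))"
    unfolding advice_def by (rule parse_word_encode_pair[OF entry_le_6])
  with u obtain B v where sel: "select_entry (concat (map (entry n ts) es)) (rev u) = Some (B, v)"
    by (auto simp: verify_def simp del: encode_pair.simps split: option.splits)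
  obtain e A where e: "e \<in> set es" "B = entry_body n ts e @ A" using select_entry_sound[OF sel] by blast
  obtain z i where zi: "e = (z, i)" by fastforce
  have i: "i \<in> set Is" using es e zi by auto
  let ?ls = "filter (\<lambda>l. fst l \<noteq> i) (rev (List.product Is [0..<s]))"
  \<comment> \<open>The padding supplies a bit for every label of another index.\<close>
  let ?v = "v @ replicate (length ?ls) False"
  have dist: "distinct ?ls" using lab(2) by (simp add: distinct_product)
  \<comment> \<open>The guessed bits as a function of the labels, well defined since these are
    distinct; they form the other words of the family.\<close>
  define d where "d = (\<lambda>l. the (map_of (zip ?ls (take (length ?ls) ?v)) l))"
  have len: "length (take (length ?ls) ?v) = length ?ls" by simp
  have d: "map d ?ls = take (length ?ls) ?v"
  proof (rule nth_equalityI)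
    fix t assume "t < length (map d ?ls)"
    then show "map d ?ls ! t = take (length ?ls) ?v ! t"
      using map_of_zip_nth[OF len[symmetric] dist, of t] by (simp add: d_def)
  qed simp
  define xs where "xs j = (if j = i then x else map (\<lambda>p. d (j, p)) [0..<s])" for j
  have "map (\<lambda>l. xs (fst l) ! snd l) ?ls = map d ?ls"
    by (rule map_cong) (auto simp: xs_def)
  from trans[OF this d]
  have eq: "map (\<lambda>l. xs (fst l) ! snd l) ?ls @ drop (length ?ls) ?v = v @ replicate (length ?ls) False"
    by (simp only: append_take_drop_id)
  have "xs i = x" by (simp add: xs_def)
  from verify_entry[OF lab i sel[unfolded e(2) zi] eq this x] u
  have "f (composed ts xs, n) = z" by (rule iffD1)
  moreover have "\<forall>j \<in> set Is. length (xs j) = s" "xs i = x" using x by (auto simp: xs_def)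
  ultimately show "\<exists>(z, i) \<in> set es. \<exists>xs. (\<forall>j \<in> set Is. length (xs j) = s) \<and> xs i = x \<and> f (composed ts xs, n) = z"
    using e(1) unfolding zi by (intro bexI[of _ "(z, i)"]) auto
next
  assume "\<exists>(z, i) \<in> set es. \<exists>xs. (\<forall>j \<in> set Is. length (xs j) = s) \<and> xs i = x \<and> f (composed ts xs, n) = z"
  then obtain z i xs where zi: "(z, i) \<in> set es" and xs: "xs i = x" "f (composed ts xs, n) = z" by blast
  obtain es1 es2 where split: "es = es1 @ (z, i) # es2" using split_list[OF zi] by blast
  have i: "i \<in> set Is" using es zi by auto
  let ?ls = "filter (\<lambda>l. fst l \<noteq> i) (rev (List.product Is [0..<s]))"
  let ?v = "map (\<lambda>l. xs (fst l) ! snd l) ?ls"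
  define u where "u = rev (replicate (length es1) False @ True # ?v)"
  have "select_entry (concat (map (entry n ts) es)) (rev u) =
      Some (entry_body n ts (z, i) @ concat (map (entry n ts) es2), ?v)"
    unfolding split u_def using select_entry_complete by simp
  from verify_entry[OF lab i this, of xs "[]" 0 x f] xs x
  have "verify f (encode_pair (x, advice n ts es), u)" by (simp del: encode_pair.simps)
  moreover have "length u \<le> length (encode_pair (x, advice n ts es))"
  proof -
    \<comment> \<open>Each bit of \<open>u\<close> is paid for by an advice symbol: the choice by
      start symbols, the guesses by template symbols of the chosen entry.\<close>
    have "length es1 \<le> length (concat (map (entry n ts) es1))"
      by (induction es1) (auto simp: entry_def)
    moreover have "length ?ls \<le> length ts"
      using length_labels[of ts] length_filter_le[of _ "rev (List.product Is [0..<s])"] lab(1)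
      by (metis length_rev order_trans)
    then have "length ?ls + 1 \<le> length (entry n ts (z, i))" by (simp add: entry_def entry_body_def del: encode_param.simps)
    ultimately have "length u \<le> length (concat (map (entry n ts) es))"
      unfolding split u_def by simp
    also have "\<dots> \<le> length (advice n ts es)" unfolding advice_def by (rule length_advice_code[OF entry_le_6])
    finally show ?thesis by simp
  qed
  ultimately show "\<exists>u. length u \<le> length (encode_pair (x, advice n ts es)) \<and> verify f (encode_pair (x, advice n ts es), u)"
    by blast
qed

lemma length_advice:
  assumes "\<And>e. e \<in> set es \<Longrightarrow> length (encode_param (fst e)) \<le> h"
  shows "length (advice n ts es) \<le> 7 * (length es * (n + length ts + h + 4))"
proof -
  have "length (advice n ts es) \<le> 7 * length (concat (map (entry n ts) es))"
    unfolding advice_def by (rule length_advice_code[OF entry_le_6])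
  moreover have "length (concat (map (entry n ts) es)) \<le> length es * (n + length ts + h + 4)"
    using assms
  proof (induction es)
    case (Cons e es)
    have "length (entry n ts e) \<le> n + length ts + h + 4"
      using Cons.prems[of e] by (simp add: entry_def entry_body_def del: encode_param.simps)
    then show ?case using Cons by (simp del: encode_param.simps)
  qed simp
  ultimately show ?thesis by simp
qed

section \<open>Coloring instances as templates\<close>

lemma length_concat_map_le:
  "(\<And>x. x \<in> set xs \<Longrightarrow> length (g x) \<le> c) \<Longrightarrow> length (concat (map g xs)) \<le> length xs * c"
  by (induction xs) (auto intro: add_mono)

lemma concat_map_single:
  "concat (map (\<lambda>j. if j = a then [l] else []) [0..<r]) = (if a < r then [l] else [])"
  by (induction r) auto

lemma length_encode_nat [simp]: "length (encode_nat n) = n + 1"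
  by (simp add: encode_nat_def)

lemma constrained_coloring_mem:
  assumes "simple_graph {..<n} (edge_set es)" "set fs \<subseteq> tuples {..<n} r"
  shows "(encode_instance n es fs, n) \<in> constrained_coloring q r R \<longleftrightarrow>
    constrained_colorable q R {..<n} (edge_set es) (set fs)"
proof
  assume "(encode_instance n es fs, n) \<in> constrained_coloring q r R"
  then obtain es' fs' where *: "encode_instance n es fs = encode_instance n es' fs'"
    "set fs' \<subseteq> tuples {..<n} r" "constrained_colorable q R {..<n} (edge_set es') (set fs')"
    by (auto simp: constrained_coloring_def)
  from encode_instance_inject[OF assms(2) *(2) *(1)] *(3)
  show "constrained_colorable q R {..<n} (edge_set es) (set fs)" by simp
qed (use assms in \<open>auto simp: constrained_coloring_def\<close>)

text \<open>The summands pay for the number of vertices with the end markers, at most n^2 edges,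
  \<open>t\<close> transfer tuples, and at most n^r further tuples.\<close>

definition template_bound :: "nat \<Rightarrow> nat \<Rightarrow> nat \<Rightarrow> nat" where
  "template_bound r n t = n + 3 + n * n * (2 * n + 3) + t * (1 + r * (n + 2)) + n ^ r * (1 + r * (n + 1))"

context OR_gadget
begin

text \<open>Built from the tuple for a false bit; \<open>Bit l\<close> adds a one to the unary
  number at position \<open>js ! 0\<close>, where the bit variable stands.\<close>

definition tuple_template :: "nat \<Rightarrow> nat \<Rightarrow> nat \<Rightarrow> nat list \<times> nat \<Rightarrow> (nat list \<times> nat) tsym list" where
  "tuple_template N m s l =
    (let t = clause_tuple N (transfer_clause m s k (fst l) (snd l) False) in
     Lit True # concat (map (\<lambda>j. if j = js ! 0 then map Lit (replicate (t ! j) True) @ [Bit l, Lit False]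
       else map Lit (encode_nat (t ! j))) [0..<r]))"

text \<open>Only the first literal depends on the bit: \<open>bit_var\<close> grows by one, and
  \<open>lit_vertex\<close> adds the variable to an offset, so the vertex number grows by one as
  well.\<close>

lemma clause_tuple_transfer:
  assumes "j < r"
  shows "clause_tuple N (transfer_clause m s k I p b) ! j =
    clause_tuple N (transfer_clause m s k I p False) ! j + (if j = js ! 0 \<and> b then 1 else 0)"
proof -
  obtain j0 js' where js0: "js = j0 # js'" using js(3) k by (cases js) auto
  show ?thesis
    using assms
    by (auto simp: clause_tuple_def tuple_of_def transfer_clause_def js0 lit_vertex_def bit_var_def)
qed

lemma length_clause_tuple: "length (clause_tuple N C) = r"
  by (simp add: clause_tuple_def tuple_of_def)

lemma expand_tuple_template:
  "expand d (tuple_template N m s l) =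
     True # concat (map encode_nat (clause_tuple N (transfer_clause m s k (fst l) (snd l) (d l))))"
proof -
  let ?t = "\<lambda>b. clause_tuple N (transfer_clause m s k (fst l) (snd l) b)"
  have "map encode_nat (?t (d l)) = map (\<lambda>j. encode_nat (?t (d l) ! j)) [0..<r]"
    using length_clause_tuple by (intro nth_equalityI) auto
  also have "\<dots> = map (\<lambda>j. expand d (if j = js ! 0 then map Lit (replicate (?t False ! j) True) @ [Bit l, Lit False]
       else map Lit (encode_nat (?t False ! j)))) [0..<r]"
  proof (rule map_cong[OF refl])
    fix j assume "j \<in> set [0..<r]"
    then have "?t (d l) ! j = ?t False ! j + (if j = js ! 0 \<and> d l then 1 else 0)"
      by (intro clause_tuple_transfer) simp
    then show "encode_nat (?t (d l) ! j) = expand d (if j = js ! 0 then map Lit (replicate (?t False ! j) True) @ [Bit l, Lit False]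
       else map Lit (encode_nat (?t False ! j)))"
      by (auto simp: encode_nat_def replicate_app_Cons_same simp flip: map_replicate)
  qed
  finally show ?thesis
    by (simp add: tuple_template_def Let_def expand_concat comp_def)
qed

lemma js_0_less: "js ! 0 < r"
proof -
  have "js ! 0 \<in> set js" using js(3) k by (intro nth_mem) simp
  then show ?thesis using js(1) J(1) by auto
qed

lemma labels_tuple_template: "labels (tuple_template N m s l) = [l]"
proof -
  have *: "labels (if j = js ! 0 then map Lit (replicate a True) @ [Bit l, Lit False] else map Lit (encode_nat b)) =
      (if j = js ! 0 then [l] else [])" for j a b by (simp del: map_replicate)
  show ?thesis
    by (simp add: tuple_template_def Let_def labels_concat comp_def * concat_map_single js_0_less del: map_replicate)
qed

lemma length_tuple_template:
  assumes "clause_tuple N (transfer_clause m s k (fst l) (snd l) False) \<in> tuples {..<n} r"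
  shows "length (tuple_template N m s l) \<le> 1 + r * (n + 2)"
proof -
  let ?t = "clause_tuple N (transfer_clause m s k (fst l) (snd l) False)"
  have "?t ! j < n" if "j < r" for j
    using assms that nth_mem[of j ?t] by (auto simp: tuples_def simp del: nth_mem)
  then have "length (concat (map (\<lambda>j. if j = js ! 0 then map Lit (replicate (?t ! j) True) @ [Bit l, Lit False]
       else map Lit (encode_nat (?t ! j))) [0..<r])) \<le> length [0..<r] * (n + 2)"
    by (intro length_concat_map_le) (auto simp: less_imp_le le_SucI)
  then show ?thesis by (simp add: tuple_template_def Let_def)
qed

text \<open>Listing the transfer tuples in the order of \<open>List.product Is [0..<s]\<close> fixes
  the order of the labels; edges and all other tuples are literal bits shared by all
  families.\<close>

theorem coloring_template:
  assumes k3: "3 \<le> k" and F: "F \<subseteq> clauses_over {..<N} 3" and N: "2 * (m * s) + k * m \<le> N"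
    and Is: "set Is = tuples {..<m} k" "distinct Is"
  obtains ts where "labels ts = List.product Is [0..<s]"
    "length ts \<le> template_bound r (order N) (length Is * s)"
    "\<And>xs. (composed ts xs, order N) \<in> constrained_coloring q r R \<longleftrightarrow> (\<exists>\<alpha>. sat \<alpha> (F \<union> transfer_clauses m s k xs))"
proof -
  let ?n = "order N"
  have sub: "edge_pairs N \<subseteq> {..<?n} \<times> {..<?n}" using edge_pairs_bounds by auto
  then have "finite (edge_pairs N)" using finite_subset by blast
  then obtain es where es: "set es = edge_pairs N" "distinct es" using finite_distinct_list by blast
  let ?T = "link_tuples N \<union> clause_tuple N ` F"
  have T: "?T \<subseteq> tuples {..<?n} r"
    using link_tuples_in_tuples clause_tuple_in_tuples F by auto
  have finT: "finite (tuples {..<?n} r)" "card (tuples {..<?n} r) = ?n ^ r"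
    unfolding tuples_def using finite_lists_length_eq[of "{..<?n}" r] card_lists_length_eq[of "{..<?n}" r]
    by (simp_all add: conj_commute)
  from finite_distinct_list[OF finite_subset[OF T finT(1)]]
  obtain fl where fl: "set fl = ?T" "distinct fl" by (elim exE conjE)
  let ?e = "\<lambda>(u, v). encode_nat u @ encode_nat v" and ?f = "\<lambda>xs. concat (map encode_nat xs)"
  let ?ls = "List.product Is [0..<s]"
  define pre where "pre = encode_nat ?n @ encode_list ?e es"
  define post where "post = concat (map (\<lambda>x. True # ?f x) fl) @ [False]"
  define ts where "ts = map Lit pre @ concat (map (tuple_template N m s) ?ls) @ map Lit post"
  have tr: "transfer_clause m s k (fst l) (snd l) b \<in> clauses_over {..<N} k" if "l \<in> set ?ls" for l b
  proof -
    obtain I p where l: "l = (I, p)" by fastforce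
    have "I \<in> tuples {..<m} k" "p < s" using that by (simp_all add: l Is(1))
    from transfer_clause_over[OF k this, of b]
    show ?thesis unfolding l fst_conv snd_conv
      by (rule subsetD[OF clauses_over_mono, rotated 2]) (use N in simp_all)
  qed
  show thesis
  proof (rule that[of ts])
    show "labels ts = ?ls"
      by (simp add: ts_def labels_concat comp_def labels_tuple_template)
    show "length ts \<le> template_bound r ?n (length Is * s)"
    proof -
      have "length es = card (edge_pairs N)" using distinct_card[OF es(2)] es(1) by simp
      also have "\<dots> \<le> card ({..<?n} \<times> {..<?n})" using sub by (intro card_mono) auto
      finally have les: "length es \<le> ?n * ?n" by (simp add: card_cartesian_product)
      have "length (encode_list ?e es) \<le> length es * (2 * ?n + 3) + 1"
      proof -
        have "length (True # ?e x) \<le> 2 * ?n + 3" if "x \<in> set es" for x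
        proof -
          obtain u v where x: "x = (u, v)" by fastforce
          with that have "(u, v) \<in> edge_pairs N" by (simp add: es(1))
          from edge_pairs_bounds[OF this] show ?thesis by (simp add: x)
        qed
        then show ?thesis unfolding encode_list_def using length_concat_map_le[of es "\<lambda>x. True # ?e x"] by simp
      qed
      also have "\<dots> \<le> ?n * ?n * (2 * ?n + 3) + 1" using les by (intro add_right_mono mult_right_mono) auto
      finally have 1: "length pre \<le> ?n + 2 + ?n * ?n * (2 * ?n + 3)" by (simp add: pre_def)
      have "length fl = card ?T" using distinct_card[OF fl(2)] fl(1) by simp
      also have "\<dots> \<le> ?n ^ r" using card_mono[OF finT(1) T] finT(2) by simp
      finally have lfl: "length fl \<le> ?n ^ r" .
      have "length (True # ?f x) \<le> 1 + r * (?n + 1)" if "x \<in> set fl" for x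
      proof -
        have x: "length x = r" "set x \<subseteq> {..<?n}" using that fl(1) T by (auto simp: tuples_def)
        then have "length (?f x) \<le> length x * (?n + 1)" by (intro length_concat_map_le) auto
        with x show ?thesis by simp
      qed
      then have "length (concat (map (\<lambda>x. True # ?f x) fl)) \<le> length fl * (1 + r * (?n + 1))"
        by (rule length_concat_map_le)
      also have "\<dots> \<le> ?n ^ r * (1 + r * (?n + 1))" using lfl by (intro mult_right_mono) auto
      finally have 2: "length post \<le> ?n ^ r * (1 + r * (?n + 1)) + 1" by (simp add: post_def)
      have "length (concat (map (tuple_template N m s) ?ls)) \<le> length ?ls * (1 + r * (?n + 2))"
        using tr clause_tuple_in_tuples by (intro length_concat_map_le length_tuple_template) blast
      then have 3: "length (concat (map (tuple_template N m s) ?ls)) \<le> length Is * s * (1 + r * (?n + 2))"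
        by simp
      show ?thesis using 1 2 3 by (simp add: ts_def template_bound_def)
    qed
    fix xs :: "nat list \<Rightarrow> bool list"
    define its where "its = map (\<lambda>l. clause_tuple N (transfer_clause m s k (fst l) (snd l) (xs (fst l) ! snd l))) ?ls"
    have "composed ts xs = encode_instance ?n es (its @ fl)"
      by (simp add: composed_def ts_def pre_def post_def its_def encode_instance_def encode_list_def
          expand_concat comp_def expand_tuple_template)
    moreover have set_its: "set its = clause_tuple N ` transfer_clauses m s k xs"
      using Is(1) by (auto simp: its_def transfer_clauses_def image_image case_prod_beta lessThan_atLeast0)
    have G: "transfer_clauses m s k xs \<subseteq> clauses_over {..<N} k"
    proof
      fix C assume "C \<in> transfer_clauses m s k xs"
      then obtain I p where "I \<in> tuples {..<m} k" "p < s" "C = transfer_clause m s k I p (xs I ! p)"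
        by (auto simp: transfer_clauses_def)
      then show "C \<in> clauses_over {..<N} k" using tr[of "(I, p)"] Is(1) by simp
    qed
    \<comment> \<open>Here k \<ge> 3 enters: the 3-clauses fit into the \<open>k\<close> positions
      of the gadget.\<close>
    have FG: "F \<union> transfer_clauses m s k xs \<subseteq> clauses_over {..<N} k"
      by (rule Un_least[OF order_trans[OF F clauses_over_mono[OF subset_refl k3]] G])
    have "set (its @ fl) = link_tuples N \<union> clause_tuple N ` (F \<union> transfer_clauses m s k xs)"
      by (simp add: set_its fl(1) image_Un Un_ac)
    moreover have "clause_tuple N ` transfer_clauses m s k xs \<subseteq> tuples {..<?n} r"
      using clause_tuple_in_tuples[OF subsetD[OF G]] by (rule image_subsetI)
    then have "set (its @ fl) \<subseteq> tuples {..<?n} r"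
      using T by (simp add: set_its fl(1))
    moreover have "edge_set es = (\<lambda>(u, v). {u, v}) ` edge_pairs N" by (simp add: edge_set_def es(1))
    ultimately show "(composed ts xs, ?n) \<in> constrained_coloring q r R \<longleftrightarrow>
        (\<exists>\<alpha>. sat \<alpha> (F \<union> transfer_clauses m s k xs))"
      using constrained_coloring_mem[of ?n es "its @ fl" r q R] simple_graph_edge_pairs[of N]
        colorable_iff_sat[OF FG] by simp
  qed
qed

end

section \<open>Covering by few entries\<close>

text \<open>A fiber of \<open>H\<close> lies in the product of its projections. If all of these had
  less than half of \<open>B\<close>, each fiber would have fewer than (|B|/2)^|Is| elements, and
  2^|Is| fibers could not cover all families.\<close>

lemma popular_value:
  fixes H :: "('i \<Rightarrow> 'a) \<Rightarrow> 'y"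
  assumes fin: "finite Is" "Is \<noteq> {}" "finite B" "B \<noteq> {}" "finite Y"
    and H: "\<forall>xs \<in> Is \<rightarrow>\<^sub>E B. H xs \<in> Y" and Y: "card Y \<le> 2 ^ card Is"
  shows "\<exists>y. \<exists>i \<in> Is. card B \<le> 2 * card {xs i |xs. xs \<in> Is \<rightarrow>\<^sub>E B \<and> H xs = y}"
proof -
  define pr where "pr y i = {xs i |xs. xs \<in> Is \<rightarrow>\<^sub>E B \<and> H xs = y}" for y i
  have pr_B: "pr y i \<subseteq> B" if "i \<in> Is" for y i using that by (auto simp: pr_def PiE_def Pi_def)
  have "\<exists>y. \<exists>i \<in> Is. card B \<le> 2 * card (pr y i)"
  proof (rule ccontr)
    assume "\<not> ?thesis"
    then have less: "2 * card (pr y i) < card B" if "i \<in> Is" for y i using that not_le by blast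
    have finE: "finite (Is \<rightarrow>\<^sub>E B)" using fin by (intro finite_PiE) auto
    have "Is \<rightarrow>\<^sub>E B \<noteq> {}" using fin(4) by (simp add: PiE_eq_empty_iff)
    then have Y0: "card Y > 0" using H fin(5) by (auto simp: card_gt_0_iff)
    have fib: "2 ^ card Is * card {xs \<in> Is \<rightarrow>\<^sub>E B. H xs = y} < card B ^ card Is" for y
    proof -
      have "{xs \<in> Is \<rightarrow>\<^sub>E B. H xs = y} \<subseteq> (\<Pi>\<^sub>E i\<in>Is. pr y i)"
        by (auto simp: pr_def PiE_def Pi_def)
      moreover have "finite (\<Pi>\<^sub>E i\<in>Is. pr y i)"
        using fin(1,3) pr_B finite_subset by (intro finite_PiE) blast+
      ultimately have "card {xs \<in> Is \<rightarrow>\<^sub>E B. H xs = y} \<le> (\<Prod>i\<in>Is. card (pr y i))"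
        using card_mono[of "\<Pi>\<^sub>E i\<in>Is. pr y i"] card_PiE[OF fin(1), of "pr y"] by simp
      then have "2 ^ card Is * card {xs \<in> Is \<rightarrow>\<^sub>E B. H xs = y} \<le> (\<Prod>i\<in>Is. 2 * card (pr y i))"
        by (simp add: prod.distrib)
      also obtain i where i: "i \<in> Is" using fin(2) by blast
      have "0 < card B" using fin(3,4) by (simp add: card_gt_0_iff)
      then have "(\<Prod>i\<in>Is. 2 * card (pr y i)) < (\<Prod>i\<in>Is. card B)"
        using i less fin(1) by (intro prod_mono_strict[where i = i]) (simp_all add: less_imp_le)
      finally show ?thesis by simp
    qed
    have "Is \<rightarrow>\<^sub>E B = (\<Union>y\<in>Y. {xs \<in> Is \<rightarrow>\<^sub>E B. H xs = y})" using H by auto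
    then have "card (Is \<rightarrow>\<^sub>E B) \<le> (\<Sum>y\<in>Y. card {xs \<in> Is \<rightarrow>\<^sub>E B. H xs = y})"
      using card_UN_le[OF fin(5), of "\<lambda>y. {xs \<in> Is \<rightarrow>\<^sub>E B. H xs = y}"] by simp
    then have "2 ^ card Is * card (Is \<rightarrow>\<^sub>E B) \<le> (\<Sum>y\<in>Y. 2 ^ card Is * card {xs \<in> Is \<rightarrow>\<^sub>E B. H xs = y})"
      by (simp flip: sum_distrib_left)
    also have "\<dots> < (\<Sum>y\<in>Y. card B ^ card Is)"
      using fib fin(5) Y0 by (intro sum_strict_mono) auto
    also have "\<dots> \<le> 2 ^ card Is * card B ^ card Is" using Y by simp
    finally show False using card_PiE[OF fin(1), of "\<lambda>_. B"] by simp
  qed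
  then show ?thesis unfolding pr_def .
qed

text \<open>A popular value shows at least half of the uncovered words at one index, so each entry
  at least halves \<open>B\<close>. Its family lies over the current \<open>B\<close>, hence over
  \<open>X\<close>.\<close>

lemma covering_entries:
  fixes H :: "('i \<Rightarrow> 'a) \<Rightarrow> 'y"
  assumes fin: "finite Is" "Is \<noteq> {}" "finite X" "finite Y"
    and H: "\<And>xs. xs \<in> Is \<rightarrow>\<^sub>E X \<Longrightarrow> H xs \<in> Y" and Y: "card Y \<le> 2 ^ card Is"
  shows "B \<subseteq> X \<Longrightarrow> card B < 2 ^ j \<Longrightarrow> \<exists>es. length es \<le> j \<and>
    (\<forall>(y, i) \<in> set es. i \<in> Is \<and> (\<exists>xs \<in> Is \<rightarrow>\<^sub>E X. H xs = y)) \<and>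
    (\<forall>x \<in> B. \<exists>(y, i) \<in> set es. \<exists>xs \<in> Is \<rightarrow>\<^sub>E X. xs i = x \<and> H xs = y)"
proof (induction j arbitrary: B)
  case 0
  then have "B = {}" using fin(3) finite_subset by fastforce
  then show ?case by (intro exI[of _ "[]"]) simp
next
  case (Suc j)
  have finB: "finite B" using Suc.prems(1) fin(3) finite_subset by blast
  show ?case
  proof (cases "B = {}")
    case True
    then show ?thesis by (intro exI[of _ "[]"]) simp
  next
    case False
    have mono: "xs \<in> Is \<rightarrow>\<^sub>E X" if "xs \<in> Is \<rightarrow>\<^sub>E B" for xs
      using that Suc.prems(1) by (auto simp: PiE_def Pi_def)
    then have HB: "\<forall>xs \<in> Is \<rightarrow>\<^sub>E B. H xs \<in> Y" using H by blast
    obtain y i where yi: "i \<in> Is" "card B \<le> 2 * card {xs i |xs. xs \<in> Is \<rightarrow>\<^sub>E B \<and> H xs = y}"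
      using popular_value[OF fin(1,2) finB False fin(4) HB Y] by (elim exE bexE)
    define D where "D = {xs i |xs. xs \<in> Is \<rightarrow>\<^sub>E B \<and> H xs = y}"
    have D: "D \<subseteq> B" using yi(1) by (auto simp: D_def PiE_def Pi_def)
    have "card B > 0" using False finB by (simp add: card_gt_0_iff)
    then have "card D > 0" using yi(2) D_def by simp
    then obtain xs0 where xs0: "xs0 \<in> Is \<rightarrow>\<^sub>E B" "H xs0 = y" by (fastforce simp: D_def card_gt_0_iff)
    have "card (B - D) = card B - card D" using D finB by (simp add: card_Diff_subset finite_subset)
    then have "card (B - D) < 2 ^ j" using yi(2) Suc.prems(2) \<open>card D > 0\<close> unfolding D_def[symmetric] by simp
    then obtain es where es: "length es \<le> j" "\<forall>(y, i) \<in> set es. i \<in> Is \<and> (\<exists>xs \<in> Is \<rightarrow>\<^sub>E X. H xs = y)"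
      "\<forall>x \<in> B - D. \<exists>(y, i) \<in> set es. \<exists>xs \<in> Is \<rightarrow>\<^sub>E X. xs i = x \<and> H xs = y"
      using Suc.IH[of "B - D"] Suc.prems(1) by blast
    show ?thesis
    proof (intro exI[of _ "(y, i) # es"] conjI ballI)
      show "length ((y, i) # es) \<le> Suc j" using es(1) by simp
      show "case e of (y, i) \<Rightarrow> i \<in> Is \<and> (\<exists>xs \<in> Is \<rightarrow>\<^sub>E X. H xs = y)" if "e \<in> set ((y, i) # es)" for e
        using that es(2) yi(1) xs0 mono[OF xs0(1)] by auto
      fix x assume x: "x \<in> B"
      show "\<exists>(y, i) \<in> set ((y, i) # es). \<exists>xs \<in> Is \<rightarrow>\<^sub>E X. xs i = x \<and> H xs = y"
      proof (cases "x \<in> D")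
        case True
        then obtain xs where "xs \<in> Is \<rightarrow>\<^sub>E B" "H xs = y" "xs i = x" by (auto simp: D_def)
        then show ?thesis using mono by auto
      next
        case False
        then show ?thesis using es(3) x by auto
      qed
    qed
  qed
qed

text \<open>At most 2^(H+1) words times H + 1 \<le> 2^H parameters.\<close>

lemma card_outputs:
  "finite {(x :: bool list, k). length x + k \<le> H} \<and> card {(x :: bool list, k). length x + k \<le> H} \<le> 2 ^ (2 * H + 1)"
proof -
  let ?A = "{x :: bool list. set x \<subseteq> UNIV \<and> length x \<le> H} \<times> {..H}"
  have fin: "finite ?A" using finite_lists_length_le[of "UNIV :: bool set" H] by simp
  have sub: "{(x :: bool list, k). length x + k \<le> H} \<subseteq> ?A" by auto
  have "card {x :: bool list. set x \<subseteq> UNIV \<and> length x \<le> H} = (\<Sum>i\<le>H. 2 ^ i)"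
    using card_lists_length_le[of "UNIV :: bool set" H] by simp
  also have "\<dots> \<le> 2 ^ (H + 1)" by (induction H) auto
  finally have "card {x :: bool list. set x \<subseteq> UNIV \<and> length x \<le> H} \<le> 2 ^ (H + 1)" .
  moreover have "H + 1 \<le> 2 ^ H" by (induction H) auto
  ultimately have "card ?A \<le> 2 ^ (H + 1) * 2 ^ H"
    unfolding card_cartesian_product by (intro mult_le_mono) auto
  also have "\<dots> = 2 ^ (2 * H + 1)" by (simp add: mult_2 power_add distrib_right)
  finally show ?thesis using card_mono[OF fin sub] finite_subset[OF sub fin] by linarith
qed

section \<open>The lower bound\<close>

text \<open>For n \<le> m W the size is at most C W^k m^k / m^e, so m^e \<ge> 4 C W^k suffices; this
  makes \<open>m\<close> a large constant power of a polynomial.\<close>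

lemma size_choice:
  fixes h :: "nat \<Rightarrow> nat" and \<epsilon> :: real
  assumes h: "(\<lambda>n. real (h n)) \<in> O(\<lambda>n. real n powr (real k - \<epsilon>))" and \<epsilon>: "\<epsilon> > 0" and k: "1 \<le> k"
    and W: "poly_bounded W" "\<And>s. 1 \<le> W s"
  shows "\<exists>m. poly_bounded m \<and> (\<forall>s. 1 \<le> m s \<and> (\<forall>n. m s \<le> n \<longrightarrow> n \<le> m s * W s \<longrightarrow> 2 * h n + 1 \<le> m s ^ k))"
proof -
  obtain C where C: "C > 0" "eventually (\<lambda>n. norm (real (h n)) \<le> C * norm (real n powr (real k - \<epsilon>))) at_top"
    using landau_o.bigE[OF h] by blast
  then obtain n0 where n0: "\<And>n. n \<ge> n0 \<Longrightarrow> real (h n) \<le> C * real n powr (real k - \<epsilon>)"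
    unfolding eventually_at_top_linorder by fastforce
  \<comment> \<open>Capping at 1 keeps the exponent k - e nonnegative, so the power is monotone in
    its base.\<close>
  define e where "e = min \<epsilon> 1"
  have e: "0 < e" "e \<le> 1" "e \<le> \<epsilon>" using \<epsilon> by (auto simp: e_def)
  \<comment> \<open>From E e \<ge> 1 and m = B^E follows m^e \<ge> B.\<close>
  define E where "E = nat \<lceil>1 / e\<rceil>"
  have E: "real E \<ge> 1 / e" unfolding E_def by (simp add: of_nat_ceiling)
  have "1 / e > 0" using e by simp
  then have E0: "0 < E" using E by (metis less_le_trans of_nat_0_less_iff)
  define c where "c = nat \<lceil>4 * C\<rceil>"
  have c: "real c \<ge> 4 * C" unfolding c_def by (simp add: of_nat_ceiling)
  \<comment> \<open>\<open>n0\<close> puts n beyond the asymptotic threshold, 2 lets m^k absorb the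
    extra 1 of the goal, and \<open>c\<close> is an integer above 4C.\<close>
  define B where "B s = n0 + 2 + c * W s ^ k" for s
  define m where "m s = B s ^ E" for s
  have "poly_bounded m"
    unfolding m_def B_def using W(1) by (intro poly_bounded_intros)
  moreover have m_ge: "B s \<le> m s" for s
    unfolding m_def using E0 by (intro self_le_power) (auto simp: B_def)
  moreover have "2 * h n + 1 \<le> m s ^ k" if n: "m s \<le> n" "n \<le> m s * W s" for s n
  proof -
    have B2: "2 \<le> B s" "n0 \<le> B s" by (auto simp: B_def)
    have n1: "n0 \<le> n" "1 \<le> n" "2 \<le> m s" using B2 m_ge[of s] n(1) by linarith+
    have mpos: "0 < real (m s)" using n1(3) by simp
    have "real (h n) \<le> C * real n powr (real k - \<epsilon>)" by (rule n0[OF n1(1)])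
    also have "\<dots> \<le> C * real n powr (real k - e)"
      using n1(2) e(3) C(1) by (intro mult_left_mono powr_mono) auto
    also have "\<dots> \<le> C * (real (m s) * real (W s)) powr (real k - e)"
    proof (intro mult_left_mono powr_mono2)
      show "real n \<le> real (m s) * real (W s)" using n(2) by (metis of_nat_le_iff of_nat_mult)
    qed (use e(2) k C(1) in auto)
    also have "\<dots> = C * (real (m s) powr (real k - e) * real (W s) powr (real k - e))"
      by (simp add: powr_mult)
    also have "\<dots> \<le> C * (real (m s) powr (real k - e) * real (W s) ^ k)"
    proof -
      have "real (W s) powr (real k - e) \<le> real (W s) powr real k"
        using W(2)[of s] e(1) by (intro powr_mono) auto
      also have "\<dots> = real (W s) ^ k" using W(2)[of s] by (simp add: powr_realpow)
      finally show ?thesis using C(1) by (intro mult_left_mono) auto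
    qed
    also have "\<dots> = (C * real (W s) ^ k) * (real (m s) ^ k / real (m s) powr e)"
      using mpos by (simp add: powr_diff powr_realpow)
    finally have h1: "real (h n) \<le> (C * real (W s) ^ k) * (real (m s) ^ k / real (m s) powr e)" .
    have "4 * (C * real (W s) ^ k) \<le> real c * real (W s) ^ k"
      using c by (simp add: mult.assoc[symmetric] mult_right_mono)
    also have "\<dots> \<le> real (B s)" by (simp add: B_def)
    also have "\<dots> = real (B s) powr 1" using B2 by simp
    also have "\<dots> \<le> real (B s) powr (real E * e)"
      using B2 E e(1) by (intro powr_mono) (auto simp: field_simps)
    also have "\<dots> = real (m s) powr e"
    proof -
      have "real (m s) = real (B s) powr real E" unfolding m_def using B2 by (simp add: powr_realpow)
      then show ?thesis by (simp add: powr_powr)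
    qed
    finally have h2: "4 * (C * real (W s) ^ k) \<le> real (m s) powr e" .
    have pe: "0 < real (m s) powr e" using mpos by simp
    have "4 * real (h n) \<le> 4 * (C * real (W s) ^ k) * (real (m s) ^ k / real (m s) powr e)"
      using h1 by simp
    also have "\<dots> \<le> real (m s) powr e * (real (m s) ^ k / real (m s) powr e)"
      using h2 pe by (intro mult_right_mono) auto
    also have "\<dots> = real (m s) ^ k" using pe by simp
    finally have "real (4 * h n) \<le> real (m s ^ k)" by simp
    then have "4 * h n \<le> m s ^ k" by (simp only: of_nat_le_iff)
    moreover have "2 \<le> m s ^ k" using n1(3) self_le_power[of "m s" k] k by linarith
    ultimately show ?thesis by linarith
  qed
  moreover have "1 \<le> m s" for s using m_ge[of s] by (auto simp: B_def)
  ultimately show ?thesis by blast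
qed

lemma template_bound_mono: "n \<le> n' \<Longrightarrow> template_bound r n t \<le> template_bound r n' t"
  unfolding template_bound_def by (intro add_mono mult_mono power_mono) auto

lemma poly_bounded_template_bound:
  "poly_bounded n \<Longrightarrow> poly_bounded t \<Longrightarrow> poly_bounded (\<lambda>s. template_bound r (n s) (t s))"
  unfolding template_bound_def by (intro poly_bounded_intros)

lemma (in OR_gadget) advice_exists:
  assumes k3: "3 \<le> k" and comp: "is_compression (constrained_coloring q r R) Q' h c"
    and F: "F \<subseteq> clauses_over {..<N} 3" and N: "2 * (m * s) + k * m \<le> N" and m: "1 \<le> m"
    and L: "encodes_OR L m s k F"
    and h: "2 * h (order N) + 1 \<le> m ^ k"
  shows "\<exists>a. length a \<le> 7 * ((s + 1) * (order N + template_bound r (order N) (m ^ k * s) + m ^ k + 4)) \<and>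
    (\<forall>x. length x = s \<longrightarrow> (x \<notin> L \<longleftrightarrow>
      (\<exists>u. length u \<le> length (encode_pair (x, a)) \<and> verify c (encode_pair (x, a), u))))"
proof -
  let ?n = "order N" and ?T = "tuples {..<m} k"
  have T: "finite ?T" "card ?T = m ^ k"
    unfolding tuples_def using finite_lists_length_eq[of "{..<m}" k] card_lists_length_eq[of "{..<m}" k]
    by (simp_all add: conj_commute)
  from finite_distinct_list[OF T(1)] obtain Is where Is: "set Is = ?T" "distinct Is" by (elim exE conjE)
  have lIs: "length Is = m ^ k" using distinct_card[OF Is(2)] by (simp add: Is(1) T(2))
  have ne: "?T \<noteq> {}" using T m by (metis card.empty not_one_le_zero one_le_power)
  obtain ts where ts: "labels ts = List.product Is [0..<s]" "length ts \<le> template_bound r ?n (length Is * s)"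
    and cc: "\<And>xs. (composed ts xs, ?n) \<in> constrained_coloring q r R \<longleftrightarrow> (\<exists>\<alpha>. sat \<alpha> (F \<union> transfer_clauses m s k xs))"
    using coloring_template[OF k3 F N Is] by metis
  have Q': "c (composed ts xs, ?n) \<in> Q' \<longleftrightarrow> (\<exists>I \<in> ?T. xs I \<in> L)" if "\<forall>I \<in> ?T. length (xs I) = s" for xs
  proof -
    have "c (composed ts xs, ?n) \<in> Q' \<longleftrightarrow> (composed ts xs, ?n) \<in> constrained_coloring q r R"
      using comp by (simp add: is_compression_def)
    also have "\<dots> \<longleftrightarrow> (\<exists>\<alpha>. sat \<alpha> (F \<union> transfer_clauses m s k xs))" by (rule cc)
    also have "\<dots> \<longleftrightarrow> (\<exists>I \<in> ?T. xs I \<in> L)" using L that by (simp add: encodes_OR_def)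
    finally show ?thesis .
  qed
  define Y where "Y = {(x :: bool list, l). length x + l \<le> h ?n}"
  have H: "c (composed ts xs, ?n) \<in> Y" for xs
  proof -
    have "length (fst (c (composed ts xs, ?n))) + snd (c (composed ts xs, ?n)) \<le> h ?n"
      using comp by (simp add: is_compression_def case_prod_beta)
    then show ?thesis by (simp add: Y_def case_prod_beta)
  qed
  have Y: "finite Y" "card Y \<le> 2 ^ card ?T"
  proof -
    show "finite Y" unfolding Y_def using card_outputs by blast
    have "card Y \<le> 2 ^ (2 * h ?n + 1)" unfolding Y_def using card_outputs by blast
    also have "\<dots> \<le> 2 ^ (m ^ k)" using h by (intro power_increasing) auto
    finally show "card Y \<le> 2 ^ card ?T" by (simp add: T(2))
  qed
  define X where "X = {x. length x = s \<and> x \<notin> L}"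
  have words: "finite {x :: bool list. length x = s}" "card {x :: bool list. length x = s} = 2 ^ s"
    using finite_lists_length_eq[of "UNIV :: bool set" s] card_lists_length_eq[of "UNIV :: bool set" s] by simp_all
  have "X \<subseteq> {x. length x = s}" by (auto simp: X_def)
  from finite_subset[OF this words(1)] card_mono[OF words(1) this]
  \<comment> \<open>Strictly below 2^(s+1), so that \<open>s + 1\<close> halvings leave
    nothing.\<close>
  have X: "finite X" "card X < 2 ^ (s + 1)" by (simp_all add: words(2) le_less_trans)
  have "\<exists>es. length es \<le> s + 1 \<and>
    (\<forall>(y, i) \<in> set es. i \<in> ?T \<and> (\<exists>xs \<in> ?T \<rightarrow>\<^sub>E X. c (composed ts xs, ?n) = y)) \<and>
    (\<forall>x \<in> X. \<exists>(y, i) \<in> set es. \<exists>xs \<in> ?T \<rightarrow>\<^sub>E X. xs i = x \<and> c (composed ts xs, ?n) = y)"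
    by (rule covering_entries[OF T(1) ne X(1) Y(1) _ Y(2) subset_refl X(2)]) (rule H)
  then obtain es where es: "length es \<le> s + 1"
    "\<forall>(y, i) \<in> set es. i \<in> ?T \<and> (\<exists>xs \<in> ?T \<rightarrow>\<^sub>E X. c (composed ts xs, ?n) = y)"
    "\<forall>x \<in> X. \<exists>(y, i) \<in> set es. \<exists>xs \<in> ?T \<rightarrow>\<^sub>E X. xs i = x \<and> c (composed ts xs, ?n) = y"
    by (elim exE conjE)
  have in_X: "\<forall>I \<in> ?T. length (xs I) = s \<and> xs I \<notin> L" if "xs \<in> ?T \<rightarrow>\<^sub>E X" for xs
    using that by (auto simp: PiE_def Pi_def X_def)
  have sub: "snd ` set es \<subseteq> set Is" using es(2) Is(1) by auto
  have iff: "x \<notin> L \<longleftrightarrow> (\<exists>(z, i) \<in> set es. \<exists>xs. (\<forall>j \<in> set Is. length (xs j) = s) \<and> xs i = x \<and> c (composed ts xs, ?n) = z)"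
    if x: "length x = s" for x
  proof
    assume "x \<notin> L"
    then have "x \<in> X" using x by (simp add: X_def)
    from bspec[OF es(3) this] obtain y i xs where "(y, i) \<in> set es" "xs \<in> ?T \<rightarrow>\<^sub>E X" "xs i = x" "c (composed ts xs, ?n) = y"
      by auto
    then show "\<exists>(z, i) \<in> set es. \<exists>xs. (\<forall>j \<in> set Is. length (xs j) = s) \<and> xs i = x \<and> c (composed ts xs, ?n) = z"
      using in_X[of xs] by (intro bexI[of _ "(y, i)"]) (auto simp: Is(1))
  next
    assume "\<exists>(z, i) \<in> set es. \<exists>xs. (\<forall>j \<in> set Is. length (xs j) = s) \<and> xs i = x \<and> c (composed ts xs, ?n) = z"
    then obtain z i xs where zi: "(z, i) \<in> set es" and xs: "\<forall>j \<in> ?T. length (xs j) = s" "xs i = x"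
      "c (composed ts xs, ?n) = z" by (auto simp: Is(1))
    from bspec[OF es(2) zi] obtain xs' where i: "i \<in> ?T" and xs': "xs' \<in> ?T \<rightarrow>\<^sub>E X" "c (composed ts xs', ?n) = z" by auto
    \<comment> \<open>The stored output comes from a family of non-members, so it lies outside
      \<open>Q'\<close>; hence no family with this output contains a member, and \<open>x\<close> is
      none.\<close>
    have "z \<notin> Q'" using Q'[of xs'] in_X[OF xs'(1)] xs'(2) by auto
    then show "x \<notin> L" using Q'[OF xs(1)] xs(2,3) i by auto
  qed
  let ?a = "advice ?n ts es"
  have "length (encode_param (fst e)) \<le> m ^ k" if e: "e \<in> set es" for e
  proof -
    obtain z i where zi: "e = (z, i)" by fastforce
    have "z \<in> Y" using es(2) e H unfolding zi by auto
    moreover obtain x l where "z = (x, l)" by fastforce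
    ultimately have "length (encode_param z) \<le> 2 * h ?n + 1"
      by (simp add: Y_def length_concat comp_def sum_list_triv unary_def)
    then show ?thesis using h by (simp add: zi)
  qed
  then have "length ?a \<le> 7 * (length es * (?n + length ts + m ^ k + 4))" by (rule length_advice)
  also have "\<dots> \<le> 7 * ((s + 1) * (?n + template_bound r ?n (m ^ k * s) + m ^ k + 4))"
    using es(1) ts(2) by (intro mult_le_mono add_mono) (auto simp: lIs)
  finally have "length ?a \<le> 7 * ((s + 1) * (?n + template_bound r ?n (m ^ k * s) + m ^ k + 4))" .
  moreover have "x \<notin> L \<longleftrightarrow> (\<exists>u. length u \<le> length (encode_pair (x, ?a)) \<and> verify c (encode_pair (x, ?a), u))"
    if "length x = s" for x
    unfolding iff[OF that] using verify_advice[OF ts(1) Is(2) sub that, of ?n c] by (rule sym)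
  ultimately show ?thesis by blast
qed

theorem theorem1p2:
  fixes q r k :: nat and R :: "nat list set" and \<epsilon> :: real
  assumes "q \<ge> 1" and "r \<ge> 1" and "k \<ge> 3"
    and "R \<subseteq> tuples {1..q} r"
    and "permutation_invariant q r R"
    and "OR_definable q r R k"
    and "\<epsilon> > 0"
  shows "\<not> NP \<subseteq> with_poly_advice coNP \<longrightarrow>
    \<not> admits_compression_bigo (constrained_coloring q r R) (\<lambda>n. real n powr (real k - \<epsilon>))"
proof (rule impI, rule notI, erule notE, rule subsetI)
  fix L
  assume "admits_compression_bigo (constrained_coloring q r R) (\<lambda>n. real n powr (real k - \<epsilon>))"
    and L: "L \<in> NP"
  then obtain h Q' c where h: "(\<lambda>n. real (h n)) \<in> O(\<lambda>n. real n powr (real k - \<epsilon>))"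
    and comp: "is_compression (constrained_coloring q r R) Q' h c"
    unfolding admits_compression_bigo_def admits_compression_def by blast
  have k1: "1 \<le> k" using assms(3) by simp
  obtain J f g where "OR_gadget q r k R J f g"
    using OR_gadget_exists[OF assms(1) k1 assms(4-6)] by blast
  then interpret OR_gadget q r k R J f g .
  from OR_CNF[OF L k1] obtain P where P: "poly_bounded P"
    and cnf: "\<forall>s m. 1 \<le> m \<longrightarrow> (\<exists>N F. F \<subseteq> clauses_over {..<N} 3 \<and> 2 * (m * s) + k * m \<le> N \<and> N \<le> m * P s \<and>
      encodes_OR L m s k F)"
    by (elim exE conjE)
  \<comment> \<open>Since \<open>m s\<close> is at least 1, \<open>N \<le> m s * P s\<close> gives
    \<open>order N \<le> m s * W s\<close>.\<close>
  define W where "W s = q + 2 * r * P s" for s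
  have W: "poly_bounded W" "\<And>s. 1 \<le> W s"
    unfolding W_def using P assms(1) by (auto intro!: poly_bounded_intros)
  from size_choice[OF h assms(7) k1 W] obtain m where m: "poly_bounded m"
    and m_size: "\<forall>s. 1 \<le> m s \<and> (\<forall>n. m s \<le> n \<longrightarrow> n \<le> m s * W s \<longrightarrow> 2 * h n + 1 \<le> m s ^ k)"
    by (elim exE conjE)
  then have m1: "1 \<le> m s" and size: "m s \<le> n \<Longrightarrow> n \<le> m s * W s \<Longrightarrow> 2 * h n + 1 \<le> m s ^ k" for s n
    by simp_all
  define b where "b s = 7 * ((s + 1) * (m s * W s + template_bound r (m s * W s) (m s ^ k * s) + m s ^ k + 4))" for s
  have "poly_bounded b"
    unfolding b_def by (intro poly_bounded_intros poly_bounded_template_bound m W)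
  then obtain p where p: "\<And>s. b s \<le> poly p s" unfolding poly_bounded_def by blast
  have "\<forall>s. \<exists>a. length a \<le> b s \<and> (\<forall>x. length x = s \<longrightarrow> (x \<notin> L \<longleftrightarrow>
      (\<exists>u. length u \<le> length (encode_pair (x, a)) \<and> verify c (encode_pair (x, a), u))))"
  proof
    fix s
    from cnf[rule_format, OF m1[of s], of s] obtain N F where F: "F \<subseteq> clauses_over {..<N} 3"
      and N: "2 * (m s * s) + k * m s \<le> N" "N \<le> m s * P s"
      and or_cnf: "encodes_OR L (m s) s k F"
      by (elim exE conjE)
    have "m s \<le> k * m s" using k1 by simp
    also have "\<dots> \<le> N" using N(1) by simp
    also have "\<dots> \<le> 2 * r * N" using r_pos by simp
    finally have n1: "m s \<le> order N" by (simp add: order_def)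
    have "order N \<le> q + 2 * r * (m s * P s)" using N(2) by (simp add: order_def)
    also have "\<dots> \<le> m s * q + 2 * r * (m s * P s)" using m1[of s] by simp
    also have "\<dots> = m s * W s" by (simp add: W_def algebra_simps)
    finally have n2: "order N \<le> m s * W s" .
    from advice_exists[OF assms(3) comp F N(1) m1 or_cnf size[OF n1 n2]]
    obtain a where a: "length a \<le> 7 * ((s + 1) * (order N + template_bound r (order N) (m s ^ k * s) + m s ^ k + 4))"
      "\<forall>x. length x = s \<longrightarrow> (x \<notin> L \<longleftrightarrow>
        (\<exists>u. length u \<le> length (encode_pair (x, a)) \<and> verify c (encode_pair (x, a), u)))"
      by (elim exE conjE)
    note a(1)
    also have "7 * ((s + 1) * (order N + template_bound r (order N) (m s ^ k * s) + m s ^ k + 4)) \<le> b s"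
      unfolding b_def using n2 template_bound_mono[OF n2] by (intro mult_le_mono add_mono) auto
    finally show "\<exists>a. length a \<le> b s \<and> (\<forall>x. length x = s \<longrightarrow> (x \<notin> L \<longleftrightarrow>
      (\<exists>u. length u \<le> length (encode_pair (x, a)) \<and> verify c (encode_pair (x, a), u))))"
      using a(2) by (intro exI[of _ a] conjI)
  qed
  from choice[OF this] obtain a where a: "\<forall>s. length (a s) \<le> b s \<and> (\<forall>x. length x = s \<longrightarrow> (x \<notin> L \<longleftrightarrow>
      (\<exists>u. length u \<le> length (encode_pair (x, a s)) \<and> verify c (encode_pair (x, a s), u))))"
    by (elim exE)
  \<comment> \<open>The coNP language behind the advice: its complement asks for a witness no longer
    than the word, checked by \<open>verify c\<close>.\<close>
  define L' where "L' = {w. \<not> (\<exists>u. length u \<le> length w \<and> verify c (w, u))}"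
  have "poly_time_computable encode_pair encode_bool (verify c)"
    using comp by (intro poly_time_verify) (simp add: is_compression_def)
  then have "- L' \<in> NP"
    unfolding NP_def L'_def
    by (intro CollectI exI[of _ "verify c"] exI[of _ "[:0, 1:]"]) simp
  moreover have "length (a s) \<le> poly p s" for s using a p[of s] by (meson order_trans)
  moreover have "x \<in> L \<longleftrightarrow> encode_pair (x, a (length x)) \<in> L'" for x
    unfolding L'_def mem_Collect_eq using a by (metis (no_types, lifting))
  ultimately show "L \<in> with_poly_advice coNP"
    unfolding with_poly_advice_def coNP_def by blast
qed

end
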